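(* (i) Let $\mathcal{S}=\mathcal{Q}(5,q)$, $\mathcal{S}'=\mathcal{Q}(4,q)$, $\mathcal{A}=\mathcal{S}\setminus\mathcal{S}'$, and let $\gamma:\mathcal{A}\mapsto\mathcal{E}$ be a $\theta$-cover (with $\theta=2$), with associated automorphism $\sigma^*$ of $\mathcal{S}'$. Then there exists an automorphism $\sigma$ of $\mathcal{Q}(5,q)$ with $\sigma^*$ the restriction of $\sigma$ to $\mathcal{Q}(4,q)$. (ii) Let $\mathcal{S}=\mathcal{H}(4,q^2)$, $\mathcal{S}'=\mathcal{H}(3,q^2)$, $\mathcal{A}=\mathcal{S}\setminus\mathcal{S}'$, and let $\gamma:\mathcal{A}\mapsto\mathcal{E}$ be a $\theta$-cover (with $\theta=q+1$), with associated automorphism $\sigma^*$ of $\mathcal{S}'$. Then there exists an automorphism $\sigma$ of $\mathcal{H}(4,q^2)$ with $\sigma^*$ the restriction of $\sigma$ to $\mathcal{H}(3,q^2)$.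
   Context: $q$ is a prime power. $\mathcal{Q}(5,q)$ is the generalized quadrangle of points and lines of a nonsingular elliptic quadric in $\mathbf{PG}(5,q)$, and $\mathcal{Q}(4,q)$ its subquadrangle obtained by intersecting with a nontangent hyperplane. $\mathcal{H}(4,q^2)$ is the generalized quadrangle of points and lines of a nonsingular Hermitian variety in $\mathbf{PG}(4,q^2)$, and $\mathcal{H}(3,q^2)$ its subquadrangle obtained by intersecting with a nontangent hyperplane. The geometry $\mathcal{A}=\mathcal{S}\setminus\mathcal{S}'$ consists of the points and lines of $\mathcal{S}$ not in $\mathcal{S}'$, with induced incidence. For a point $x$ of $\mathcal{S}\setminus\mathcal{S}'$, the set $\mathcal{O}_x$ of points of $\mathcal{S}'$ collinear with $x$ is an ovoid of $\mathcal{S}'$ (a point set meeting each line of $\mathcal{S}'$ exactly once), said to be subtended by $x$; in these examples each subtended ovoid is subtended by exactly $\theta$ points ($\theta=2$, resp. $\theta=q+1$). For a line $L$ of $\mathcal{A}$, the rosette $R_L$ is the set of ovoids $\mathcal{O}_x$ with $x$ a point of $\mathcal{A}$ on $L$; its ovoids share the point $L\cap\mathcal{S}'$. $\mathcal{E}$ is the geometry with points the subtended ovoids, lines the rosettes, and incidence containment. A cover is an incidence-preserving map sending points to points and lines to lines which induces a bijection from the lines on each point $x$ to the lines on its image, and from the points on each line to the points on its image; it is a $\theta$-cover if all point fibers and line fibers have size $\theta$. Associated automorphism: for a $\theta$-cover $\gamma:\mathcal{A}\mapsto\mathcal{E}$ and a point $x$ of $\mathcal{S}'$, let $x^*$ be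 the set of all lines $N$ of $\mathcal{A}$ such that $\gamma(N)$ is a rosette whose ovoids share the point $x$. All lines of $x^*$ are incident in $\mathcal{S}$ with a common point $x^{**}$ of $\mathcal{S}'$ and, identifying $x^*$ with $x^{**}$, the map $\sigma^*: x^{**}\mapsto x$ defines an automorphism of $\mathcal{S}'$. *)

theory Defs
  imports "HOL-Analysis.Analysis"
begin

section \<open>Incidence geometries, covers, automorphisms\<close>

record ('p, 'l) geometry =
  pts :: "'p set"
  lns :: "'l set"
  inc :: "'p \<Rightarrow> 'l \<Rightarrow> bool"

definition collinear_in :: "('p, 'l) geometry \<Rightarrow> 'p \<Rightarrow> 'p \<Rightarrow> bool" where
  "collinear_in G x y \<longleftrightarrow> (\<exists>L\<in>lns G. inc G x L \<and> inc G y L)"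

text \<open>A map between geometries is a pair consisting of its action on points and its action on lines.\<close>

definition cover ::
  "('p, 'l) geometry \<Rightarrow> ('r, 'm) geometry \<Rightarrow> ('p \<Rightarrow> 'r) \<Rightarrow> ('l \<Rightarrow> 'm) \<Rightarrow> bool" where
  "cover G G' f g \<longleftrightarrow>
     f ` pts G \<subseteq> pts G' \<and> g ` lns G \<subseteq> lns G' \<and>
     (\<forall>x\<in>pts G. \<forall>L\<in>lns G. inc G x L \<longrightarrow> inc G' (f x) (g L)) \<and>
     (\<forall>x\<in>pts G. bij_betw g {L\<in>lns G. inc G x L} {M\<in>lns G'. inc G' (f x) M}) \<and>
     (\<forall>L\<in>lns G. bij_betw f {x\<in>pts G. inc G x L} {y\<in>pts G'. inc G' y (g L)})"

definition theta_cover ::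
  "nat \<Rightarrow> ('p, 'l) geometry \<Rightarrow> ('r, 'm) geometry \<Rightarrow> ('p \<Rightarrow> 'r) \<Rightarrow> ('l \<Rightarrow> 'm) \<Rightarrow> bool" where
  "theta_cover \<theta> G G' f g \<longleftrightarrow> cover G G' f g \<and>
     (\<forall>y\<in>pts G'. card {x\<in>pts G. f x = y} = \<theta>) \<and>
     (\<forall>M\<in>lns G'. card {L\<in>lns G. g L = M} = \<theta>)"

definition automorphism :: "('p, 'l) geometry \<Rightarrow> ('p \<Rightarrow> 'p) \<Rightarrow> ('l \<Rightarrow> 'l) \<Rightarrow> bool" where
  "automorphism G f g \<longleftrightarrow> bij_betw f (pts G) (pts G) \<and> bij_betw g (lns G) (lns G) \<and>
     (\<forall>x\<in>pts G. \<forall>L\<in>lns G. inc G x L \<longleftrightarrow> inc G (f x) (g L))"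


section \<open>Subtended ovoids, rosettes, and the associated map\<close>

definition geometry_diff :: "('p, 'l) geometry \<Rightarrow> ('p, 'l) geometry \<Rightarrow> ('p, 'l) geometry" where
  "geometry_diff S S' = \<lparr>pts = pts S - pts S', lns = lns S - lns S', inc = inc S\<rparr>"

definition subtended :: "('p, 'l) geometry \<Rightarrow> ('p, 'l) geometry \<Rightarrow> 'p \<Rightarrow> 'p set" where
  "subtended S S' x = {y\<in>pts S'. collinear_in S x y}"

definition rosette :: "('p, 'l) geometry \<Rightarrow> ('p, 'l) geometry \<Rightarrow> 'l \<Rightarrow> 'p set set" where
  "rosette S S' L = subtended S S' ` {x\<in>pts (geometry_diff S S'). inc S x L}"

definition ovoid_geometry ::
  "('p, 'l) geometry \<Rightarrow> ('p, 'l) geometry \<Rightarrow> ('p set, 'p set set) geometry" where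
  "ovoid_geometry S S' =
     \<lparr>pts = subtended S S' ` pts (geometry_diff S S'),
      lns = rosette S S' ` lns (geometry_diff S S'),
      inc = (\<in>)\<rparr>"

text \<open>For \<open>\<gamma>\<close> acting on lines by \<open>g\<close>, \<open>star S S' g x\<close> is $x^*$, \<open>star_point S S' g x\<close> is $x^{**}$,
  and \<open>assoc_map S S' g\<close> is the point map $\sigma^*: x^{**} \mapsto x$.
  The uniqueness needed for the definite descriptions, and the fact that $\sigma^*$ is an
  automorphism of $S'$, are consequences of \<open>\<gamma>\<close> being a cover and are nowhere assumed.\<close>

definition star :: "('p, 'l) geometry \<Rightarrow> ('p, 'l) geometry \<Rightarrow> ('l \<Rightarrow> 'p set set) \<Rightarrow> 'p \<Rightarrow> 'l set" where
  "star S S' g x = {N\<in>lns (geometry_diff S S'). \<forall>\<O>\<in>g N. x \<in> \<O>}"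

definition star_point :: "('p, 'l) geometry \<Rightarrow> ('p, 'l) geometry \<Rightarrow> ('l \<Rightarrow> 'p set set) \<Rightarrow> 'p \<Rightarrow> 'p" where
  "star_point S S' g x = (THE y. y \<in> pts S' \<and> (\<forall>N\<in>star S S' g x. inc S y N))"

definition assoc_map :: "('p, 'l) geometry \<Rightarrow> ('p, 'l) geometry \<Rightarrow> ('l \<Rightarrow> 'p set set) \<Rightarrow> 'p \<Rightarrow> 'p" where
  "assoc_map S S' g y = (THE x. x \<in> pts S' \<and> star_point S S' g x = y)"


section \<open>Quadrics and Hermitian varieties in projective space\<close>

text \<open>The projective space is that of the vector space \<open>'a^'n\<close>: its points and lines are the vector
  subspaces of dimension 1 and 2. Both kinds of variety are described by a function \<open>F\<close> on vectors
  (a quadratic form, or \<open>\<lambda>x. h x x\<close> for a Hermitian form \<open>h\<close>) whose zeros are the vectors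
  representing points of the variety.\<close>

definition variety_geometry ::
  "('a::field^'n \<Rightarrow> 'a) \<Rightarrow> (('a^'n) set, ('a^'n) set) geometry" where
  "variety_geometry F =
     \<lparr>pts = {p. vec.subspace p \<and> vec.dim p = 1 \<and> (\<forall>x\<in>p. F x = 0)},
      lns = {L. vec.subspace L \<and> vec.dim L = 2 \<and> (\<forall>x\<in>L. F x = 0)},
      inc = (\<subseteq>)\<rparr>"

definition section_geometry ::
  "('a::field^'n \<Rightarrow> 'a) \<Rightarrow> ('a^'n) set \<Rightarrow> (('a^'n) set, ('a^'n) set) geometry" where
  "section_geometry F H =
     \<lparr>pts = {p\<in>pts (variety_geometry F). p \<subseteq> H},
      lns = {L\<in>lns (variety_geometry F). L \<subseteq> H},
      inc = (\<subseteq>)\<rparr>"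

text \<open>The tangent hyperplane at the point spanned by \<open>x\<close> is the set of \<open>y\<close> with \<open>b x y = 0\<close>, where
  \<open>b\<close> is the polar form of the quadratic form, respectively the Hermitian form itself.\<close>

definition nontangent_hyperplane ::
  "('a::field^'n \<Rightarrow> 'a) \<Rightarrow> ('a^'n \<Rightarrow> 'a^'n \<Rightarrow> 'a) \<Rightarrow> ('a^'n) set \<Rightarrow> bool" where
  "nontangent_hyperplane F b H \<longleftrightarrow>
     vec.subspace H \<and> vec.dim H = CARD('n) - 1 \<and>
     \<not> (\<exists>x. x \<noteq> 0 \<and> F x = 0 \<and> H = {y. b x y = 0})"

definition polar_form :: "('a::field^'n \<Rightarrow> 'a) \<Rightarrow> 'a^'n \<Rightarrow> 'a^'n \<Rightarrow> 'a" where
  "polar_form Q x y = Q (x + y) - Q x - Q y"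

definition quadratic_form :: "('a::field^'n \<Rightarrow> 'a) \<Rightarrow> bool" where
  "quadratic_form Q \<longleftrightarrow> (\<forall>c x. Q (c *s x) = c\<^sup>2 * Q x) \<and>
     (\<forall>x y z. polar_form Q (x + y) z = polar_form Q x z + polar_form Q y z) \<and>
     (\<forall>c x z. polar_form Q (c *s x) z = c * polar_form Q x z)"

text \<open>Nonsingular: no point of the quadric is singular. In characteristic 2 the polar form may be
  degenerate as long as its radical contains no point of the quadric.\<close>

definition nonsingular_quadric :: "('a::field^'n \<Rightarrow> 'a) \<Rightarrow> bool" where
  "nonsingular_quadric Q \<longleftrightarrow> quadratic_form Q \<and>
     (\<forall>x. Q x = 0 \<and> (\<forall>y. polar_form Q x y = 0) \<longrightarrow> x = 0)"

definition witt_index :: "('a::field^'n \<Rightarrow> 'a) \<Rightarrow> nat" where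
  "witt_index Q = Max (vec.dim ` {W. vec.subspace W \<and> (\<forall>x\<in>W. Q x = 0)})"

text \<open>A nonsingular quadric in $\mathbf{PG}(2m-1,q)$ is elliptic if its projective index (the largest
  projective dimension of a subspace on it) is $m-2$, hyperbolic if it is $m-1$. For
  $\mathbf{PG}(5,q)$ elliptic thus means projective index 1, i.e. Witt index 2.\<close>

definition elliptic_quadric :: "('a::field^'n \<Rightarrow> 'a) \<Rightarrow> bool" where
  "elliptic_quadric Q \<longleftrightarrow> nonsingular_quadric Q \<and> 2 * witt_index Q + 2 = CARD('n)"

text \<open>To be used over a field with $q^2$ elements, whose involution is $c \mapsto c^q$.\<close>

definition hermitian_form :: "nat \<Rightarrow> ('a::field^'n \<Rightarrow> 'a^'n \<Rightarrow> 'a) \<Rightarrow> bool" where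
  "hermitian_form q h \<longleftrightarrow>
     (\<forall>x y z. h (x + y) z = h x z + h y z) \<and>
     (\<forall>c x z. h (c *s x) z = c * h x z) \<and>
     (\<forall>x y. h y x = h x y ^ q)"

definition nonsingular_hermitian :: "nat \<Rightarrow> ('a::field^'n \<Rightarrow> 'a^'n \<Rightarrow> 'a) \<Rightarrow> bool" where
  "nonsingular_hermitian q h \<longleftrightarrow> hermitian_form q h \<and> (\<forall>x. (\<forall>y. h x y = 0) \<longrightarrow> x = 0)"


section \<open>Extension of the associated automorphism\<close>

text \<open>\<open>\<sigma>\<close> and \<open>\<tau>\<close> are the actions on points and lines of an automorphism of \<open>S\<close> that restricts to an
  automorphism of \<open>S'\<close>, the restriction having \<open>\<sigma>s\<close> as its action on points. A line of a generalized
  quadrangle is determined by its points, so the point map determines the restriction.\<close>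

definition extends_to_automorphism ::
  "('p, 'l) geometry \<Rightarrow> ('p, 'l) geometry \<Rightarrow> ('p \<Rightarrow> 'p) \<Rightarrow> bool" where
  "extends_to_automorphism S S' \<sigma>s \<longleftrightarrow>
     (\<exists>\<sigma> \<tau>. automorphism S \<sigma> \<tau> \<and> automorphism S' \<sigma> \<tau> \<and> (\<forall>y\<in>pts S'. \<sigma>s y = \<sigma> y))"

end

theory Submission
  imports Defs "HOL-Computational_Algebra.Polynomial"
begin

text \<open>The proof has a combinatorial and a linear part. Let \<open>A\<close> be the geometry \<open>S \<setminus> S'\<close>. Every line
  \<open>N\<close> of \<open>A\<close> has exactly one point in \<open>S'\<close>, its trace, and the ovoids of the rosette \<open>\<gamma>(N)\<close> have exactly one
  common point, its base. Since generalized quadrangles have no triangles, lines with the same base have the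
  same trace (\<open>base_eq_imp_trace_eq\<close>). Hence the associated map \<open>\<sigma>*\<close>, which sends the trace of \<open>N\<close> to the base of
  \<open>\<gamma>(N)\<close>, is a permutation of the points of \<open>S'\<close>, and \<open>\<gamma>(y)\<close> is the image under \<open>\<sigma>*\<close> of the ovoid subtended by
  \<open>y\<close>. So \<open>\<sigma>*\<close> permutes subtended ovoids; as any two noncollinear points of \<open>S'\<close> lie in a common one, it also
  preserves collinearity. In short, for every point \<open>x\<close> of \<open>S\<close>, inside \<open>S'\<close> or not, \<open>\<sigma>*\<close> maps the set of points of
  \<open>S'\<close> perpendicular to \<open>x\<close> onto a set of the same kind (\<open>assoc_coll\<close>, \<open>assoc_subtended\<close>).

  The linear part shows that such a map comes from a semilinear similitude of the whole space; it is the same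
  for both kinds of variety (locale \<open>polar_space\<close>). Choose in the hyperplane \<open>H\<close> a quadrilateral
  \<open>w1, w2, w3, w4\<close> of singular vectors, adjacent ones orthogonal and opposite ones not. For a singular vector \<open>x\<close>
  the ratio of its scalar products with two adjacent \<open>w\<close>'s is visible as the point of their line that is
  perpendicular to \<open>x\<close>, so \<open>\<sigma>*\<close> acts on such ratios. The form represents enough values on the orthogonal
  complement of the \<open>w\<close>'s for every quadruple of scalar products to occur, if \<open>x\<close> may lie outside \<open>H\<close>; this is where
  the subtended ovoids enter. The four ratios have product 1 and are otherwise arbitrary, hence all four are
  transformed by one multiplicative map \<open>\<tau>\<close> (\<open>coord_auto_exists\<close>), and the vectors perpendicular to
  \<open>w1 + w2 + w3 + w4\<close> show that \<open>\<tau>\<close> is additive (\<open>tau_complement\<close>). Thus \<open>\<sigma>*\<close> is \<open>\<tau>\<close>-semilinear on the span of the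
  \<open>w\<close>'s.

  For Hermitian varieties this span is all of \<open>H\<close>. For quadrics one dimension is missing, spanned by a vector \<open>g\<close>,
  and on it \<open>\<sigma>*\<close> is known up to a sign that a priori depends on the point. The sign does not change between
  collinear points, and the points off the span of the \<open>w\<close>'s correspond to the \<open>2 \<times> 2\<close> matrices of a fixed nonzero
  determinant, which are connected by elementary row and column operations (\<open>good_all\<close>). In both cases the
  image of a single point outside \<open>H\<close> then extends the semilinear map to a similitude \<open>T\<close> of the whole space
  (\<open>F_T\<close>, \<open>Phi_eq_T\<close>), and the action of \<open>T\<close> on subspaces is the required automorphism.\<close>

section \<open>Covers of the complement of a subquadrangle\<close>

text \<open>What the combinatorial part draws from the two varieties: \<open>S\<close> is a
  finite generalized quadrangle with thick lines, and \<open>S'\<close> is a full subgeometry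
  with at least two lines on each point, which every other line of \<open>S\<close> meets in a
  single point.\<close>

locale gq_hyperplane =
  fixes S S' :: "('p, 'l) geometry"
  assumes finite_pts: "finite (pts S)" and finite_lns: "finite (lns S)"
    and line_unique: "\<lbrakk>L \<in> lns S; M \<in> lns S; p \<in> pts S; r \<in> pts S; p \<noteq> r;
          inc S p L; inc S r L; inc S p M; inc S r M\<rbrakk> \<Longrightarrow> L = M"
    and proj_exists: "\<lbrakk>p \<in> pts S; L \<in> lns S; \<not> inc S p L\<rbrakk> \<Longrightarrow>
          \<exists>r\<in>pts S. inc S r L \<and> collinear_in S p r"
    and proj_unique: "\<lbrakk>p \<in> pts S; L \<in> lns S; \<not> inc S p L; r \<in> pts S; s \<in> pts S; inc S r L;
          inc S s L; collinear_in S p r; collinear_in S p s\<rbrakk> \<Longrightarrow> r = s"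
    and thick: "L \<in> lns S \<Longrightarrow> \<exists>p\<in>pts S. \<exists>r\<in>pts S. \<exists>s\<in>pts S.
          p \<noteq> r \<and> p \<noteq> s \<and> r \<noteq> s \<and> inc S p L \<and> inc S r L \<and> inc S s L"
    and sub_pts: "pts S' \<subseteq> pts S"
    and sub_lns: "lns S' = {L \<in> lns S. \<forall>p\<in>pts S. inc S p L \<longrightarrow> p \<in> pts S'}"
    and meets: "\<lbrakk>L \<in> lns S; L \<notin> lns S'\<rbrakk> \<Longrightarrow> \<exists>!p. p \<in> pts S' \<and> inc S p L"
    and two_lines: "p \<in> pts S' \<Longrightarrow> \<exists>L\<in>lns S'. \<exists>M\<in>lns S'. L \<noteq> M \<and> inc S p L \<and> inc S p M"
    and off_point: "pts S - pts S' \<noteq> {}"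
    and on_point: "pts S' \<noteq> {}"
begin

abbreviation "A \<equiv> geometry_diff S S'"
abbreviation "E \<equiv> ovoid_geometry S S'"
abbreviation "Ov \<equiv> subtended S S'"
abbreviation "R \<equiv> rosette S S'"
abbreviation coll (infix "\<bowtie>" 50) where "x \<bowtie> y \<equiv> collinear_in S x y"

definition trace where "trace L = (THE p. p \<in> pts S' \<and> inc S p L)"

definition lines_on where "lines_on x = {L \<in> lns S. inc S x L}"

lemma A_simps [simp]: "pts A = pts S - pts S'" "lns A = lns S - lns S'" "inc A = inc S"
  by (simp_all add: geometry_diff_def)

lemma E_simps [simp]: "pts E = Ov ` (pts S - pts S')" "lns E = R ` (lns S - lns S')" "inc E = (\<in>)"
  by (simp_all add: ovoid_geometry_def)

lemma coll_sym: "x \<bowtie> y \<Longrightarrow> y \<bowtie> x"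
  by (auto simp: collinear_in_def)

lemma collI: "\<lbrakk>L \<in> lns S; inc S x L; inc S y L\<rbrakk> \<Longrightarrow> x \<bowtie> y"
  by (auto simp: collinear_in_def)

lemma trace: "L \<in> lns S - lns S' \<Longrightarrow> trace L \<in> pts S'" "L \<in> lns S - lns S' \<Longrightarrow> inc S (trace L) L"
  using theI'[OF meets, of L] by (auto simp: trace_def)

lemma trace_eq: "\<lbrakk>L \<in> lns S - lns S'; p \<in> pts S'; inc S p L\<rbrakk> \<Longrightarrow> trace L = p"
  using meets[of L] trace[of L] by auto

lemma no_triangle: "\<lbrakk>L \<in> lns S; p \<in> pts S; r \<in> pts S; s \<in> pts S; r \<noteq> s; inc S r L; inc S s L; p \<bowtie> r; p \<bowtie> s\<rbrakk>
    \<Longrightarrow> inc S p L"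
  using proj_unique by blast

lemma line_off: "\<lbrakk>x \<in> pts S - pts S'; L \<in> lns S; inc S x L\<rbrakk> \<Longrightarrow> L \<in> lns S - lns S'"
  by (auto simp: sub_lns)

lemma mem_Ov: "y \<in> Ov x \<longleftrightarrow> y \<in> pts S' \<and> x \<bowtie> y"
  by (simp add: subtended_def)

lemma trace_in_Ov: "\<lbrakk>x \<in> pts S - pts S'; L \<in> lns S; inc S x L\<rbrakk> \<Longrightarrow> trace L \<in> Ov x"
  using line_off[of x L] trace[of L] by (auto simp: mem_Ov intro: collI)

lemma Ov_trace:
  assumes "x \<in> pts S - pts S'" "y \<in> Ov x"
  obtains L where "L \<in> lns S - lns S'" "inc S x L" "trace L = y"
proof -
  obtain L where "L \<in> lns S" "inc S x L" "inc S y L"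
    using assms by (auto simp: mem_Ov collinear_in_def)
  then show ?thesis
    using that[of L] line_off[of x L] trace_eq[of L y] assms by (auto simp: mem_Ov)
qed

lemma two_off_points:
  assumes L: "L \<in> lns S - lns S'"
  obtains x y where "x \<in> pts S - pts S'" "y \<in> pts S - pts S'" "x \<noteq> y" "inc S x L" "inc S y L"
proof -
  obtain p r s where *: "p \<in> pts S" "r \<in> pts S" "s \<in> pts S" "p \<noteq> r" "p \<noteq> s" "r \<noteq> s"
    "inc S p L" "inc S r L" "inc S s L" using thick[of L] L by auto
  moreover have "z \<in> pts S' \<Longrightarrow> inc S z L \<Longrightarrow> z = trace L" for z
    using trace_eq[OF L] by auto
  ultimately have "(p \<in> pts S - pts S' \<and> r \<in> pts S - pts S') \<or> (p \<in> pts S - pts S' \<and> s \<in> pts S - pts S')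
      \<or> (r \<in> pts S - pts S' \<and> s \<in> pts S - pts S')"
    by (metis Diff_iff)
  then show ?thesis using that[of p r] that[of p s] that[of r s] * by blast
qed

text \<open>Otherwise the line through \<open>u\<close> and \<open>v\<close> would contain
  \<open>w\<close>, because there are no triangles, and would be a line off \<open>S'\<close>
  with two points in \<open>S'\<close>.\<close>

lemma Ov_noncoll:
  assumes "w \<in> pts S - pts S'" "u \<in> Ov w" "v \<in> Ov w" "u \<bowtie> v"
  shows "u = v"
proof (rule ccontr)
  assume "u \<noteq> v"
  obtain K where K: "K \<in> lns S" "inc S u K" "inc S v K"
    using assms by (auto simp: collinear_in_def)
  have uv: "u \<in> pts S'" "v \<in> pts S'" "w \<bowtie> u" "w \<bowtie> v" using assms by (auto simp: mem_Ov)
  then have "inc S w K"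
    using no_triangle[of K w u v] K \<open>u \<noteq> v\<close> assms(1) sub_pts by auto
  then have "K \<in> lns S - lns S'" using line_off assms(1) K by auto
  then show False using trace_eq K uv \<open>u \<noteq> v\<close> by metis
qed

lemma trace_inj: "x \<in> pts S - pts S' \<Longrightarrow> inj_on trace (lines_on x)"
proof (rule inj_onI)
  fix L M assume x: "x \<in> pts S - pts S'" and LM: "L \<in> lines_on x" "M \<in> lines_on x" "trace L = trace M"
  have "L \<in> lns S - lns S'" "M \<in> lns S - lns S'" using line_off[OF x] LM by (auto simp: lines_on_def)
  then show "L = M" using trace[of L] trace[of M] x LM line_unique[of L M x "trace L"] sub_pts
    by (auto simp: lines_on_def)
qed

lemma trace_lines_on: "x \<in> pts S - pts S' \<Longrightarrow> trace ` lines_on x = Ov x"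
proof (intro equalityI subsetI)
  fix y assume "x \<in> pts S - pts S'" "y \<in> Ov x"
  then obtain L where "L \<in> lns S - lns S'" "inc S x L" "trace L = y" using Ov_trace by metis
  then show "y \<in> trace ` lines_on x" unfolding lines_on_def by blast
qed (auto simp: lines_on_def trace_in_Ov)

lemma card_Ov: "x \<in> pts S - pts S' \<Longrightarrow> card (Ov x) = card (lines_on x)"
  using trace_lines_on card_image[OF trace_inj] by metis

text \<open>A line \<open>L\<close> on \<open>x\<close> is sent to the line on \<open>y\<close>
  that meets \<open>L\<close>.\<close>

lemma card_lines_on_le:
  assumes xy: "x \<in> pts S" "y \<in> pts S" "\<not> x \<bowtie> y"
  shows "card (lines_on x) \<le> card (lines_on y)"
proof -
  have "\<exists>M. M \<in> lines_on y \<and> (\<exists>p\<in>pts S. inc S p L \<and> inc S p M)" if "L \<in> lines_on x" for L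
  proof -
    have LS: "L \<in> lns S" "inc S x L" using that by (auto simp: lines_on_def)
    then have "\<not> inc S y L" using xy collI[of L x y] by auto
    from proj_exists[OF xy(2) LS(1) this] obtain r M where
      "r \<in> pts S" "inc S r L" "M \<in> lns S" "inc S y M" "inc S r M"
      unfolding collinear_in_def by blast
    then show ?thesis by (auto simp: lines_on_def)
  qed
  then obtain f where f: "\<And>L. L \<in> lines_on x \<Longrightarrow> f L \<in> lines_on y \<and> (\<exists>p\<in>pts S. inc S p L \<and> inc S p (f L))"
    by metis
  have "inj_on f (lines_on x)"
  proof (rule inj_onI)
    fix L L' assume L: "L \<in> lines_on x" "L' \<in> lines_on x" "f L = f L'"
    let ?M = "f L"
    have M: "?M \<in> lns S" "inc S y ?M" using f[OF L(1)] by (auto simp: lines_on_def)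
    have L2: "L \<in> lns S" "L' \<in> lns S" "inc S x L" "inc S x L'" using L by (auto simp: lines_on_def)
    obtain p p' where p: "p \<in> pts S" "inc S p L" "inc S p ?M" "p' \<in> pts S" "inc S p' L'" "inc S p' ?M"
      using f[OF L(1)] f[OF L(2)] L(3) by auto
    have nx: "\<not> inc S x ?M" using collI[of ?M x y] M xy by auto
    have "p = p'"
      using proj_unique[of x ?M p p'] nx M xy p L2 collI[of L x p] collI[of L' x p'] by auto
    moreover have "p \<noteq> x" using p nx by auto
    ultimately show "L = L'" using line_unique[of L L' x p] L2 p xy by auto
  qed
  moreover have "f ` lines_on x \<subseteq> lines_on y" using f by auto
  moreover have "finite (lines_on y)" using finite_lns by (auto simp: lines_on_def)
  ultimately show ?thesis by (rule card_inj_on_le)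
qed

text \<open>The points may be collinear, so they are compared through a third one:
  \<open>x\<close> and \<open>y\<close> are each collinear with one point of a line of
  \<open>S'\<close>, and this line has a further point.\<close>

lemma card_lines_on_eq:
  assumes x: "x \<in> pts S - pts S'" and y: "y \<in> pts S - pts S'"
  shows "card (lines_on x) = card (lines_on y)"
proof -
  obtain p where "p \<in> pts S'" using on_point by auto
  then obtain M where M: "M \<in> lns S'" using two_lines by blast
  then have MS: "M \<in> lns S" by (auto simp: sub_lns)
  obtain p r s where *: "p \<in> pts S" "r \<in> pts S" "s \<in> pts S" "p \<noteq> r" "p \<noteq> s" "r \<noteq> s"
    "inc S p M" "inc S r M" "inc S s M" using thick[OF MS] by auto
  have nM: "\<not> inc S z M" if "z \<in> pts S - pts S'" for z using that M by (auto simp: sub_lns)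
  have un: "a = b" if "z \<in> pts S - pts S'" "a \<in> pts S" "b \<in> pts S" "inc S a M" "inc S b M" "z \<bowtie> a" "z \<bowtie> b" for z a b
    using proj_unique[of z M a b] nM that MS by auto
  have "\<exists>u\<in>pts S. \<not> x \<bowtie> u \<and> \<not> y \<bowtie> u"
  proof (rule ccontr)
    assume "\<not> ?thesis"
    then have "x \<bowtie> p \<or> y \<bowtie> p" "x \<bowtie> r \<or> y \<bowtie> r" "x \<bowtie> s \<or> y \<bowtie> s" using * by auto
    then show False using un[OF x] un[OF y] * by metis
  qed
  then obtain u where u: "u \<in> pts S" "\<not> x \<bowtie> u" "\<not> y \<bowtie> u" by auto
  then have "\<not> u \<bowtie> x" "\<not> u \<bowtie> y" using coll_sym by auto
  then show ?thesis
    using card_lines_on_le[of x u] card_lines_on_le[of u x] card_lines_on_le[of y u] card_lines_on_le[of u y] x y u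
    by auto
qed

text \<open>Suppose that all lines on \<open>u\<close> belong to \<open>S'\<close>. Then every
  point of an ovoid subtended by a point \<open>x\<close> not collinear with \<open>u\<close> is
  collinear with \<open>u\<close>. A line \<open>K\<close> of \<open>S'\<close> on
  \<open>u\<close> has a point \<open>s\<close> besides \<open>u\<close> and its point in the
  ovoid, and on a second line \<open>M\<close> of \<open>S'\<close> through \<open>s\<close>
  both \<open>s\<close> and the point of the ovoid would be collinear with
  \<open>u\<close>.\<close>

lemma line_through:
  assumes u: "u \<in> pts S'"
  obtains L where "L \<in> lns S - lns S'" "inc S u L"
proof -
  obtain x where x: "x \<in> pts S - pts S'" using off_point by auto
  have uS: "u \<in> pts S" using u sub_pts by auto
  show ?thesis
  proof (cases "x \<bowtie> u")
    case True
    then obtain L where "L \<in> lns S" "inc S x L" "inc S u L" by (auto simp: collinear_in_def)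
    then show ?thesis using that line_off[OF x] by auto
  next
    case nxu: False
    show ?thesis
    proof (rule ccontr)
      assume "\<not> thesis"
      then have none: "\<And>L. L \<in> lns S \<Longrightarrow> inc S u L \<Longrightarrow> L \<in> lns S'" using that by blast
      have allO: "r \<in> pts S'" if "u \<bowtie> r" "r \<in> pts S" for r
        using that none by (auto simp: collinear_in_def sub_lns)
      obtain K where K: "K \<in> lns S'" "inc S u K" using two_lines[OF u] by blast
      then have KS: "K \<in> lns S" by (auto simp: sub_lns)
      obtain a b c where abc: "a \<in> pts S" "b \<in> pts S" "c \<in> pts S" "a \<noteq> b" "a \<noteq> c" "b \<noteq> c"
         "inc S a K" "inc S b K" "inc S c K" using thick[OF KS] by auto
      have nxK: "\<not> inc S x K" using K x by (auto simp: sub_lns)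
      \<comment> \<open>a point s of K other than u and other than the point of the ovoid on K\<close>
      obtain s where s: "s \<in> pts S" "inc S s K" "s \<noteq> u" "\<not> x \<bowtie> s"
        using proj_unique[of x K] nxK KS x abc nxu by (metis Diff_iff)
      have sS': "s \<in> pts S'" using s K by (auto simp: sub_lns)
      obtain M where M: "M \<in> lns S'" "inc S s M" "M \<noteq> K" using two_lines[OF sS'] by blast
      then have MS: "M \<in> lns S" by (auto simp: sub_lns)
      have nuM: "\<not> inc S u M" using line_unique[of K M u s] KS MS K M s uS by auto
      have nxM: "\<not> inc S x M" using M x by (auto simp: sub_lns)
      then obtain r where r: "r \<in> pts S" "inc S r M" "x \<bowtie> r" using proj_exists[of x M] MS x by auto
      obtain L where L: "L \<in> lns S" "inc S x L" "inc S r L" using r by (auto simp: collinear_in_def)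
      have LA: "L \<in> lns S - lns S'" using line_off[OF x] L by auto
      have nuL: "\<not> inc S u L" using L nxu collI[of L x u] by auto
      then obtain t where t: "t \<in> pts S" "inc S t L" "u \<bowtie> t" using proj_exists[of u L] uS LA by auto
      have "t \<in> pts S'" using allO t by auto
      moreover have "r \<in> pts S'" using r M by (auto simp: sub_lns)
      ultimately have "t = r" using trace_eq[OF LA] t L by auto
      then have "u \<bowtie> r" using t by simp
      moreover have "u \<bowtie> s" using K s KS collI by auto
      ultimately have "r = s" using proj_unique[of u M r s] uS MS nuM r s M by auto
      then show False using r s by auto
    qed
  qed
qed

text \<open>Any line \<open>N\<close> off \<open>S'\<close> on \<open>u\<close> contains such a
  point: the projection of \<open>v\<close> onto \<open>N\<close>.\<close>

lemma noncoll_common: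
  assumes "u \<in> pts S'" "v \<in> pts S'" "\<not> u \<bowtie> v"
  obtains y where "y \<in> pts S - pts S'" "u \<in> Ov y" "v \<in> Ov y"
proof -
  obtain N where N: "N \<in> lns S - lns S'" "inc S u N" using line_through assms by metis
  have uv: "u \<in> pts S" "v \<in> pts S" using assms sub_pts by auto
  have nv: "\<not> inc S v N" using assms N collI by auto
  then obtain y where y: "y \<in> pts S" "inc S y N" "v \<bowtie> y" using proj_exists[of v N] N uv by auto
  have "y \<notin> pts S'" using trace_eq[OF N(1)] y N assms coll_sym by metis
  moreover have "y \<bowtie> u" using collI N y by auto
  ultimately show ?thesis using that y coll_sym assms by (auto simp: mem_Ov)
qed

lemma rosette_mem: "L \<in> lns S - lns S' \<Longrightarrow> X \<in> R L \<longleftrightarrow> (\<exists>x\<in>pts S - pts S'. inc S x L \<and> X = Ov x)"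
  by (auto simp: rosette_def)

lemma rosette_meet:
  assumes L: "L \<in> lns S - lns S'" and X: "X \<in> R L" "Y \<in> R L" "X \<noteq> Y" and u: "u \<in> X" "u \<in> Y"
  shows "u = trace L"
proof -
  obtain x y where xy: "x \<in> pts S - pts S'" "inc S x L" "X = Ov x" "y \<in> pts S - pts S'" "inc S y L" "Y = Ov y"
    using X rosette_mem[OF L] by auto
  then have "x \<noteq> y" "x \<bowtie> u" "y \<bowtie> u" "u \<in> pts S'" using X u by (auto simp: mem_Ov)
  then have "inc S u L" using no_triangle[of L u x y] xy L sub_pts coll_sym by auto
  then show ?thesis using trace_eq L \<open>u \<in> pts S'\<close> by auto
qed

lemma rosette_base:
  assumes L: "L \<in> lns S - lns S'"
  shows "(\<forall>X\<in>R L. u \<in> X) \<longleftrightarrow> u = trace L"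
proof
  assume "u = trace L"
  then show "\<forall>X\<in>R L. u \<in> X" using L trace_in_Ov by (auto simp: rosette_mem)
next
  assume *: "\<forall>X\<in>R L. u \<in> X"
  obtain x y where xy: "x \<in> pts S - pts S'" "y \<in> pts S - pts S'" "x \<noteq> y" "inc S x L" "inc S y L"
    using two_off_points[OF L] .
  then have "u \<in> Ov x" "u \<in> Ov y" using * rosette_mem[OF L] by auto
  then have "u \<in> pts S'" "u \<bowtie> x" "u \<bowtie> y" using coll_sym by (auto simp: mem_Ov)
  then have "inc S u L" using no_triangle[of L u x y] xy L sub_pts by auto
  then show "u = trace L" using trace_eq L \<open>u \<in> pts S'\<close> by auto
qed

end

text \<open>The hypothesis \<open>\<theta> > 0\<close> makes the cover surjective on lines, so
  that every point of \<open>S'\<close> is the base of some line.\<close>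

locale gq_cover = gq_hyperplane S S' for S S' :: "('p, 'l) geometry" +
  fixes f :: "'p \<Rightarrow> 'p set" and g :: "'l \<Rightarrow> 'p set set" and \<theta> :: nat
  assumes cover: "theta_cover \<theta> A E f g" and theta: "\<theta> > 0"
begin

definition base where "base N = (THE u. \<forall>X\<in>g N. u \<in> X)"

lemma
  shows f_mem: "x \<in> pts S - pts S' \<Longrightarrow> \<exists>w\<in>pts S - pts S'. f x = Ov w"
    and g_mem: "N \<in> lns S - lns S' \<Longrightarrow> \<exists>M\<in>lns S - lns S'. g N = R M"
    and fg_inc: "\<lbrakk>x \<in> pts S - pts S'; N \<in> lns S - lns S'; inc S x N\<rbrakk> \<Longrightarrow> f x \<in> g N"
    and g_bij: "x \<in> pts S - pts S' \<Longrightarrow>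
      bij_betw g {L \<in> lns S - lns S'. inc S x L} {M \<in> R ` (lns S - lns S'). f x \<in> M}"
    and f_bij: "N \<in> lns S - lns S' \<Longrightarrow>
      bij_betw f {x \<in> pts S - pts S'. inc S x N} {y \<in> Ov ` (pts S - pts S'). y \<in> g N}"
    and g_onto: "M \<in> lns S - lns S' \<Longrightarrow> \<exists>N\<in>lns S - lns S'. g N = R M"
proof -
  have c: "cover A E f g" and fib: "\<forall>M\<in>lns E. card {L\<in>lns A. g L = M} = \<theta>"
    using cover by (auto simp: theta_cover_def)
  note cc = c[unfolded cover_def]
  note c1 = cc[THEN conjunct1] cc[THEN conjunct2, THEN conjunct1]
  note c2 = cc[THEN conjunct2, THEN conjunct2, THEN conjunct1, THEN bspec, THEN bspec, THEN mp]
  note c3 = cc[THEN conjunct2, THEN conjunct2, THEN conjunct2, THEN conjunct1, THEN bspec]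
  note c4 = cc[THEN conjunct2, THEN conjunct2, THEN conjunct2, THEN conjunct2, THEN bspec]
  show "x \<in> pts S - pts S' \<Longrightarrow> \<exists>w\<in>pts S - pts S'. f x = Ov w" for x
    using c1(1) by (simp add: image_subset_iff image_iff)
  show "N \<in> lns S - lns S' \<Longrightarrow> \<exists>M\<in>lns S - lns S'. g N = R M" for N
    using c1(2) by (simp add: image_subset_iff image_iff)
  show "\<lbrakk>x \<in> pts S - pts S'; N \<in> lns S - lns S'; inc S x N\<rbrakk> \<Longrightarrow> f x \<in> g N" for x N
    using c2[of x N] by simp
  show "x \<in> pts S - pts S' \<Longrightarrow>
      bij_betw g {L \<in> lns S - lns S'. inc S x L} {M \<in> R ` (lns S - lns S'). f x \<in> M}" for x
    using c3[of x] by simp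
  show "N \<in> lns S - lns S' \<Longrightarrow>
      bij_betw f {x \<in> pts S - pts S'. inc S x N} {y \<in> Ov ` (pts S - pts S'). y \<in> g N}" for N
    using c4[of N] by simp
  assume "M \<in> lns S - lns S'"
  then have "card {L\<in>lns A. g L = R M} = \<theta>" using fib by simp
  then have "{L\<in>lns A. g L = R M} \<noteq> {}" using theta by (metis card.empty less_irrefl)
  then show "\<exists>N\<in>lns S - lns S'. g N = R M" by auto
qed

lemma base_iff: "N \<in> lns S - lns S' \<Longrightarrow> (\<forall>X\<in>g N. u \<in> X) \<longleftrightarrow> u = base N"
proof -
  assume "N \<in> lns S - lns S'"
  then obtain M where "M \<in> lns S - lns S'" "g N = R M" using g_mem by auto
  then show ?thesis by (simp add: base_def rosette_base)
qed

lemma base_trace: "\<lbrakk>N \<in> lns S - lns S'; M \<in> lns S - lns S'; g N = R M\<rbrakk> \<Longrightarrow> base N = trace M"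
  using base_iff[of N "trace M"] rosette_base[of M "trace M"] by auto

lemma base_in: "N \<in> lns S - lns S' \<Longrightarrow> base N \<in> pts S'"
  using g_mem base_trace trace by metis

text \<open>If \<open>f y\<close> is subtended by \<open>w\<close>, a point \<open>v\<close> of
  it is the base of the rosette of the line \<open>wv\<close>, and this rosette is the image of
  a line on \<open>y\<close> because a cover is bijective on the lines at a point.\<close>

lemma base_lines_on: "y \<in> pts S - pts S' \<Longrightarrow> base ` lines_on y = f y"
proof (intro equalityI subsetI)
  assume y: "y \<in> pts S - pts S'"
  { fix u assume "u \<in> base ` lines_on y"
    then obtain N where N: "N \<in> lns S - lns S'" "inc S y N" "u = base N"
      using line_off[OF y] by (auto simp: lines_on_def)
    then show "u \<in> f y" using fg_inc[OF y] base_iff[of N u] by auto }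
  fix v assume v: "v \<in> f y"
  obtain w where w: "w \<in> pts S - pts S'" "f y = Ov w" using f_mem[OF y] by auto
  obtain M where M: "M \<in> lns S - lns S'" "inc S w M" "trace M = v" using Ov_trace w v by metis
  then have "f y \<in> R M" using w rosette_mem by auto
  then have "R M \<in> {M \<in> R ` (lns S - lns S'). f y \<in> M}" using M by auto
  then have "R M \<in> g ` {L \<in> lns S - lns S'. inc S y L}"
    using bij_betw_imp_surj_on[OF g_bij[OF y]] by simp
  then obtain N where N: "N \<in> lns S - lns S'" "inc S y N" "g N = R M" by auto
  then have "base N = v" "N \<in> lines_on y" using base_trace[OF N(1) M(1)] M by (auto simp: lines_on_def)
  then show "v \<in> base ` lines_on y" by blast
qed

text \<open>By counting: there are as many lines on \<open>y\<close> as points in any subtended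
  ovoid.\<close>

lemma base_inj: "y \<in> pts S - pts S' \<Longrightarrow> inj_on base (lines_on y)"
proof -
  assume y: "y \<in> pts S - pts S'"
  obtain w where w: "w \<in> pts S - pts S'" "f y = Ov w" using f_mem[OF y] by auto
  have "card (base ` lines_on y) = card (lines_on y)"
    using base_lines_on[OF y] w card_Ov[of w] card_lines_on_eq[OF y, of w] by simp
  moreover have "finite (lines_on y)" using finite_lns by (auto simp: lines_on_def)
  ultimately show ?thesis by (simp add: eq_card_imp_inj_on)
qed

text \<open>Suppose that \<open>N\<close> and \<open>N'\<close> have the same base
  \<open>u\<close> but different traces. They have no common point off \<open>S'\<close>, and
  since there are no triangles a point \<open>y\<close> of \<open>N\<close> is joined to a point
  \<open>y'\<close> of \<open>N'\<close> by a line \<open>M\<close>, with \<open>y\<close> and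
  \<open>y'\<close> off \<open>S'\<close>. The ovoids \<open>f y\<close> and \<open>f y'\<close>
  are different members of the rosette \<open>g M\<close> that both contain \<open>u\<close>, so
  \<open>u\<close> is the base of \<open>M\<close> too, against the injectivity of
  \<open>base\<close> on the lines on \<open>y\<close>.\<close>

lemma base_eq_imp_trace_eq:
  assumes N: "N \<in> lns S - lns S'" "N' \<in> lns S - lns S'" and eq: "base N = base N'"
  shows "trace N = trace N'"
proof (rule ccontr)
  assume ne: "trace N \<noteq> trace N'"
  then have NN: "N \<noteq> N'" by auto
  have disj: "\<not> (inc S y N \<and> inc S y N')" if "y \<in> pts S - pts S'" for y
    using base_inj[OF that] N eq NN by (auto simp: lines_on_def inj_on_def)
  obtain y1 y2 where y12: "y1 \<in> pts S - pts S'" "y2 \<in> pts S - pts S'" "y1 \<noteq> y2" "inc S y1 N" "inc S y2 N"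
    using two_off_points[OF N(1)] .
  have tr: "trace N' \<in> pts S" using trace(1)[OF N(2)] sub_pts by auto
  obtain r1 where r1: "r1 \<in> pts S" "inc S r1 N'" "y1 \<bowtie> r1" using proj_exists[of y1 N'] disj y12 N by blast
  obtain r2 where r2: "r2 \<in> pts S" "inc S r2 N'" "y2 \<bowtie> r2" using proj_exists[of y2 N'] disj y12 N by blast
  have "\<not> (r1 \<in> pts S' \<and> r2 \<in> pts S')"
  proof
    assume "r1 \<in> pts S' \<and> r2 \<in> pts S'"
    then have "r1 = trace N'" "r2 = trace N'" using trace_eq[OF N(2)] r1 r2 by auto
    then have "inc S (trace N') N"
      using no_triangle[of N "trace N'" y1 y2] y12 r1 r2 N tr coll_sym by auto
    then show False using ne trace_eq[OF N(1)] trace(1)[OF N(2)] by auto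
  qed
  then obtain y y' where y: "y \<in> pts S - pts S'" "inc S y N" "y' \<in> pts S - pts S'" "inc S y' N'" "y \<bowtie> y'"
    using y12 r1 r2 by blast
  then obtain M where M0: "M \<in> lns S" "inc S y M" "inc S y' M" by (auto simp: collinear_in_def)
  then have M: "M \<in> lns S - lns S'" using line_off y by auto
  have "M \<noteq> N" using disj y M0 by auto
  then have bM: "base M \<noteq> base N" using base_inj[OF y(1)] M0 N y by (auto simp: lines_on_def inj_on_def)
  have "y \<noteq> y'" using disj y by auto
  then have fy: "f y \<noteq> f y'"
    using f_bij[OF M] y M0 unfolding bij_betw_def inj_on_def by auto
  have "f y \<in> g M" "f y' \<in> g M" "f y \<in> g N" "f y' \<in> g N'" using fg_inc y M M0 N by auto
  moreover obtain K where K: "K \<in> lns S - lns S'" "g M = R K" using g_mem[OF M] by auto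
  moreover have "base N \<in> f y" "base N \<in> f y'"
    using calculation base_iff[OF N(1), of "base N"] base_iff[OF N(2), of "base N"] eq by auto
  ultimately have "base N = trace K" using rosette_meet[OF K(1)] fy by auto
  then show False using base_trace[OF M K] bM by simp
qed

lemma star_eq: "star S S' g x = {N \<in> lns S - lns S'. base N = x}"
  using base_iff by (auto simp: star_def)

lemma base_onto: "x \<in> pts S' \<Longrightarrow> \<exists>N\<in>lns S - lns S'. base N = x"
proof -
  assume x: "x \<in> pts S'"
  then obtain L where L: "L \<in> lns S - lns S'" "inc S x L" using line_through by metis
  then have "trace L = x" using trace_eq x by auto
  then show ?thesis using g_onto[OF L(1)] base_trace[OF _ L(1)] by blast
qed

lemma star_point_base:
  assumes N: "N \<in> lns S - lns S'"
  shows "star_point S S' g (base N) = trace N"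
  unfolding star_point_def
proof (rule the_equality)
  show "trace N \<in> pts S' \<and> (\<forall>K\<in>star S S' g (base N). inc S (trace N) K)"
    using trace[OF N] base_eq_imp_trace_eq[OF N] trace(2) by (auto simp: star_eq)
  fix y assume y: "y \<in> pts S' \<and> (\<forall>K\<in>star S S' g (base N). inc S y K)"
  then have "inc S y N" using N by (auto simp: star_eq)
  then show "y = trace N" using trace_eq[OF N] y by auto
qed

text \<open>Every point of \<open>S'\<close> is the trace of a line, so the map is onto, and its
  domain is finite.\<close>

lemma star_point_bij: "bij_betw (star_point S S' g) (pts S') (pts S')"
proof -
  have fin: "finite (pts S')" using finite_pts sub_pts finite_subset by blast
  have "star_point S S' g ` pts S' = pts S'"
  proof (intro equalityI subsetI)
    fix u assume "u \<in> star_point S S' g ` pts S'"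
    then obtain x where x: "x \<in> pts S'" "u = star_point S S' g x" by auto
    obtain N where "N \<in> lns S - lns S'" "base N = x" using base_onto[OF x(1)] by auto
    then show "u \<in> pts S'" using star_point_base[of N] trace(1)[of N] x by auto
  next
    fix u assume u: "u \<in> pts S'"
    then obtain L where L: "L \<in> lns S - lns S'" "inc S u L" using line_through by metis
    then have "trace L = u" using trace_eq u by auto
    then show "u \<in> star_point S S' g ` pts S'" using star_point_base[OF L(1)] base_in[OF L(1)] by force
  qed
  then show ?thesis using finite_surj_inj[OF fin] by (simp add: bij_betw_def)
qed

abbreviation "\<sigma> \<equiv> assoc_map S S' g"

lemma assoc_star_point: "x \<in> pts S' \<Longrightarrow> \<sigma> (star_point S S' g x) = x"
  unfolding assoc_map_def using star_point_bij
  by (intro the_equality) (auto simp: bij_betw_def inj_on_def)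

lemma assoc_trace: "N \<in> lns S - lns S' \<Longrightarrow> \<sigma> (trace N) = base N"
  using assoc_star_point[of "base N"] base_in star_point_base by simp

theorem assoc_bij: "bij_betw \<sigma> (pts S') (pts S')"
proof -
  have "inv_into (pts S') (star_point S S' g) u = \<sigma> u" if "u \<in> pts S'" for u
    using that star_point_bij assoc_star_point
    by (metis bij_betw_imp_surj_on inv_into_into f_inv_into_f)
  then show ?thesis using bij_betw_cong[of "pts S'"] bij_betw_inv_into[OF star_point_bij] by metis
qed

lemma assoc_Ov: "y \<in> pts S - pts S' \<Longrightarrow> \<sigma> ` Ov y = f y"
proof -
  assume y: "y \<in> pts S - pts S'"
  have "\<sigma> ` trace ` lines_on y = base ` lines_on y"
    unfolding image_image using assoc_trace line_off[OF y] by (intro image_cong) (auto simp: lines_on_def)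
  then show ?thesis using trace_lines_on[OF y] base_lines_on[OF y] by simp
qed

theorem assoc_subtended: "y \<in> pts S - pts S' \<Longrightarrow> \<exists>w\<in>pts S - pts S'. \<sigma> ` Ov y = Ov w"
  using assoc_Ov f_mem by simp

text \<open>Noncollinear points lie in a common subtended ovoid, so their images lie in one as
  well and are not collinear. The resulting injection of the finite set of noncollinear pairs
  into itself is onto, which gives the converse.\<close>

theorem assoc_coll:
  assumes "u \<in> pts S'" "v \<in> pts S'"
  shows "\<sigma> u \<bowtie> \<sigma> v \<longleftrightarrow> u \<bowtie> v"
proof -
  let ?NC = "{(u, v). u \<in> pts S' \<and> v \<in> pts S' \<and> \<not> u \<bowtie> v}"
  let ?h = "map_prod \<sigma> \<sigma>"
  have inj: "inj_on \<sigma> (pts S')" and im: "\<sigma> ` pts S' = pts S'" using assoc_bij by (auto simp: bij_betw_def)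
  have fin: "finite (pts S')" using finite_pts sub_pts finite_subset by blast
  have refl: "u \<bowtie> u" if "u \<in> pts S'" for u
    using line_through[OF that] collI by (metis DiffD1)
  have sub: "?h ` ?NC \<subseteq> ?NC"
  proof clarsimp
    fix u v assume uv: "u \<in> pts S'" "v \<in> pts S'" "\<not> u \<bowtie> v"
    obtain y where y: "y \<in> pts S - pts S'" "u \<in> Ov y" "v \<in> Ov y" using noncoll_common[OF uv] .
    obtain w where w: "w \<in> pts S - pts S'" "\<sigma> ` Ov y = Ov w" using assoc_subtended[OF y(1)] by auto
    have "u \<noteq> v" using uv refl by auto
    then have "\<sigma> u \<noteq> \<sigma> v" using inj uv by (auto simp: inj_on_def)
    then show "\<sigma> u \<in> pts S' \<and> \<sigma> v \<in> pts S' \<and> \<not> \<sigma> u \<bowtie> \<sigma> v"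
      using Ov_noncoll[OF w(1), of "\<sigma> u" "\<sigma> v"] w y im uv by blast
  qed
  have "inj_on ?h ?NC" using inj by (auto simp: inj_on_def)
  moreover have "finite ?NC" by (rule finite_subset[of _ "pts S' \<times> pts S'"]) (use fin in auto)
  ultimately have onto: "?h ` ?NC = ?NC" using sub endo_inj_surj by blast
  show ?thesis
  proof
    assume "\<sigma> u \<bowtie> \<sigma> v" then show "u \<bowtie> v" using sub assms by force
  next
    assume uv: "u \<bowtie> v"
    show "\<sigma> u \<bowtie> \<sigma> v"
    proof (rule ccontr)
      assume "\<not> \<sigma> u \<bowtie> \<sigma> v"
      then have "(\<sigma> u, \<sigma> v) \<in> ?h ` ?NC" unfolding onto using im assms by auto
      then obtain a b where ab: "(a, b) \<in> ?NC" "\<sigma> a = \<sigma> u" "\<sigma> b = \<sigma> v" by auto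
      then have "a = u" "b = v" using inj assms by (auto simp: inj_on_def)
      then show False using ab uv by auto
    qed
  qed
qed

end

section \<open>Points and lines of a variety in terms of vectors\<close>

text \<open>Linear independence of a pair in terms of coefficients, the form in which semilinear
  maps transport it.\<close>

definition indep2 :: "'a::field^'n \<Rightarrow> 'a^'n \<Rightarrow> bool" where
  "indep2 x y \<longleftrightarrow> (\<forall>r s. r *s x + s *s y = 0 \<longrightarrow> r = 0 \<and> s = 0)"

lemma mem_span1: "v \<in> vec.span {x} \<longleftrightarrow> (\<exists>r. v = r *s (x :: 'a::field^'n))"
  by (auto simp: vec.span_singleton)

lemma mem_span2: "v \<in> vec.span {x, y} \<longleftrightarrow> (\<exists>r s. v = r *s (x :: 'a::field^'n) + s *s y)"
  by (auto simp: vec.span_insert mem_span1 algebra_simps) 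

lemma indep2_nonzero: assumes "indep2 x y" shows "x \<noteq> 0" "y \<noteq> 0"
  using assms[unfolded indep2_def, rule_format, of 1 0] assms[unfolded indep2_def, rule_format, of 0 1] by auto

lemma indep2_iff: "indep2 x y \<longleftrightarrow> x \<noteq> y \<and> vec.independent {x, y :: 'a::field^'n}"
proof
  assume i: "indep2 x y"
  have "x \<notin> vec.span {y}"
  proof
    assume "x \<in> vec.span {y}"
    then obtain r where "x = r *s y" by (auto simp: mem_span1)
    then have "1 *s x + (- r) *s y = 0" by simp
    then show False using i unfolding indep2_def by (metis zero_neq_one)
  qed
  then show "x \<noteq> y \<and> vec.independent {x, y}"
    using indep2_nonzero[OF i] by (auto simp: vec.independent_insert vec.span_base)
next
  assume *: "x \<noteq> y \<and> vec.independent {x, y}"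
  then have x: "x \<notin> vec.span {y}" and y: "y \<noteq> 0"
    by (auto simp: vec.independent_insert)
  show "indep2 x y"
    unfolding indep2_def
  proof (intro allI impI)
    fix r s assume rs: "r *s x + s *s y = 0"
    have "r = 0"
    proof (rule ccontr)
      assume "r \<noteq> 0"
      from rs have "r *s x = (- s) *s y" by (simp add: eq_neg_iff_add_eq_0)
      then have "inverse r *s (r *s x) = inverse r *s ((- s) *s y)" by simp
      then have "x = (inverse r * (- s)) *s y" using \<open>r \<noteq> 0\<close> by (simp add: vector_smult_assoc)
      then show False using x mem_span1 by blast
    qed
    then show "r = 0 \<and> s = 0" using rs y by simp
  qed
qed

lemma not_indep2: "\<not> indep2 x y \<Longrightarrow> x \<noteq> 0 \<Longrightarrow> \<exists>r. y = r *s (x :: 'a::field^'n)"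
proof -
  assume "\<not> indep2 x y" "x \<noteq> 0"
  then obtain r s where rs: "r *s x + s *s y = 0" "r \<noteq> 0 \<or> s \<noteq> 0" by (auto simp: indep2_def)
  then have "s \<noteq> 0" using \<open>x \<noteq> 0\<close> by auto
  have "s *s y = (- r) *s x" using rs by (simp add: eq_neg_iff_add_eq_0 add.commute)
  then have "inverse s *s (s *s y) = inverse s *s ((- r) *s x)" by simp
  then have "y = (inverse s * (- r)) *s x" using \<open>s \<noteq> 0\<close> by (simp add: vector_smult_assoc)
  then show ?thesis by blast
qed

lemma subspace_dim1: "vec.subspace p \<and> vec.dim p = 1 \<longleftrightarrow> (\<exists>u. u \<noteq> 0 \<and> p = vec.span {u :: 'a::field^'n})"
proof
  assume p: "vec.subspace p \<and> vec.dim p = 1"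
  obtain B where B: "B \<subseteq> p" "vec.independent B" "p \<subseteq> vec.span B" "card B = vec.dim p"
    using vec.basis_exists by blast
  then obtain u where "B = {u}" using p by (auto simp: card_1_singleton_iff)
  then show "\<exists>u. u \<noteq> 0 \<and> p = vec.span {u}"
    using B p vec.span_minimal[of B p] by auto
next
  assume "\<exists>u. u \<noteq> 0 \<and> p = vec.span {u}"
  then show "vec.subspace p \<and> vec.dim p = 1"
    using vec.dim_span_eq_card_independent[of "{u}" for u]
    by (auto simp: vec.subspace_span simp del: vec.dim_span)
qed

lemma subspace_dim2: "vec.subspace L \<and> vec.dim L = 2 \<longleftrightarrow> (\<exists>x y. indep2 x y \<and> L = vec.span {x, y :: 'a::field^'n})"
proof
  assume p: "vec.subspace L \<and> vec.dim L = 2"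
  obtain B where B: "B \<subseteq> L" "vec.independent B" "L \<subseteq> vec.span B" "card B = vec.dim L"
    using vec.basis_exists by blast
  then obtain x y where "B = {x, y}" "x \<noteq> y" using p by (auto simp: card_2_iff)
  then show "\<exists>x y. indep2 x y \<and> L = vec.span {x, y}"
    using B p vec.span_minimal[of B L] by (auto simp: indep2_iff)
next
  assume "\<exists>x y. indep2 x y \<and> L = vec.span {x, y}"
  then obtain x y where "indep2 x y" "L = vec.span {x, y}" by auto
  then show "vec.subspace L \<and> vec.dim L = 2"
    using vec.dim_span_eq_card_independent[of "{x, y}"]
    by (auto simp: indep2_iff vec.subspace_span card_insert_if simp del: vec.dim_span)
qed

lemma span_singleton_eq:
  assumes "u \<noteq> 0" "v \<noteq> (0 :: 'a::field^'n)"
  shows "vec.span {u} = vec.span {v} \<longleftrightarrow> (\<exists>c. c \<noteq> 0 \<and> u = c *s v)"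
proof
  assume "vec.span {u} = vec.span {v}"
  then have "u \<in> vec.span {v}" by (metis vec.span_base singletonI)
  then show "\<exists>c. c \<noteq> 0 \<and> u = c *s v" using assms by (auto simp: mem_span1)
next
  assume "\<exists>c. c \<noteq> 0 \<and> u = c *s v"
  then obtain c where c: "c \<noteq> 0" "u = c *s v" by auto
  then have "v = inverse c *s u" by (simp add: vector_smult_assoc)
  then have "v \<in> vec.span {u}" "u \<in> vec.span {v}" using c mem_span1 by blast+
  then show "vec.span {u} = vec.span {v}"
    by (intro equalityI vec.span_minimal) (auto simp: vec.subspace_span)
qed

lemma span_pair_eq:
  assumes "indep2 x y" "u \<in> vec.span {x, y}" "v \<in> vec.span {x, y}" "indep2 u (v :: 'a::field^'n)"
  shows "vec.span {u, v} = vec.span {x, y}"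
proof -
  have sub: "vec.span {u, v} \<subseteq> vec.span {x, y}"
    by (rule vec.span_minimal) (use assms in \<open>auto simp: vec.subspace_span\<close>)
  moreover have "vec.dim (vec.span {u, v}) = 2" "vec.dim (vec.span {x, y}) = 2"
    using assms subspace_dim2 by blast+
  ultimately show ?thesis
    using vec.subspace_dim_equal[of "vec.span {u, v}" "vec.span {x, y}"] by (auto simp: vec.subspace_span)
qed

section \<open>Quadratic and Hermitian forms treated together\<close>

text \<open>The cross product of the two rows is a solution. If it vanishes the rows are
  proportional, and a solution of one nonzero row solves the other.\<close>

lemma two_equations:
  fixes a1 a2 a3 b1 b2 b3 :: "'a::field"
  shows "\<exists>r s t. (r \<noteq> 0 \<or> s \<noteq> 0 \<or> t \<noteq> 0) \<and> r * a1 + s * a2 + t * a3 = 0 \<and> r * b1 + s * b2 + t * b3 = 0"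
proof -
  let ?P = "\<lambda>r s t. (r \<noteq> 0 \<or> s \<noteq> 0 \<or> t \<noteq> 0) \<and> r * a1 + s * a2 + t * a3 = 0 \<and> r * b1 + s * b2 + t * b3 = 0"
  let ?r = "a2 * b3 - a3 * b2" and ?s = "a3 * b1 - a1 * b3" and ?t = "a1 * b2 - a2 * b1"
  show ?thesis
  proof (cases "?r \<noteq> 0 \<or> ?s \<noteq> 0 \<or> ?t \<noteq> 0")
    case True
    then have "?P ?r ?s ?t" by (simp add: algebra_simps)
    then show ?thesis by blast
  next
    case False
    then have z: "a2 * b3 = a3 * b2" "a3 * b1 = a1 * b3" "a1 * b2 = a2 * b1" by auto
    consider "a1 \<noteq> 0 \<or> a2 \<noteq> 0" | "a1 = 0" "a2 = 0" "b1 \<noteq> 0 \<or> b2 \<noteq> 0" | "a1 = 0" "a2 = 0" "b1 = 0" "b2 = 0"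
      by blast
    then show ?thesis
    proof cases
      case 1
      then have "?P a2 (- a1) 0" using z by (auto simp: algebra_simps)
      then show ?thesis by blast
    next
      case 2
      then have "?P b2 (- b1) 0" using z by (auto simp: algebra_simps)
      then show ?thesis by blast
    next
      case 3
      then have "?P 1 0 0" by simp
      then show ?thesis by blast
    qed
  qed
qed

text \<open>For a quadratic form \<open>F\<close> with polar form \<open>b\<close> the maps
  \<open>cj\<close> and \<open>tr\<close> are the identity. For a Hermitian form
  \<open>b\<close> they are the involution \<open>c \<mapsto> c\<^sup>q\<close> and the trace
  \<open>c \<mapsto> c + c\<^sup>q\<close>, and \<open>F x = b x x\<close>. As \<open>cj\<close>
  is a power map it commutes with every multiplicative map of the field, in particular with the
  field automorphism constructed below.\<close>

locale polar_space =
  fixes cj tr :: "'a::{field,finite} \<Rightarrow> 'a" and F :: "'a^'n \<Rightarrow> 'a" and b :: "'a^'n \<Rightarrow> 'a^'n \<Rightarrow> 'a"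
  assumes cj_add: "cj (a + c) = cj a + cj c" and cj_cj: "cj (cj a) = a"
    and cj_power: "\<exists>q>0. \<forall>x. cj x = x ^ q"
    and tr_cases: "(tr = id \<and> cj = id) \<or> tr = (\<lambda>a. a + cj a)"
    and tr_nondeg: "(\<And>c. tr (c * a) = 0) \<Longrightarrow> a = 0"
    and tr_onto: "\<exists>c. tr c = F x"
    and b_add: "b (x + y) z = b x z + b y z" and b_scale: "b (c *s x) z = c * b x z"
    and b_sym: "b y x = cj (b x y)"
    and F_scale: "F (c *s x) = c * cj c * F x" and F_add: "F (x + y) = F x + F y + tr (b x y)"
    and nonsingular: "F x = 0 \<Longrightarrow> (\<And>y. b x y = 0) \<Longrightarrow> x = 0"
begin

lemma cj_mult: "cj (x * y) = cj x * cj y"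
  using cj_power by (auto simp: power_mult_distrib)

lemma cj_0 [simp]: "cj 0 = 0" and cj_1 [simp]: "cj 1 = 1" and cj_cj' [simp]: "cj (cj x) = x"
  using cj_power cj_cj by auto

lemma cj_minus: "cj (- x) = - cj x"
  using cj_add[of x "- x"] by (simp add: eq_neg_iff_add_eq_0 add.commute)

lemma cj_eq_0 [simp]: "cj x = 0 \<longleftrightarrow> x = 0"
  using cj_cj cj_0 by metis

lemma cj_commute:
  assumes "\<And>x y. t (x * y) = t x * t y" "t 1 = 1"
  shows "t (cj x) = cj (t x)"
proof -
  obtain q where q: "\<And>x. cj x = x ^ q" using cj_power by auto
  have "t (x ^ n) = t x ^ n" for n by (induction n) (auto simp: assms)
  then show ?thesis by (simp add: q)
qed

lemma tr_add: "tr (x + y) = tr x + tr y" and tr_0 [simp]: "tr 0 = 0"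
  and tr_minus: "tr (- x) = - tr x"
  using tr_cases by (auto simp: cj_add cj_minus)

lemma tr_commute:
  assumes "\<And>x y. t (x * y) = t x * t y" "t 1 = 1" "\<And>x y. t (x + y) = t x + t y" "cj m = m"
  shows "tr (m * t x) = m * t (tr x)"
  using tr_cases cj_commute[of t x, OF assms(1,2)] by (auto simp: assms cj_mult algebra_simps)

lemma b_add_right: "b x (y + z) = b x y + b x z"
  by (metis b_add b_sym cj_add)

lemma b_scale_right: "b x (c *s y) = cj c * b x y"
  by (metis b_scale b_sym cj_mult)

lemma b_zero [simp]: "b 0 x = 0" "b x 0 = 0"
  using b_scale[of 0 0 x] b_scale_right[of x 0 0] by auto

lemma b_sym0: "b x y = 0 \<longleftrightarrow> b y x = 0"
  using b_sym[of x y] by auto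

lemma F_0 [simp]: "F 0 = 0" using F_scale[of 0 0] by simp

lemma F_scale_eq_0: "F x = 0 \<Longrightarrow> F (c *s x) = 0" by (simp add: F_scale)

text \<open>Compare the two expansions of \<open>F ((c + 1) *s x)\<close>.\<close>

lemma b_self: "F x = 0 \<Longrightarrow> b x x = 0"
proof -
  assume x: "F x = 0"
  have "tr (c * b x x) = 0" for c
  proof -
    have "F (c *s x + x) = F ((c + 1) *s x)" by (simp add: vec.scale_left_distrib)
    moreover have "F ((c + 1) *s x) = 0" using x by (rule F_scale_eq_0)
    ultimately show ?thesis using F_add[of "c *s x" x] by (simp add: x b_scale F_scale)
  qed
  then show ?thesis using tr_nondeg by blast
qed

lemma b_minus: "b (- x) y = - b x y" "b x (- y) = - b x y"
  using b_scale[of "- 1" x y] b_scale_right[of x "- 1" y] by (auto simp: cj_minus)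

lemma b_diff: "b (x - y) z = b x z - b y z" "b x (y - z) = b x y - b x z"
  using b_add[of x "- y" z] b_add_right[of x y "- z"] by (simp_all add: b_minus)

lemmas b_expand = b_add b_add_right b_scale b_scale_right b_diff b_minus

lemma F_diff: "F (x - y) = F x + F y - tr (b x y)"
proof -
  have "F (- y) = F ((- 1) *s y)" by simp
  also have "\<dots> = F y" by (simp only: F_scale cj_minus cj_1) simp
  finally show ?thesis using F_add[of x "- y"] by (simp add: b_minus tr_minus)
qed

lemma F_combo: "F x = 0 \<Longrightarrow> F y = 0 \<Longrightarrow> b x y = 0 \<Longrightarrow> F (r *s x + s *s y) = 0"
  by (simp add: F_add F_scale b_expand)

text \<open>On a totally singular subspace \<open>tr (c * b x y)\<close> vanishes for all \<open>c\<close>, and \<open>tr\<close> is nondegenerate.\<close>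

lemma b_zero_of_F:
  assumes "\<And>r s. F (r *s x + s *s y) = 0"
  shows "b x y = 0"
proof -
  have "F x = 0" "F y = 0" using assms[of 1 0] assms[of 0 1] by auto
  then have "tr (c * b x y) = 0" for c using assms[of c 1] by (simp add: F_add F_scale b_expand)
  then show ?thesis using tr_nondeg by blast
qed

abbreviation "S \<equiv> variety_geometry F"

lemma inc_S [simp]: "inc S = (\<subseteq>)" by (simp add: variety_geometry_def)

lemma pts_iff: "p \<in> pts S \<longleftrightarrow> (\<exists>u. u \<noteq> 0 \<and> F u = 0 \<and> p = vec.span {u})"
proof -
  have "p \<in> pts S \<longleftrightarrow> (vec.subspace p \<and> vec.dim p = 1) \<and> (\<forall>x\<in>p. F x = 0)"
    by (auto simp: variety_geometry_def)
  also have "\<dots> \<longleftrightarrow> (\<exists>u. u \<noteq> 0 \<and> p = vec.span {u}) \<and> (\<forall>x\<in>p. F x = 0)"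
    unfolding subspace_dim1 ..
  also have "\<dots> \<longleftrightarrow> (\<exists>u. u \<noteq> 0 \<and> F u = 0 \<and> p = vec.span {u})"
    by (auto simp: mem_span1 F_scale intro: vec.span_base)
  finally show ?thesis .
qed

lemma span_pt: "u \<noteq> 0 \<Longrightarrow> F u = 0 \<Longrightarrow> vec.span {u} \<in> pts S"
  by (auto simp: pts_iff)

lemma lns_iff: "L \<in> lns S \<longleftrightarrow> (\<exists>x y. indep2 x y \<and> F x = 0 \<and> F y = 0 \<and> b x y = 0 \<and> L = vec.span {x, y})"
proof -
  have "L \<in> lns S \<longleftrightarrow> (vec.subspace L \<and> vec.dim L = 2) \<and> (\<forall>x\<in>L. F x = 0)"
    by (auto simp: variety_geometry_def)
  also have "\<dots> \<longleftrightarrow> (\<exists>x y. indep2 x y \<and> L = vec.span {x, y}) \<and> (\<forall>x\<in>L. F x = 0)"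
    unfolding subspace_dim2 ..
  also have "\<dots> \<longleftrightarrow> (\<exists>x y. indep2 x y \<and> F x = 0 \<and> F y = 0 \<and> b x y = 0 \<and> L = vec.span {x, y})"
    (is "?l \<longleftrightarrow> ?r")
  proof
    assume ?l
    then obtain x y where *: "indep2 x y" "L = vec.span {x, y}" "\<And>v. v \<in> L \<Longrightarrow> F v = 0" by auto
    then have 0: "F (r *s x + s *s y) = 0" for r s by (auto simp: mem_span2)
    then have "F x = 0" "F y = 0" using 0[of 1 0] 0[of 0 1] by auto
    then show ?r using * b_zero_of_F[OF 0] by blast
  qed (auto simp: mem_span2 F_combo)
  finally show ?thesis .
qed

lemma line_b: "\<lbrakk>L \<in> lns S; u \<in> L; v \<in> L\<rbrakk> \<Longrightarrow> b u v = 0"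
  by (auto simp: lns_iff mem_span2 b_expand b_self b_sym0)

lemma line_F: "\<lbrakk>L \<in> lns S; u \<in> L\<rbrakk> \<Longrightarrow> F u = 0"
  by (auto simp: lns_iff mem_span2 F_combo)

lemma span1_subset_iff: "L \<in> lns S \<Longrightarrow> vec.span {u} \<subseteq> L \<longleftrightarrow> u \<in> L"
proof -
  assume L: "L \<in> lns S"
  then have "vec.subspace L" by (simp add: variety_geometry_def)
  then show ?thesis using vec.span_minimal[of "{u}" L] vec.span_base[of u "{u}"] by auto
qed

lemma span2_line: "\<lbrakk>indep2 x y; F x = 0; F y = 0; b x y = 0\<rbrakk> \<Longrightarrow> vec.span {x, y} \<in> lns S"
  by (auto simp: lns_iff)

lemma line_eq:
  assumes "L \<in> lns S" "u \<in> L" "v \<in> L" "indep2 u v"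
  shows "L = vec.span {u, v}"
proof -
  obtain x y where "indep2 x y" "L = vec.span {x, y}" using assms(1) by (auto simp: lns_iff)
  then show ?thesis using span_pair_eq[of x y u v] assms by simp
qed

end

section \<open>The subquadrangle cut out by a hyperplane containing a frame\<close>

text \<open>The signs \<open>b w1 w3 = - 1\<close> and \<open>b w2 w4 = 1\<close> are chosen
  such that \<open>w1 + w2 + w3 + w4\<close> is singular. The last two assumptions say that the
  complement of the frame contains no points, but that every vector of its span becomes singular
  after adding a suitable vector of the complement, which may lie outside the hyperplane
  \<open>\<beta> = 0\<close>.\<close>

locale polar_frame = polar_space cj tr F b
  for cj tr :: "'a::{field,finite} \<Rightarrow> 'a" and F :: "'a^'n \<Rightarrow> 'a" and b +
  fixes \<beta> :: "'a^'n \<Rightarrow> 'a" and w1 w2 w3 w4 :: "'a^'n"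
  assumes beta_add: "\<beta> (x + y) = \<beta> x + \<beta> y" and beta_scale: "\<beta> (c *s x) = c * \<beta> x"
    and beta_nonzero: "\<exists>v. \<beta> v \<noteq> 0"
    and beta_w [simp]: "\<beta> w1 = 0" "\<beta> w2 = 0" "\<beta> w3 = 0" "\<beta> w4 = 0"
    and F_w [simp]: "F w1 = 0" "F w2 = 0" "F w3 = 0" "F w4 = 0"
    and b_w: "b w1 w2 = 0" "b w2 w3 = 0" "b w3 w4 = 0" "b w4 w1 = 0" "b w1 w3 = - 1" "b w2 w4 = 1"
    and anisotropic: "\<lbrakk>b z w1 = 0; b z w2 = 0; b z w3 = 0; b z w4 = 0; F z = 0\<rbrakk> \<Longrightarrow> z = 0"
    and universal: "\<exists>z. b z w1 = 0 \<and> b z w2 = 0 \<and> b z w3 = 0 \<and> b z w4 = 0 \<and> F z = - F v"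
begin

lemma beta_0 [simp]: "\<beta> 0 = 0" and beta_diff: "\<beta> (x - y) = \<beta> x - \<beta> y"
  using beta_scale[of 0 0] beta_add[of "x - y" y] by auto

lemma b_w_all [simp]:
  "b w1 w1 = 0" "b w1 w2 = 0" "b w1 w3 = - 1" "b w1 w4 = 0"
  "b w2 w1 = 0" "b w2 w2 = 0" "b w2 w3 = 0" "b w2 w4 = 1"
  "b w3 w1 = - 1" "b w3 w2 = 0" "b w3 w3 = 0" "b w3 w4 = 0"
  "b w4 w1 = 0" "b w4 w2 = 1" "b w4 w3 = 0" "b w4 w4 = 0"
  using b_w b_w(1-4)[THEN b_sym0[THEN iffD1]] b_sym[of w3 w1] b_sym[of w4 w2]
  by (simp_all add: b_self cj_minus)

definition perp where "perp z \<longleftrightarrow> b z w1 = 0 \<and> b z w2 = 0 \<and> b z w3 = 0 \<and> b z w4 = 0"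

definition comb where "comb c1 c2 c3 c4 = c1 *s w1 + c2 *s w2 + c3 *s w3 + c4 *s w4"

lemma b_comb [simp]:
  "b (comb c1 c2 c3 c4) w1 = - c3" "b (comb c1 c2 c3 c4) w2 = c4"
  "b (comb c1 c2 c3 c4) w3 = - c1" "b (comb c1 c2 c3 c4) w4 = c2"
  by (simp_all add: comb_def b_expand)

lemma b_comb_right: "b x (comb c1 c2 c3 c4) = cj c1 * b x w1 + cj c2 * b x w2 + cj c3 * b x w3 + cj c4 * b x w4"
  by (simp add: comb_def b_expand)

lemma beta_comb [simp]: "\<beta> (comb c1 c2 c3 c4) = 0"
  by (simp add: comb_def beta_add beta_scale)

lemma F_comb: "F (comb c1 c2 c3 c4) = tr (c2 * cj c4 - c1 * cj c3)"
proof -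
  have "F (comb c1 c2 c3 c4) = tr (c1 * - cj c3) + tr (c2 * cj c4)"
    by (simp add: comb_def F_add F_scale b_expand tr_add mult.commute)
  then show ?thesis by (simp add: tr_add[symmetric] mult.commute)
qed

lemma perp_b_comb: "perp z \<Longrightarrow> b z (comb c1 c2 c3 c4) = 0"
  by (simp add: perp_def b_comb_right)

lemma F_comb_perp: "perp z \<Longrightarrow> F (comb c1 c2 c3 c4 + z) = F (comb c1 c2 c3 c4) + F z"
  using perp_b_comb[of z c1 c2 c3 c4] b_sym0[of z] by (simp add: F_add)

definition wpart where "wpart v = comb (- b v w3) (b v w4) (- b v w1) (b v w2)"

lemma perp_diff: "perp (v - wpart v)"
proof -
  have "b (v - wpart v) u = b v u - b (wpart v) u" for u
    using b_add[of "v - wpart v" "wpart v" u] by simp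
  then show ?thesis by (simp add: perp_def wpart_def)
qed

lemma decomp: obtains z where "perp z" "v = wpart v + z"
  using perp_diff[of v] that[of "v - wpart v"] by simp

lemma wpart_comb [simp]: "wpart (comb c1 c2 c3 c4) = comb c1 c2 c3 c4"
  by (simp add: wpart_def)

lemma perp_eq_0: "perp z \<Longrightarrow> F z = 0 \<Longrightarrow> z = 0"
  using anisotropic by (simp add: perp_def)

text \<open>The component of \<open>k\<close> orthogonal to the frame is singular, hence zero by
  anisotropy.\<close>

lemma perp_two:
  assumes "F k = 0"
  shows "b k w1 = 0 \<Longrightarrow> b k w2 = 0 \<Longrightarrow> k = comb (- b k w3) (b k w4) 0 0"
    and "b k w2 = 0 \<Longrightarrow> b k w3 = 0 \<Longrightarrow> k = comb 0 (b k w4) (- b k w1) 0"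
    and "b k w3 = 0 \<Longrightarrow> b k w4 = 0 \<Longrightarrow> k = comb 0 0 (- b k w1) (b k w2)"
    and "b k w4 = 0 \<Longrightarrow> b k w1 = 0 \<Longrightarrow> k = comb (- b k w3) 0 0 (b k w2)"
proof -
  obtain z where z: "perp z" "k = wpart k + z" using decomp .
  have "F k = F (wpart k) + F z"
    using F_comb_perp[OF z(1), of "- b k w3" "b k w4" "- b k w1" "b k w2"] z(2) by (metis wpart_def)
  then have "F (wpart k) = 0 \<Longrightarrow> k = wpart k"
    using assms perp_eq_0[OF z(1)] z(2) by simp
  then show "b k w1 = 0 \<Longrightarrow> b k w2 = 0 \<Longrightarrow> k = comb (- b k w3) (b k w4) 0 0"
    and "b k w2 = 0 \<Longrightarrow> b k w3 = 0 \<Longrightarrow> k = comb 0 (b k w4) (- b k w1) 0"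
    and "b k w3 = 0 \<Longrightarrow> b k w4 = 0 \<Longrightarrow> k = comb 0 0 (- b k w1) (b k w2)"
    and "b k w4 = 0 \<Longrightarrow> b k w1 = 0 \<Longrightarrow> k = comb (- b k w3) 0 0 (b k w2)"
    by (auto simp: wpart_def F_comb)
qed

text \<open>A totally singular space of dimension 3 would meet, for each pair of adjacent frame
  vectors, the orthogonal space of the pair, hence the line spanned by it. But four nonzero
  vectors on the four sides of the frame cannot be pairwise orthogonal.\<close>

lemma no_three:
  assumes F: "F x = 0" "F y = 0" "F z = 0" and o: "b x y = 0" "b y z = 0" "b x z = 0"
  shows "\<exists>r s t. (r \<noteq> 0 \<or> s \<noteq> 0 \<or> t \<noteq> 0) \<and> r *s x + s *s y + t *s z = 0"
proof (rule ccontr)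
  assume ind: "\<not> ?thesis"
  define X where "X = {r *s x + s *s y + t *s z | r s t. True}"
  have ts: "F k = 0" if "k \<in> X" for k
    using that F o by (auto simp: X_def F_add F_scale b_expand)
  have to: "b k l = 0" if "k \<in> X" "l \<in> X" for k l
    using that F o o[THEN b_sym0[THEN iffD1]] by (auto simp: X_def b_expand b_self)
  have ex: "\<exists>k\<in>X. k \<noteq> 0 \<and> b k u = 0 \<and> b k v = 0" for u v
  proof -
    obtain r s t where *: "r \<noteq> 0 \<or> s \<noteq> 0 \<or> t \<noteq> 0"
      "r * b x u + s * b y u + t * b z u = 0" "r * b x v + s * b y v + t * b z v = 0"
      using two_equations[of "b x u" "b y u" "b z u" "b x v" "b y v" "b z v"] by auto
    then show ?thesis using ind
      by (intro bexI[of _ "r *s x + s *s y + t *s z"]) (auto simp: X_def b_expand)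
  qed
  obtain k where k: "k \<in> X" "k \<noteq> 0" "b k w1 = 0" "b k w2 = 0" using ex[of w1 w2] by auto
  obtain l where l: "l \<in> X" "l \<noteq> 0" "b l w2 = 0" "b l w3 = 0" using ex[of w2 w3] by auto
  obtain m where m: "m \<in> X" "m \<noteq> 0" "b m w3 = 0" "b m w4 = 0" using ex[of w3 w4] by auto
  obtain n where n: "n \<in> X" "n \<noteq> 0" "b n w4 = 0" "b n w1 = 0" using ex[of w4 w1] by auto
  have 0: "comb 0 0 0 0 = 0" by (simp add: comb_def)
  obtain k1 k2 where k': "k = comb k1 k2 0 0" "k1 \<noteq> 0 \<or> k2 \<noteq> 0" using perp_two(1)[OF ts[OF k(1)]] k 0 by metis
  obtain l2 l3 where l': "l = comb 0 l2 l3 0" "l2 \<noteq> 0 \<or> l3 \<noteq> 0" using perp_two(2)[OF ts[OF l(1)]] l 0 by metis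
  obtain m3 m4 where m': "m = comb 0 0 m3 m4" "m3 \<noteq> 0 \<or> m4 \<noteq> 0" using perp_two(3)[OF ts[OF m(1)]] m 0 by metis
  obtain n1 n4 where n': "n = comb n1 0 0 n4" "n1 \<noteq> 0 \<or> n4 \<noteq> 0" using perp_two(4)[OF ts[OF n(1)]] n 0 by metis
  have "k1 * cj m3 = k2 * cj m4" using to[OF k(1) m(1)] by (simp add: k' m' b_comb_right mult.commute)
  moreover have "l2 * cj n4 = l3 * cj n1" using to[OF l(1) n(1)] by (simp add: l' n' b_comb_right mult.commute)
  moreover have "k1 = 0 \<or> l3 = 0" using to[OF k(1) l(1)] by (auto simp: k' l' b_comb_right)
  moreover have "l2 = 0 \<or> m4 = 0" using to[OF l(1) m(1)] by (auto simp: l' m' b_comb_right)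
  moreover have "m3 = 0 \<or> n1 = 0" using to[OF m(1) n(1)] by (auto simp: m' n' b_comb_right)
  moreover have "k2 = 0 \<or> n4 = 0" using to[OF k(1) n(1)] by (auto simp: k' n' b_comb_right)
  ultimately show False using k' l' m' n' by auto
qed

lemma in_line_of_perp:
  assumes "F x = 0" "F y = 0" "F z = 0" "b x y = 0" "b y z = 0" "b x z = 0" "indep2 y z"
  shows "\<exists>s t. x = s *s y + t *s z"
proof -
  obtain r s t where *: "r \<noteq> 0 \<or> s \<noteq> 0 \<or> t \<noteq> 0" "r *s x + s *s y + t *s z = 0"
    using no_three assms by metis
  have "r \<noteq> 0" using * assms(7) by (auto simp: indep2_def)
  have "r *s x = (- s) *s y + (- t) *s z" using *(2) by (simp add: algebra_simps eq_neg_iff_add_eq_0)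
  then have "inverse r *s (r *s x) = inverse r *s ((- s) *s y + (- t) *s z)" by simp
  then have "x = (inverse r * - s) *s y + (inverse r * - t) *s z"
    using \<open>r \<noteq> 0\<close> by (simp add: vector_smult_assoc vec.scale_right_distrib)
  then show ?thesis by blast
qed

abbreviation "H \<equiv> {v. \<beta> v = 0}"
abbreviation "S' \<equiv> section_geometry F H"

lemma span1_H: "vec.span {u} \<subseteq> H \<longleftrightarrow> \<beta> u = 0"
  by (auto simp: mem_span1 beta_scale intro: vec.span_base)

lemma span2_H: "\<beta> x = 0 \<Longrightarrow> \<beta> y = 0 \<Longrightarrow> vec.span {x, y} \<subseteq> H"
  by (auto simp: mem_span2 beta_scale beta_add)

lemma S'_simps: "pts S' = {p \<in> pts S. p \<subseteq> H}" "lns S' = {L \<in> lns S. L \<subseteq> H}"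
  by (simp_all add: section_geometry_def)

lemma pts'_iff: "p \<in> pts S' \<longleftrightarrow> (\<exists>u. u \<noteq> 0 \<and> F u = 0 \<and> \<beta> u = 0 \<and> p = vec.span {u})"
  using span1_H by (auto simp: S'_simps pts_iff)

lemma ortho_combo: "b u (cj (b u y) *s x - cj (b u x) *s y) = 0"
proof -
  have "cj (b u y) *s x - cj (b u x) *s y = cj (b u y) *s x + (- cj (b u x)) *s y" by simp
  then show ?thesis by (simp only: b_expand cj_minus cj_cj) simp
qed

lemma line_partner:
  assumes u: "u \<noteq> 0" "F u = 0"
  shows "\<exists>v. indep2 u v \<and> F v = 0 \<and> b u v = 0"
proof (cases "b u w1 = 0 \<and> b u w2 = 0")
  case True
  have "indep2 u w1 \<or> indep2 u w2"
  proof (rule ccontr)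
    assume "\<not> ?thesis"
    then obtain r s where rs: "w1 = r *s u" "w2 = s *s u" using not_indep2 u by blast
    then have "b (s *s w1) w3 = b (r *s w2) w3" by (simp add: vector_smult_assoc mult.commute)
    then have "s = 0" by (simp add: b_scale)
    then have "w2 = 0" using rs by simp
    then show False using b_w(6) by simp
  qed
  then show ?thesis using True by auto
next
  case False
  let ?r = "cj (b u w2) *s w1 + (- cj (b u w1)) *s w2"
  have r: "b u ?r = 0" "F ?r = 0" "b ?r w1 = 0" "b ?r w2 = 0"
    by (simp_all add: b_expand F_diff F_scale mult.commute)
  have "b ?r w3 = - cj (b u w2)" "b ?r w4 = - cj (b u w1)" by (simp_all add: b_expand)
  then have r0: "?r \<noteq> 0" using False by (metis b_zero(1) cj_eq_0 neg_equal_0_iff_equal)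
  have "indep2 u ?r"
  proof (rule ccontr)
    assume "\<not> ?thesis"
    then obtain c where c: "?r = c *s u" using not_indep2 u by blast
    then have "c \<noteq> 0" using r0 by auto
    then show False using r(3,4) False unfolding c by (simp add: b_scale)
  qed
  then show ?thesis using r by blast
qed

lemma coll_iff:
  assumes "u \<noteq> 0" "F u = 0" "v \<noteq> 0" "F v = 0"
  shows "collinear_in S (vec.span {u}) (vec.span {v}) \<longleftrightarrow> b u v = 0"
proof
  assume "collinear_in S (vec.span {u}) (vec.span {v})"
  then obtain L where "L \<in> lns S" "vec.span {u} \<subseteq> L" "vec.span {v} \<subseteq> L" by (auto simp: collinear_in_def)
  then show "b u v = 0" using line_b by (auto simp: span1_subset_iff)
next
  assume uv: "b u v = 0"
  show "collinear_in S (vec.span {u}) (vec.span {v})"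
  proof (cases "indep2 u v")
    case True
    then show ?thesis using span2_line[of u v] assms uv
      by (auto simp: collinear_in_def span1_subset_iff intro!: bexI[of _ "vec.span {u, v}"] vec.span_base)
  next
    case False
    then obtain c where c: "v = c *s u" using not_indep2 assms by blast
    obtain x where x: "indep2 u x" "F x = 0" "b u x = 0" using line_partner assms by blast
    then have L: "vec.span {u, x} \<in> lns S" using span2_line assms by blast
    have "u \<in> vec.span {u, x}" "v \<in> vec.span {u, x}"
      unfolding c by (auto intro: vec.span_base vec.span_scale)
    then show ?thesis using L by (auto simp: collinear_in_def span1_subset_iff)
  qed
qed

lemma indep2_of_span_ne: "u \<noteq> 0 \<Longrightarrow> v \<noteq> 0 \<Longrightarrow> vec.span {u} \<noteq> vec.span {v} \<Longrightarrow> indep2 u v"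
proof (rule ccontr)
  assume *: "u \<noteq> 0" "v \<noteq> 0" "vec.span {u} \<noteq> vec.span {v}" "\<not> indep2 u v"
  then obtain c where "v = c *s u" using not_indep2 by blast
  then have "c \<noteq> 0 \<and> v = c *s u" using * by auto
  then show False using * span_singleton_eq[of v u] by blast
qed

lemma span_ne_of_indep2: "indep2 u v \<Longrightarrow> vec.span {u} \<noteq> vec.span {v}"
proof
  assume i: "indep2 u v" and "vec.span {u} = vec.span {v}"
  then obtain c where "u = c *s v" using span_singleton_eq indep2_nonzero by blast
  then have "1 *s u + (- c) *s v = 0" by simp
  then show False using i unfolding indep2_def by (metis zero_neq_one)
qed

text \<open>The vector \<open>r\<close> spans the point of the line \<open>\<langle>x,
  v\<rangle>\<close> collinear with \<open>u\<close>; the vector \<open>t\<close> certifies that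
  it is not zero.\<close>

lemma combo_partner:
  fixes u x v
  defines "r \<equiv> cj (b u v) *s x - cj (b u x) *s v"
  assumes "F x = 0" "F v = 0" "\<beta> x = 0" "\<beta> v = 0" "b x v = 0" "b u x \<noteq> 0" "b x t = 0" "b v t \<noteq> 0"
  shows "F r = 0" "b u r = 0" "\<beta> r = 0" "indep2 u r"
proof -
  have vx: "b v x = 0" using assms b_sym0 by auto
  have "b r x = 0" using assms vx by (simp add: b_expand b_self)
  show "F r = 0" using assms by (simp add: F_diff F_scale b_expand)
  show "b u r = 0" by (simp add: r_def ortho_combo)
  show "\<beta> r = 0" using assms by (simp add: beta_diff beta_scale)
  have "b r t \<noteq> 0" using assms by (simp add: b_expand)
  then have r0: "r \<noteq> 0" by auto
  show "indep2 u r"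
  proof (rule ccontr)
    assume "\<not> ?thesis"
    moreover have "u \<noteq> 0" using assms by auto
    ultimately obtain c where c: "r = c *s u" using not_indep2 by blast
    then show False using r0 \<open>b r x = 0\<close> \<open>b u x \<noteq> 0\<close> by (simp add: b_scale)
  qed
qed

lemma two_lines_at:
  assumes u: "F u = 0" "\<beta> u = 0" and w: "F x = 0" "F y = 0" "F z = 0" "\<beta> x = 0" "\<beta> y = 0" "\<beta> z = 0"
    and o: "b x y = 0" "b x z = 0" "b y z \<noteq> 0" "b u x \<noteq> 0"
  shows "\<exists>L\<in>lns S'. \<exists>M\<in>lns S'. L \<noteq> M \<and> u \<in> L \<and> u \<in> M"
proof -
  define r where "r = cj (b u y) *s x - cj (b u x) *s y"
  define s where "s = cj (b u z) *s x - cj (b u x) *s z"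
  have zy: "b z y \<noteq> 0" "b y x = 0" using o b_sym0 by auto
  note r = combo_partner[OF w(1,2,4,5) o(1,4,2,3), folded r_def]
  note s = combo_partner[OF w(1,3,4,6) o(2,4,1) zy(1), folded s_def]
  have L: "vec.span {u, r} \<in> lns S'" "vec.span {u, s} \<in> lns S'"
    using r s u span2_line[of u] span2_H[of u] by (auto simp: S'_simps)
  have "b r s \<noteq> 0" using o zy b_self[OF w(1)] by (simp add: r_def s_def b_expand)
  moreover have "r \<in> vec.span {u, r}" "s \<in> vec.span {u, s}" "u \<in> vec.span {u, r}" "u \<in> vec.span {u, s}"
    by (auto intro: vec.span_base)
  ultimately show ?thesis
    using L line_b[of "vec.span {u, r}" r s] unfolding S'_simps by blast
qed

text \<open>Projecting a point to a line amounts to solving one linear equation on a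
  two-dimensional space; the solution is unique because there are no totally singular spaces of
  dimension 3.\<close>

theorem gq: "gq_hyperplane S S'"
proof
  show "finite (pts S)" "finite (lns S)" by auto
next
  fix L M p r assume *: "L \<in> lns S" "M \<in> lns S" "p \<in> pts S" "r \<in> pts S" "p \<noteq> r"
    "inc S p L" "inc S r L" "inc S p M" "inc S r M"
  then obtain u v where uv: "u \<noteq> 0" "p = vec.span {u}" "v \<noteq> 0" "r = vec.span {v}" by (auto simp: pts_iff)
  then have "indep2 u v" using * indep2_of_span_ne by blast
  then show "L = M" using line_eq[of L u v] line_eq[of M u v] * uv by (auto simp: span1_subset_iff)
next
  fix p L assume *: "p \<in> pts S" "L \<in> lns S" "\<not> inc S p L"
  then obtain u where u: "u \<noteq> 0" "F u = 0" "p = vec.span {u}" by (auto simp: pts_iff)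
  obtain x y where xy: "indep2 x y" "F x = 0" "F y = 0" "b x y = 0" "L = vec.span {x, y}"
    using * by (auto simp: lns_iff)
  define r where "r = (if b u x = 0 then x else cj (b u y) *s x - cj (b u x) *s y)"
  have 1: "b u r = 0" using ortho_combo by (auto simp: r_def)
  have "cj (b u y) *s x - cj (b u x) *s y = cj (b u y) *s x + (- cj (b u x)) *s y" by simp
  then have 2: "r \<noteq> 0" using xy(1) indep2_nonzero[OF xy(1)] unfolding r_def indep2_def
    by (metis cj_eq_0 neg_equal_0_iff_equal)
  have 3: "r \<in> L" unfolding r_def xy(5) by (auto intro: vec.span_base vec.span_diff vec.span_scale)
  then have "F r = 0" using line_F * by auto
  then show "\<exists>r\<in>pts S. inc S r L \<and> collinear_in S p r"
    using 1 2 3 u coll_iff[of u r] span_pt[of r] *(2)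
    by (intro bexI[of _ "vec.span {r}"]) (auto simp: span1_subset_iff)
next
  fix p L r s assume *: "p \<in> pts S" "L \<in> lns S" "\<not> inc S p L" "r \<in> pts S" "s \<in> pts S"
    "inc S r L" "inc S s L" "collinear_in S p r" "collinear_in S p s"
  obtain u v w where u: "u \<noteq> 0" "F u = 0" "p = vec.span {u}" and v: "v \<noteq> 0" "F v = 0" "r = vec.span {v}"
    and w: "w \<noteq> 0" "F w = 0" "s = vec.span {w}" using * by (auto simp: pts_iff)
  show "r = s"
  proof (rule ccontr)
    assume "r \<noteq> s"
    then have i: "indep2 v w" using v w indep2_of_span_ne by blast
    have L: "v \<in> L" "w \<in> L" using * v w by (auto simp: span1_subset_iff)
    have "b u v = 0" "b u w = 0" using * u v w coll_iff by auto
    then obtain c d where "u = c *s v + d *s w"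
      using in_line_of_perp[OF u(2) v(2) w(2)] line_b[OF *(2) L] i by blast
    then have "u \<in> L" using line_eq[OF *(2) L i] by (auto simp: mem_span2)
    then show False using * u by (auto simp: span1_subset_iff)
  qed
next
  fix L assume L: "L \<in> lns S"
  then obtain x y where xy: "indep2 x y" "F x = 0" "F y = 0" "b x y = 0" "L = vec.span {x, y}"
    by (auto simp: lns_iff)
  have i: "indep2 x (x + y)" "indep2 y (x + y)"
  proof -
    have "r *s x + s *s (x + y) = (r + s) *s x + s *s y" "r *s y + s *s (x + y) = s *s x + (r + s) *s y" for r s
      by (simp_all add: vec.scale_left_distrib vec.scale_right_distrib algebra_simps)
    then show "indep2 x (x + y)" "indep2 y (x + y)"
      using xy(1) unfolding indep2_def by (metis add.right_neutral add.left_neutral)+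
  qed
  have "x \<in> L" "y \<in> L" "x + y \<in> L" unfolding xy(5) by (auto intro: vec.span_base vec.span_add)
  moreover have "F (x + y) = 0" using calculation line_F L by auto
  ultimately show "\<exists>p\<in>pts S. \<exists>r\<in>pts S. \<exists>s\<in>pts S.
      p \<noteq> r \<and> p \<noteq> s \<and> r \<noteq> s \<and> inc S p L \<and> inc S r L \<and> inc S s L"
    using xy(1-3) i L indep2_nonzero[OF i(1)] indep2_nonzero[OF i(2)]
      span_ne_of_indep2[OF xy(1)] span_ne_of_indep2[OF i(1)] span_ne_of_indep2[OF i(2)]
      span_pt[of x] span_pt[of y] span_pt[of "x + y"] span1_subset_iff[OF L]
    by (intro bexI[of _ "vec.span {x}"] bexI[of _ "vec.span {y}"] bexI[of _ "vec.span {x + y}"]) simp_all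
next
  show "pts S' \<subseteq> pts S" by (auto simp: S'_simps)
next
  show "lns S' = {L \<in> lns S. \<forall>p\<in>pts S. inc S p L \<longrightarrow> p \<in> pts S'}"
  proof (intro equalityI subsetI)
    fix L assume "L \<in> {L \<in> lns S. \<forall>p\<in>pts S. inc S p L \<longrightarrow> p \<in> pts S'}"
    then have L: "L \<in> lns S" "\<And>p. p \<in> pts S \<Longrightarrow> p \<subseteq> L \<Longrightarrow> p \<subseteq> H" by (auto simp: S'_simps)
    have "v \<in> H" if "v \<in> L" for v
      using L(2)[of "vec.span {v}"] span_pt[of v] line_F[OF L(1) that] that span1_subset_iff[OF L(1)] span1_H[of v]
      by (cases "v = 0") auto
    then show "L \<in> lns S'" using L by (auto simp: S'_simps)
  qed (auto simp: S'_simps)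
next
  fix L assume L: "L \<in> lns S" "L \<notin> lns S'"
  then obtain x y where xy: "indep2 x y" "F x = 0" "F y = 0" "b x y = 0" "L = vec.span {x, y}"
    by (auto simp: lns_iff)
  have nH: "\<not> (\<beta> x = 0 \<and> \<beta> y = 0)" using span2_H[of x y] L xy by (auto simp: S'_simps)
  let ?v = "\<beta> y *s x - \<beta> x *s y"
  have v: "\<beta> ?v = 0" "?v \<in> L"
    unfolding xy(5) by (auto simp: beta_diff beta_scale intro: vec.span_base vec.span_diff vec.span_scale)
  have "?v = \<beta> y *s x + (- \<beta> x) *s y" by simp
  then have v0: "?v \<noteq> 0" using nH xy(1) unfolding indep2_def by (metis neg_equal_0_iff_equal)
  with v have ex: "vec.span {?v} \<in> pts S'" "vec.span {?v} \<subseteq> L"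
    using line_F[OF L(1) v(2)] span1_subset_iff[OF L(1)] unfolding pts'_iff by blast+
  show "\<exists>!p. p \<in> pts S' \<and> inc S p L"
  proof (rule ex_ex1I)
    show "\<exists>p. p \<in> pts S' \<and> inc S p L" using ex by auto
    fix p r assume pr: "p \<in> pts S' \<and> inc S p L" "r \<in> pts S' \<and> inc S r L"
    then obtain u v where uv: "u \<noteq> 0" "\<beta> u = 0" "p = vec.span {u}" "v \<noteq> 0" "\<beta> v = 0" "r = vec.span {v}"
      by (auto simp: pts'_iff)
    show "p = r"
    proof (rule ccontr)
      assume "p \<noteq> r"
      then have "indep2 u v" using uv indep2_of_span_ne by blast
      then have "L = vec.span {u, v}" using line_eq[OF L(1)] pr uv span1_subset_iff[OF L(1)] by auto
      then have "L \<subseteq> H" using span2_H uv by auto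
      then show False using L by (auto simp: S'_simps)
    qed
  qed
next
  fix p assume "p \<in> pts S'"
  then obtain u where u: "u \<noteq> 0" "F u = 0" "\<beta> u = 0" "p = vec.span {u}" by (auto simp: pts'_iff)
  consider "b u w1 \<noteq> 0" | "b u w2 \<noteq> 0" | "b u w3 \<noteq> 0" | "b u w4 \<noteq> 0" using anisotropic u by blast
  then have "\<exists>L\<in>lns S'. \<exists>M\<in>lns S'. L \<noteq> M \<and> u \<in> L \<and> u \<in> M"
  proof cases
    case 1 show ?thesis by (rule two_lines_at[OF u(2,3), of w1 w2 w4]) (use 1 in simp_all)
  next
    case 2 show ?thesis by (rule two_lines_at[OF u(2,3), of w2 w1 w3]) (use 2 in simp_all)
  next
    case 3 show ?thesis by (rule two_lines_at[OF u(2,3), of w3 w2 w4]) (use 3 in simp_all)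
  next
    case 4 show ?thesis by (rule two_lines_at[OF u(2,3), of w4 w1 w3]) (use 4 in simp_all)
  qed
  then show "\<exists>L\<in>lns S'. \<exists>M\<in>lns S'. L \<noteq> M \<and> inc S p L \<and> inc S p M"
    using u by (auto simp: S'_simps span1_subset_iff)
next
  obtain v where v: "\<beta> v \<noteq> 0" using beta_nonzero by auto
  obtain z where z: "perp z" "v = wpart v + z" using decomp .
  have bz: "\<beta> z \<noteq> 0" using v z(2) beta_add[of "wpart v" z] by (auto simp: wpart_def)
  obtain c where c: "tr c = F z" using tr_onto by auto
  \<comment> \<open>the value of \<open>F\<close> at the combination of \<open>w1\<close> and \<open>w3\<close> is \<open>- tr c\<close>\<close>
  let ?x = "comb c 0 1 0 + z"
  have "F ?x = 0" using F_comb_perp[OF z(1)] c by (simp add: F_comb tr_minus)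
  moreover have "\<beta> ?x \<noteq> 0" using bz by (simp add: beta_add)
  moreover have "?x \<noteq> 0" using calculation(2) by (metis beta_0)
  ultimately have "vec.span {?x} \<in> pts S - pts S'"
    using span_pt[of ?x] span1_H[of ?x] unfolding S'_simps by blast
  then show "pts S - pts S' \<noteq> {}" by blast
next
  have "w1 \<noteq> 0" by (metis b_w(5) b_zero(1) zero_neq_one neg_equal_0_iff_equal)
  then have "vec.span {w1} \<in> pts S'" using pts'_iff by auto
  then show "pts S' \<noteq> {}" by blast
qed

end

section \<open>The image of a frame\<close>

text \<open>A function \<open>\<rho>\<close> that expresses the ratio of the new coordinates
  \<open>ni, nj\<close> by the ratio of the old ones \<open>oi, oj\<close>.\<close>

definition ratio_map where
  "ratio_map P oi oj ni nj \<rho> \<longleftrightarrow> \<rho> 1 = 1 \<and> (\<forall>r. r \<noteq> 0 \<longrightarrow> \<rho> r \<noteq> 0) \<and>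
     (\<forall>r s. r \<noteq> 0 \<longrightarrow> s \<noteq> 0 \<longrightarrow> \<rho> r = \<rho> s \<longrightarrow> r = s) \<and>
     (\<forall>x. P x \<longrightarrow> oi x \<noteq> 0 \<longrightarrow> oj x \<noteq> 0 \<longrightarrow> ni x = \<rho> (oi x / oj x) * nj x)"

lemma ratio_mapD:
  assumes "ratio_map P oi oj ni nj \<rho>"
  shows "\<rho> 1 = 1" "r \<noteq> 0 \<Longrightarrow> \<rho> r \<noteq> 0" "r \<noteq> 0 \<Longrightarrow> s \<noteq> 0 \<Longrightarrow> \<rho> r = \<rho> s \<Longrightarrow> r = s"
    "P x \<Longrightarrow> oi x \<noteq> 0 \<Longrightarrow> oj x \<noteq> 0 \<Longrightarrow> ni x = \<rho> (oi x / oj x) * nj x"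
  using assms unfolding ratio_map_def by blast+

text \<open>It suffices that equality of old ratios is equivalent to equality of new
  ratios.\<close>

lemma ratio_map_exists:
  fixes oi oj ni nj :: "'v \<Rightarrow> 'a::field"
  assumes iff: "\<And>x y. \<lbrakk>P x; P y; oi x \<noteq> 0; oj x \<noteq> 0; oi y \<noteq> 0; oj y \<noteq> 0\<rbrakk> \<Longrightarrow>
        oi x * oj y = oj x * oi y \<longleftrightarrow> ni x * nj y = nj x * ni y"
    and zero: "\<And>x. P x \<Longrightarrow> ni x = 0 \<longleftrightarrow> oi x = 0" "\<And>x. P x \<Longrightarrow> nj x = 0 \<longleftrightarrow> oj x = 0"
    and u: "P u" "oi u = 1" "oj u = 1" "ni u = 1" "nj u = 1"
    and ex: "\<And>r. r \<noteq> 0 \<Longrightarrow> \<exists>x. P x \<and> oi x = r \<and> oj x = 1"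
  shows "\<exists>\<rho>. ratio_map P oi oj ni nj \<rho>"
proof -
  obtain X where X: "\<And>r. r \<noteq> 0 \<Longrightarrow> P (X r) \<and> oi (X r) = r \<and> oj (X r) = 1" using ex by metis
  define \<rho> where "\<rho> r = ni (X r) / nj (X r)" for r
  have nz: "ni (X r) \<noteq> 0" "nj (X r) \<noteq> 0" if "r \<noteq> 0" for r using X[OF that] zero that by auto
  have main: "ni x = \<rho> (oi x / oj x) * nj x" if x: "P x" "oi x \<noteq> 0" "oj x \<noteq> 0" for x
  proof -
    let ?y = "X (oi x / oj x)"
    have r: "oi x / oj x \<noteq> 0" using x by auto
    have "ni x * nj ?y = nj x * ni ?y"
      using X[OF r] x by (subst iff[symmetric]) auto
    then show ?thesis using nz[OF r] by (simp add: \<rho>_def field_simps)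
  qed
  have "r = s" if "r \<noteq> 0" "s \<noteq> 0" "\<rho> r = \<rho> s" for r s
  proof -
    have "ni (X r) * nj (X s) = nj (X r) * ni (X s)"
      using that nz by (simp add: \<rho>_def field_simps)
    then show ?thesis using iff[of "X r" "X s"] X[of r] X[of s] that by simp
  qed
  moreover have "\<rho> 1 = 1" using main[of u] u by simp
  moreover have "\<rho> r \<noteq> 0" if "r \<noteq> 0" for r using nz[OF that] by (simp add: \<rho>_def)
  ultimately show ?thesis using main unfolding ratio_map_def by (intro exI[of _ \<rho>] conjI allI impI)
qed

text \<open>A lift of the associated map to vectors. For a singular \<open>u\<close> in the
  hyperplane, \<open>\<Phi> u\<close> spans the image of the point
  \<open>\<langle>u\<rangle>\<close>; for a singular \<open>x\<close> outside, \<open>\<Phi>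
  x\<close> spans a point subtending the image of the ovoid subtended by
  \<open>\<langle>x\<rangle>\<close>. Both facts are expressed by
  \<open>Phi_perp\<close>.\<close>

locale frame_map = polar_frame cj tr F b \<beta> w1 w2 w3 w4
  for cj tr :: "'a::{field,finite} \<Rightarrow> 'a" and F :: "'a^'n \<Rightarrow> 'a" and b \<beta> w1 w2 w3 w4 +
  fixes \<Phi> :: "'a^'n \<Rightarrow> 'a^'n"
  assumes Phi_nz: "\<lbrakk>x \<noteq> 0; F x = 0\<rbrakk> \<Longrightarrow> \<Phi> x \<noteq> 0" and Phi_F: "\<lbrakk>x \<noteq> 0; F x = 0\<rbrakk> \<Longrightarrow> F (\<Phi> x) = 0"
    and Phi_H: "\<lbrakk>u \<noteq> 0; F u = 0; \<beta> u = 0\<rbrakk> \<Longrightarrow> \<beta> (\<Phi> u) = 0"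
    and Phi_perp: "\<lbrakk>x \<noteq> 0; F x = 0; u \<noteq> 0; F u = 0; \<beta> u = 0\<rbrakk> \<Longrightarrow> b (\<Phi> x) (\<Phi> u) = 0 \<longleftrightarrow> b x u = 0"
    and Phi_scale: "\<lbrakk>u \<noteq> 0; F u = 0; \<beta> u = 0; c \<noteq> 0\<rbrakk> \<Longrightarrow> \<exists>k. k \<noteq> 0 \<and> \<Phi> (c *s u) = k *s \<Phi> u"
begin

abbreviation sing where "sing x \<equiv> x \<noteq> 0 \<and> F x = 0"
abbreviation singH where "singH x \<equiv> x \<noteq> 0 \<and> F x = 0 \<and> \<beta> x = 0"

lemma w_nz [simp]: "w1 \<noteq> 0" "w2 \<noteq> 0" "w3 \<noteq> 0" "w4 \<noteq> 0"
  using b_w_all by (metis b_zero(1) zero_neq_one neg_equal_0_iff_equal)+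

lemma Phi_indep:
  assumes "sing u" "sing v" "singH t" "b u t \<noteq> 0" "b v t = 0"
  shows "indep2 (\<Phi> u) (\<Phi> v)"
proof (rule ccontr)
  assume "\<not> ?thesis"
  then obtain r where r: "\<Phi> v = r *s \<Phi> u" using not_indep2 Phi_nz assms by blast
  then have "r * b (\<Phi> u) (\<Phi> t) = b (\<Phi> v) (\<Phi> t)" by (simp add: b_scale)
  then have "r = 0" using assms Phi_perp[of v t] Phi_perp[of u t] by auto
  then show False using r Phi_nz[of v] assms by simp
qed

lemma Phi_line:
  assumes "singH u" "singH v" "b u v = 0" "indep2 (\<Phi> u) (\<Phi> v)" "sing x" "b x u = 0" "b x v = 0"
  shows "\<exists>s t. \<Phi> x = s *s \<Phi> u + t *s \<Phi> v"
  using assms Phi_perp Phi_F by (intro in_line_of_perp) auto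

text \<open>Equality of the ratios for \<open>x\<close> and \<open>y\<close> means that they are
  perpendicular to the same point \<open>p\<close> of the line \<open>\<langle>u,
  v\<rangle>\<close>, and \<open>\<Phi>\<close> preserves this.\<close>

lemma Phi_ratio:
  assumes uv: "singH u" "singH v" "b u v = 0" "indep2 u v" "indep2 (\<Phi> u) (\<Phi> v)" and x: "sing x" and y: "sing y"
    and nz: "b x u \<noteq> 0" "b x v \<noteq> 0" "b y u \<noteq> 0" "b y v \<noteq> 0"
  shows "b x u * b y v = b x v * b y u \<longleftrightarrow>
    b (\<Phi> x) (\<Phi> u) * b (\<Phi> y) (\<Phi> v) = b (\<Phi> x) (\<Phi> v) * b (\<Phi> y) (\<Phi> u)"
proof -
  let ?p = "cj (b x v) *s u - cj (b x u) *s v"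
  have "?p = cj (b x v) *s u + (- cj (b x u)) *s v" by simp
  then have p0: "?p \<noteq> 0" using uv(4) nz unfolding indep2_def by (metis cj_eq_0)
  have vu: "b v u = 0" using uv b_sym0 by auto
  have p: "F ?p = 0" "\<beta> ?p = 0" "b x ?p = 0" "b ?p u = 0" "b ?p v = 0"
    using uv vu by (auto simp: F_diff F_scale b_expand beta_diff beta_scale b_self mult.commute)
  obtain s t where st: "\<Phi> ?p = s *s \<Phi> u + t *s \<Phi> v"
    using Phi_line[of u v ?p] uv p p0 by blast
  have N: "b (\<Phi> z) (\<Phi> ?p) = cj s * b (\<Phi> z) (\<Phi> u) + cj t * b (\<Phi> z) (\<Phi> v)" for z
    by (simp add: st b_expand)
  have Nnz: "b (\<Phi> x) (\<Phi> v) \<noteq> 0" "b (\<Phi> x) (\<Phi> u) \<noteq> 0" using Phi_perp x uv nz by auto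
  have x0: "cj s * b (\<Phi> x) (\<Phi> u) + cj t * b (\<Phi> x) (\<Phi> v) = 0"
    using Phi_perp[of x ?p] N[of x] x p p0 by auto
  have s0: "s \<noteq> 0"
  proof
    assume "s = 0"
    then have "t = 0" using x0 Nnz by auto
    then show False using st \<open>s = 0\<close> Phi_nz[of ?p] p p0 by auto
  qed
  have "b x u * b y v = b x v * b y u \<longleftrightarrow> b y ?p = 0"
    by (auto simp: b_expand mult.commute)
  also have "\<dots> \<longleftrightarrow> b (\<Phi> y) (\<Phi> ?p) = 0" using Phi_perp[of y ?p] y p p0 by auto
  also have "\<dots> \<longleftrightarrow> b (\<Phi> x) (\<Phi> v) * (cj s * b (\<Phi> y) (\<Phi> u) + cj t * b (\<Phi> y) (\<Phi> v)) = 0"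
    using N Nnz by simp
  also have "b (\<Phi> x) (\<Phi> v) * (cj s * b (\<Phi> y) (\<Phi> u) + cj t * b (\<Phi> y) (\<Phi> v)) =
      cj s * (b (\<Phi> x) (\<Phi> v) * b (\<Phi> y) (\<Phi> u)) + (cj t * b (\<Phi> x) (\<Phi> v)) * b (\<Phi> y) (\<Phi> v)"
    by (simp add: algebra_simps)
  also have "cj t * b (\<Phi> x) (\<Phi> v) = - (cj s * b (\<Phi> x) (\<Phi> u))"
    using x0 by (simp add: eq_neg_iff_add_eq_0 add.commute)
  also have "cj s * (b (\<Phi> x) (\<Phi> v) * b (\<Phi> y) (\<Phi> u)) + - (cj s * b (\<Phi> x) (\<Phi> u)) * b (\<Phi> y) (\<Phi> v)
      = cj s * (b (\<Phi> x) (\<Phi> v) * b (\<Phi> y) (\<Phi> u) - b (\<Phi> x) (\<Phi> u) * b (\<Phi> y) (\<Phi> v))"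
    by (simp add: algebra_simps)
  also have "\<dots> = 0 \<longleftrightarrow> b (\<Phi> x) (\<Phi> u) * b (\<Phi> y) (\<Phi> v) = b (\<Phi> x) (\<Phi> v) * b (\<Phi> y) (\<Phi> u)"
    using s0 by auto
  finally show ?thesis .
qed

text \<open>Coordinates \<open>o1, \<dots>, o4\<close> of a singular vector and \<open>n1, \<dots>, n4\<close> of its image, measured by scalar products with
  the frame and its image and normalized to be 1 at the unit point. They see only the perpendicularity
  relation, so they make sense for vectors outside the span of the frame as well.\<close>

definition "unit = comb 1 1 1 1"

definition "o1 x = - b x w1"
definition "o2 x = b x w2"
definition "o3 x = - b x w3"
definition "o4 x = b x w4"
definition "n1 x = b (\<Phi> x) (\<Phi> w1) / b (\<Phi> unit) (\<Phi> w1)"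
definition "n2 x = b (\<Phi> x) (\<Phi> w2) / b (\<Phi> unit) (\<Phi> w2)"
definition "n3 x = b (\<Phi> x) (\<Phi> w3) / b (\<Phi> unit) (\<Phi> w3)"
definition "n4 x = b (\<Phi> x) (\<Phi> w4) / b (\<Phi> unit) (\<Phi> w4)"

lemmas o_defs = o1_def o2_def o3_def o4_def
lemmas n_defs = n1_def n2_def n3_def n4_def

lemma unit: "singH unit" "b unit w1 = - 1" "b unit w2 = 1" "b unit w3 = - 1" "b unit w4 = 1"
proof -
  show *: "b unit w1 = - 1" "b unit w2 = 1" "b unit w3 = - 1" "b unit w4 = 1" by (auto simp: unit_def)
  then have "unit \<noteq> 0" by (metis b_zero(1) zero_neq_one)
  then show "singH unit" by (simp add: unit_def F_comb)
qed

lemma Phi_unit_nz: "b (\<Phi> unit) (\<Phi> w1) \<noteq> 0" "b (\<Phi> unit) (\<Phi> w2) \<noteq> 0"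
   "b (\<Phi> unit) (\<Phi> w3) \<noteq> 0" "b (\<Phi> unit) (\<Phi> w4) \<noteq> 0"
  using unit by (auto simp: Phi_perp)

lemma o_unit: "o1 unit = 1" "o2 unit = 1" "o3 unit = 1" "o4 unit = 1"
  and n_unit: "n1 unit = 1" "n2 unit = 1" "n3 unit = 1" "n4 unit = 1"
  using unit Phi_unit_nz by (auto simp: o_defs n_defs)

lemma n_zero: assumes "sing x"
  shows "n1 x = 0 \<longleftrightarrow> o1 x = 0" "n2 x = 0 \<longleftrightarrow> o2 x = 0" "n3 x = 0 \<longleftrightarrow> o3 x = 0" "n4 x = 0 \<longleftrightarrow> o4 x = 0"
  using assms Phi_unit_nz by (auto simp: o_defs n_defs Phi_perp)

lemma o_nonzero: "sing x \<Longrightarrow> o1 x \<noteq> 0 \<or> o2 x \<noteq> 0 \<or> o3 x \<noteq> 0 \<or> o4 x \<noteq> 0"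
  using anisotropic by (auto simp: o_defs)

text \<open>A vector of the span of the frame with the prescribed coordinates is made singular
  by a vector of the complement; the result may lie outside the hyperplane.\<close>

lemma exists_sing:
  assumes "c1 \<noteq> 0 \<or> c2 \<noteq> 0 \<or> c3 \<noteq> 0 \<or> c4 \<noteq> 0"
  shows "\<exists>x. sing x \<and> o1 x = c1 \<and> o2 x = c2 \<and> o3 x = c3 \<and> o4 x = c4"
proof -
  obtain z where z: "perp z" "F z = - F (comb c3 c4 c1 c2)"
    using universal[of "comb c3 c4 c1 c2"] by (auto simp: perp_def)
  let ?x = "comb c3 c4 c1 c2 + z"
  have "F ?x = 0" using F_comb_perp[OF z(1)] z(2) by simp
  moreover have o: "o1 ?x = c1 \<and> o2 ?x = c2 \<and> o3 ?x = c3 \<and> o4 ?x = c4"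
    using z(1) by (simp add: o_defs b_add perp_def)
  moreover have "?x \<noteq> 0" using assms o by (auto simp: o_defs)
  ultimately show ?thesis by blast
qed

lemma frame_indep: "indep2 w1 w2" "indep2 w2 w3" "indep2 w3 w4" "indep2 w4 w1"
proof -
  have *: "indep2 u v" if "b u s \<noteq> 0" "b v s = 0" "b u t = 0" "b v t \<noteq> 0" for u v s t
    unfolding indep2_def
  proof (intro allI impI)
    fix r r' assume "r *s u + r' *s v = 0"
    then have "b (r *s u + r' *s v) s = 0" "b (r *s u + r' *s v) t = 0" by simp_all
    then show "r = 0 \<and> r' = 0" using that by (simp add: b_expand)
  qed
  show "indep2 w1 w2" "indep2 w2 w3" "indep2 w3 w4" "indep2 w4 w1"
    using *[of w1 w3 w2 w4] *[of w2 w4 w3 w1] *[of w3 w1 w4 w2] *[of w4 w2 w1 w3] by simp_all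
qed

lemma Phi_frame_indep: "indep2 (\<Phi> w1) (\<Phi> w2)" "indep2 (\<Phi> w2) (\<Phi> w3)" "indep2 (\<Phi> w3) (\<Phi> w4)" "indep2 (\<Phi> w4) (\<Phi> w1)"
  using Phi_indep[of w1 w2 w3] Phi_indep[of w2 w3 w4] Phi_indep[of w3 w4 w1] Phi_indep[of w4 w1 w2] by auto

lemma ratio:
  assumes "sing x" "sing y"
  shows "\<lbrakk>o1 x \<noteq> 0; o2 x \<noteq> 0; o1 y \<noteq> 0; o2 y \<noteq> 0\<rbrakk> \<Longrightarrow> o1 x * o2 y = o2 x * o1 y \<longleftrightarrow> n1 x * n2 y = n2 x * n1 y"
    and "\<lbrakk>o2 x \<noteq> 0; o3 x \<noteq> 0; o2 y \<noteq> 0; o3 y \<noteq> 0\<rbrakk> \<Longrightarrow> o2 x * o3 y = o3 x * o2 y \<longleftrightarrow> n2 x * n3 y = n3 x * n2 y"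
    and "\<lbrakk>o3 x \<noteq> 0; o4 x \<noteq> 0; o3 y \<noteq> 0; o4 y \<noteq> 0\<rbrakk> \<Longrightarrow> o3 x * o4 y = o4 x * o3 y \<longleftrightarrow> n3 x * n4 y = n4 x * n3 y"
    and "\<lbrakk>o4 x \<noteq> 0; o1 x \<noteq> 0; o4 y \<noteq> 0; o1 y \<noteq> 0\<rbrakk> \<Longrightarrow> o4 x * o1 y = o1 x * o4 y \<longleftrightarrow> n4 x * n1 y = n1 x * n4 y"
  using Phi_ratio[of w1 w2 x y] Phi_ratio[of w2 w3 x y] Phi_ratio[of w3 w4 x y] Phi_ratio[of w4 w1 x y]
    assms frame_indep Phi_frame_indep Phi_unit_nz
  by (simp_all add: o_defs n_defs frac_eq_eq mult.commute)

text \<open>The rule for the ratios of adjacent coordinates is stated in cross-multiplied form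
  to cover vanishing coordinates.\<close>

definition coord_auto :: "('a \<Rightarrow> 'a) \<Rightarrow> bool" where
  "coord_auto t \<longleftrightarrow> t 0 = 0 \<and> t 1 = 1 \<and> (\<forall>r s. t (r * s) = t r * t s) \<and> inj t \<and>
     (\<forall>x. sing x \<longrightarrow> n1 x * t (o2 x) = n2 x * t (o1 x) \<and> n2 x * t (o3 x) = n3 x * t (o2 x) \<and>
        n3 x * t (o4 x) = n4 x * t (o3 x) \<and> n4 x * t (o1 x) = n1 x * t (o4 x))"

text \<open>Let \<open>t, t2, t3, t4\<close> transform the four ratios of cyclically adjacent
  coordinates. A singular vector with ratios \<open>r, s, 1, 1/(r s)\<close> exists and the
  transformed ratios have product 1 as well. This functional equation, and the same one with
  \<open>r, s\<close> in other places, shows that the four maps agree and are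
  multiplicative.\<close>

lemma coord_auto_exists: "\<exists>t. coord_auto t"
proof -
  have ex: "\<exists>x. sing x \<and> o1 x = r \<and> o2 x = 1" "\<exists>x. sing x \<and> o2 x = r \<and> o3 x = 1"
      "\<exists>x. sing x \<and> o3 x = r \<and> o4 x = 1" "\<exists>x. sing x \<and> o4 x = r \<and> o1 x = 1" for r
    using exists_sing[of r 1 0 0] exists_sing[of 0 r 1 0] exists_sing[of 0 0 r 1] exists_sing[of 1 0 0 r] by force+
  have su: "sing unit" using unit by simp
  obtain t where "ratio_map sing o1 o2 n1 n2 t"
    using ratio_map_exists[of sing o1 o2 n1 n2 unit, OF ratio(1) n_zero(1) n_zero(2) su
      o_unit(1) o_unit(2) n_unit(1) n_unit(2) ex(1)] by (rule exE)
  note t = ratio_mapD[OF this]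
  obtain t2 where "ratio_map sing o2 o3 n2 n3 t2"
    using ratio_map_exists[of sing o2 o3 n2 n3 unit, OF ratio(2) n_zero(2) n_zero(3) su
      o_unit(2) o_unit(3) n_unit(2) n_unit(3) ex(2)] by (rule exE)
  note t2 = ratio_mapD[OF this]
  obtain t3 where "ratio_map sing o3 o4 n3 n4 t3"
    using ratio_map_exists[of sing o3 o4 n3 n4 unit, OF ratio(3) n_zero(3) n_zero(4) su
      o_unit(3) o_unit(4) n_unit(3) n_unit(4) ex(3)] by (rule exE)
  note t3 = ratio_mapD[OF this]
  obtain t4 where "ratio_map sing o4 o1 n4 n1 t4"
    using ratio_map_exists[of sing o4 o1 n4 n1 unit, OF ratio(4) n_zero(4) n_zero(1) su
      o_unit(4) o_unit(1) n_unit(4) n_unit(1) ex(4)] by (rule exE)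
  note t4 = ratio_mapD[OF this]
  have rs: "t r * t2 s * t4 (1 / (r * s)) = 1" if "r \<noteq> 0" "s \<noteq> 0" for r s
  proof -
    obtain x where x: "sing x" "o1 x = r * s" "o2 x = s" "o3 x = 1" "o4 x = 1"
      using exists_sing[of "r * s" s 1 1] by auto
    have "n1 x = t r * n2 x" "n2 x = t2 s * n3 x" "n3 x = n4 x" "n4 x = t4 (1 / (r * s)) * n1 x" "n1 x \<noteq> 0"
      using t(4)[of x] t2(4)[of x] t3(4)[of x] t4(4)[of x] x that t3(1) n_zero[of x] by auto
    then have "n1 x * (t r * t2 s * t4 (1 / (r * s))) = n1 x" "n1 x \<noteq> 0" by (simp_all add: mult_ac)
    then show ?thesis by simp
  qed
  have r3: "t3 r * t4 (1 / r) = 1" if "r \<noteq> 0" for r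
  proof -
    obtain x where x: "sing x" "o1 x = r" "o2 x = r" "o3 x = r" "o4 x = 1"
      using exists_sing[of r r r 1] by auto
    have "n1 x = n2 x" "n2 x = n3 x" "n3 x = t3 r * n4 x" "n4 x = t4 (1 / r) * n1 x" "n1 x \<noteq> 0"
      using t(4)[of x] t2(4)[of x] t3(4)[of x] t4(4)[of x] x that t(1) t2(1) n_zero[of x] by auto
    then have "n1 x * (t3 r * t4 (1 / r)) = n1 x" "n1 x \<noteq> 0" by (simp_all add: mult_ac)
    then show ?thesis by simp
  qed
  have e4: "t4 (1 / r) = inverse (t r)" if "r \<noteq> 0" for r
    using rs[of r 1] that t(2) t2(1) by (simp add: field_simps)
  have e2: "t2 r = t r" if "r \<noteq> 0" for r
    using rs[of 1 r] that t(1) t(2)[OF that] e4[OF that] by (simp add: field_simps)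
  have e3: "t3 r = t r" if "r \<noteq> 0" for r
    using r3[OF that] e4[OF that] t(2)[OF that] by (simp add: field_simps)
  have tm: "t (r * s) = t r * t s" if "r \<noteq> 0" "s \<noteq> 0" for r s
    using rs[OF that] e4[of "r * s"] e2[of s] t(2)[of "r * s"] that by (simp add: field_simps)
  have t4e: "t4 r = t r" if "r \<noteq> 0" for r
  proof -
    have "t r * t (1 / r) = 1" using tm[of r "1 / r"] that t(1) by simp
    moreover have "t4 r = inverse (t (1 / r))" using e4[of "1 / r"] that by simp
    moreover have "t (1 / r) \<noteq> 0" using t(2)[of "1 / r"] that by simp
    ultimately show ?thesis by (metis inverse_unique mult.commute inverse_inverse_eq)
  qed
  have td: "t (r / s) * t s = t r" if "r \<noteq> 0" "s \<noteq> 0" for r s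
    using tm[of "r / s" s] that by simp
  let ?t = "\<lambda>r. if r = 0 then 0 else t r"
  have cross: "n * ?t oj = n' * ?t oi"
    if "n = 0 \<longleftrightarrow> oi = 0" "n' = 0 \<longleftrightarrow> oj = 0" "oi \<noteq> 0 \<Longrightarrow> oj \<noteq> 0 \<Longrightarrow> n = t (oi / oj) * n'" for n n' oi oj
    using that td[of oi oj] by auto
  have "coord_auto ?t"
    unfolding coord_auto_def
  proof (intro conjI allI impI)
    show "inj ?t"
    proof (rule injI)
      fix r s assume *: "?t r = ?t s"
      show "r = s" using * t(2)[of r] t(2)[of s] t(3)[of r s] by (cases "r = 0"; cases "s = 0") simp_all
    qed
    fix x assume x: "sing x"
    show "n1 x * ?t (o2 x) = n2 x * ?t (o1 x)" by (rule cross) (use n_zero[OF x] t(4)[OF x] in auto)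
    show "n2 x * ?t (o3 x) = n3 x * ?t (o2 x)" by (rule cross) (use n_zero[OF x] t2(4)[OF x] e2 in auto)
    show "n3 x * ?t (o4 x) = n4 x * ?t (o3 x)" by (rule cross) (use n_zero[OF x] t3(4)[OF x] e3 in auto)
    show "n4 x * ?t (o1 x) = n1 x * ?t (o4 x)" by (rule cross) (use n_zero[OF x] t4(4)[OF x] t4e in auto)
  qed (use t(1) tm in auto)
  then show ?thesis by blast
qed

definition tau :: "'a \<Rightarrow> 'a" where "tau = (SOME t. coord_auto t)"

lemma coord_auto_tau: "coord_auto tau"
  unfolding tau_def using coord_auto_exists by (rule someI_ex)

lemma tau_0 [simp]: "tau 0 = 0" and tau_1 [simp]: "tau 1 = 1" and tau_mult: "tau (r * s) = tau r * tau s"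
  and inj_tau: "inj tau"
  using coord_auto_tau by (auto simp: coord_auto_def)

lemma tau_eq_0 [simp]: "tau r = 0 \<longleftrightarrow> r = 0"
  using inj_tau tau_0 by (metis injD)

lemma cross:
  assumes "sing x"
  shows "n1 x * tau (o2 x) = n2 x * tau (o1 x)" "n2 x * tau (o3 x) = n3 x * tau (o2 x)"
    "n3 x * tau (o4 x) = n4 x * tau (o3 x)" "n4 x * tau (o1 x) = n1 x * tau (o4 x)"
  using coord_auto_tau assms by (auto simp: coord_auto_def)

lemma tau_divide: "tau (r / s) = tau r / tau s"
  by (cases "s = 0") (auto simp: field_simps tau_mult[symmetric])

lemma tau_cj: "tau (cj r) = cj (tau r)"
  by (rule cj_commute) (auto simp: tau_mult)

text \<open>The points \<open>grid t\<close> are joined by a line to a point of \<open>\<langle>w1, w2\<rangle>\<close> and one of \<open>\<langle>w3, w4\<rangle>\<close>, so their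
  images stay in the span of the images of the frame.\<close>

definition "grid t = comb 1 t (cj t) 1"

lemma grid: "singH (grid t)" "o1 (grid t) = cj t" "o2 (grid t) = 1" "o3 (grid t) = 1" "o4 (grid t) = t"
proof -
  show *: "o1 (grid t) = cj t" "o2 (grid t) = 1" "o3 (grid t) = 1" "o4 (grid t) = t" by (auto simp: grid_def o_defs)
  then have "grid t \<noteq> 0" by (auto simp: o2_def)
  then show "singH (grid t)" by (simp add: grid_def F_comb)
qed

lemma Phi_grid_span:
  "\<exists>d1 d2 d3 d4. \<Phi> (grid t) = d1 *s \<Phi> w1 + d2 *s \<Phi> w2 + d3 *s \<Phi> w3 + d4 *s \<Phi> w4"
proof -
  let ?k = "comb 1 t 0 0" and ?l = "comb 0 0 (cj t) 1"
  have "b ?k w3 = - 1" "b ?l w2 = 1" by auto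
  then have 0: "?k \<noteq> 0" "?l \<noteq> 0" by (metis b_zero(1) zero_neq_one neg_equal_0_iff_equal)+
  then have kl: "singH ?k" "singH ?l" by (auto simp: F_comb)
  have "\<exists>s s'. \<Phi> ?k = s *s \<Phi> w1 + s' *s \<Phi> w2" by (rule Phi_line) (use kl Phi_frame_indep in auto)
  moreover have "\<exists>s s'. \<Phi> ?l = s *s \<Phi> w3 + s' *s \<Phi> w4" by (rule Phi_line) (use kl Phi_frame_indep in auto)
  moreover have "\<exists>s s'. \<Phi> (grid t) = s *s \<Phi> ?k + s' *s \<Phi> ?l"
  proof (rule Phi_line)
    show "indep2 (\<Phi> ?k) (\<Phi> ?l)" using Phi_indep[of ?k ?l w3] kl by auto
    show "b ?k ?l = 0" "b (grid t) ?k = 0" "b (grid t) ?l = 0" by (auto simp: b_comb_right grid_def)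
  qed (use kl grid in auto)
  ultimately obtain s1 s2 s3 s4 s5 s6 where "\<Phi> ?k = s1 *s \<Phi> w1 + s2 *s \<Phi> w2" "\<Phi> ?l = s3 *s \<Phi> w3 + s4 *s \<Phi> w4"
    "\<Phi> (grid t) = s5 *s \<Phi> ?k + s6 *s \<Phi> ?l" by blast
  then have "\<Phi> (grid t) = (s5 * s1) *s \<Phi> w1 + (s5 * s2) *s \<Phi> w2 + (s6 * s3) *s \<Phi> w3 + (s6 * s4) *s \<Phi> w4"
    by (simp add: vec.scale_right_distrib vector_smult_assoc)
  then show ?thesis by blast
qed

end

section \<open>The field automorphism is additive\<close>

lemma proportional_trans:
  fixes a c d :: "'a::field"
  assumes "a * q = c * p" "c * r = d * q" "q \<noteq> 0"
  shows "a * r = d * p"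
proof -
  have "(a * r) * q = (c * r) * p" using assms(1) by (metis mult.assoc mult.commute)
  also have "\<dots> = (d * p) * q" using assms(2) by (simp add: mult_ac)
  finally show ?thesis using assms(3) by simp
qed

context frame_map
begin

lemma grid_1: "grid 1 = unit"
  by (simp add: grid_def unit_def)

text \<open>The images of the frame vectors are determined up to scalars only. The multiples
  \<open>v1, \<dots>, v4\<close> are chosen such that they add up to the image of the unit
  vector; then they form a frame up to the common factor \<open>mu\<close>.\<close>

definition "unit_coords = (SOME (d1, d2, d3, d4). \<Phi> unit = d1 *s \<Phi> w1 + d2 *s \<Phi> w2 + d3 *s \<Phi> w3 + d4 *s \<Phi> w4)"

definition "v1 = fst unit_coords *s \<Phi> w1"
definition "v2 = fst (snd unit_coords) *s \<Phi> w2"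
definition "v3 = fst (snd (snd unit_coords)) *s \<Phi> w3"
definition "v4 = snd (snd (snd unit_coords)) *s \<Phi> w4"

lemma Phi_unit: "\<Phi> unit = v1 + v2 + v3 + v4"
proof -
  have "\<exists>d. case d of (d1, d2, d3, d4) \<Rightarrow> \<Phi> unit = d1 *s \<Phi> w1 + d2 *s \<Phi> w2 + d3 *s \<Phi> w3 + d4 *s \<Phi> w4"
    using Phi_grid_span[of 1] by (auto simp: grid_1)
  then have "case unit_coords of (d1, d2, d3, d4) \<Rightarrow> \<Phi> unit = d1 *s \<Phi> w1 + d2 *s \<Phi> w2 + d3 *s \<Phi> w3 + d4 *s \<Phi> w4"
    unfolding unit_coords_def by (rule someI_ex)
  then show ?thesis by (auto simp: v1_def v2_def v3_def v4_def split: prod.splits)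
qed

lemma Phi_frame_b:
  "b (\<Phi> w1) (\<Phi> w1) = 0" "b (\<Phi> w1) (\<Phi> w2) = 0" "b (\<Phi> w1) (\<Phi> w4) = 0"
  "b (\<Phi> w2) (\<Phi> w2) = 0" "b (\<Phi> w2) (\<Phi> w1) = 0" "b (\<Phi> w2) (\<Phi> w3) = 0"
  "b (\<Phi> w3) (\<Phi> w3) = 0" "b (\<Phi> w3) (\<Phi> w2) = 0" "b (\<Phi> w3) (\<Phi> w4) = 0"
  "b (\<Phi> w4) (\<Phi> w4) = 0" "b (\<Phi> w4) (\<Phi> w1) = 0" "b (\<Phi> w4) (\<Phi> w3) = 0"
  by (auto simp: Phi_perp)

lemma Phi_unit_b:
  "b (\<Phi> unit) (\<Phi> w1) = b v3 (\<Phi> w1)" "b (\<Phi> unit) (\<Phi> w2) = b v4 (\<Phi> w2)"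
  "b (\<Phi> unit) (\<Phi> w3) = b v1 (\<Phi> w3)" "b (\<Phi> unit) (\<Phi> w4) = b v2 (\<Phi> w4)"
  unfolding Phi_unit by (simp_all add: v1_def v2_def v3_def v4_def b_expand Phi_frame_b)

lemma b_v_n: "b (\<Phi> x) v1 = n1 x * b v3 v1" "b (\<Phi> x) v2 = n2 x * b v4 v2"
   "b (\<Phi> x) v3 = n3 x * b v1 v3" "b (\<Phi> x) v4 = n4 x * b v2 v4"
proof -
  have *: "b y (c *s \<Phi> w) = b y (\<Phi> w) / b (\<Phi> unit) (\<Phi> w) * b v (c *s \<Phi> w)"
    if "b (\<Phi> unit) (\<Phi> w) = b v (\<Phi> w)" "b (\<Phi> unit) (\<Phi> w) \<noteq> 0" for y v w c
    using that by (simp add: b_scale_right)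
  show "b (\<Phi> x) v1 = n1 x * b v3 v1" unfolding v1_def n1_def using *[OF Phi_unit_b(1) Phi_unit_nz(1)] .
  show "b (\<Phi> x) v2 = n2 x * b v4 v2" unfolding v2_def n2_def using *[OF Phi_unit_b(2) Phi_unit_nz(2)] .
  show "b (\<Phi> x) v3 = n3 x * b v1 v3" unfolding v3_def n3_def using *[OF Phi_unit_b(3) Phi_unit_nz(3)] .
  show "b (\<Phi> x) v4 = n4 x * b v2 v4" unfolding v4_def n4_def using *[OF Phi_unit_b(4) Phi_unit_nz(4)] .
qed

definition "mu = b v2 v4"

lemma v_scaled: obtains d1 d2 d3 d4 where "v1 = d1 *s \<Phi> w1" "v2 = d2 *s \<Phi> w2" "v3 = d3 *s \<Phi> w3" "v4 = d4 *s \<Phi> w4"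
    "d1 \<noteq> 0" "d2 \<noteq> 0" "d3 \<noteq> 0" "d4 \<noteq> 0"
  using that[OF v1_def v2_def v3_def v4_def] Phi_unit_nz unfolding Phi_unit_b
  by (auto simp: v1_def v2_def v3_def v4_def b_scale)

text \<open>The vectors \<open>w1 + w2\<close> and \<open>w2 + w3\<close> are orthogonal to the
  unit vector, and so are their images.\<close>

lemma mu: "b v1 v3 = - mu" "b v3 v1 = - mu" "b v2 v4 = mu" "b v4 v2 = mu" "cj mu = mu" "mu \<noteq> 0"
proof -
  have 1: "sing (comb 1 1 0 0)" "sing (comb 0 1 1 0)"
    using b_comb(4)[of 1 1 0 0] b_comb(4)[of 0 1 1 0] by (auto simp: F_comb simp del: b_comb)
  have N: "b (\<Phi> x) (\<Phi> unit) = n1 x * b v3 v1 + n2 x * b v4 v2 + n3 x * b v1 v3 + n4 x * b v2 v4" for x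
    by (simp add: Phi_unit b_expand b_v_n)
  have z: "b (\<Phi> x) (\<Phi> unit) = 0" if "sing x" "b x unit = 0" for x
    using that Phi_perp[of x unit] unit by auto
  have o: "b (comb 1 1 0 0) unit = 0" "b (comb 0 1 1 0) unit = 0" by (auto simp: unit_def b_comb_right)
  let ?k = "comb 1 1 0 0" and ?l = "comb 0 1 1 0"
  have "n1 ?k = 0" "n2 ?k = 0" "n3 ?k \<noteq> 0" "n3 ?k = n4 ?k"
    using n_zero[OF 1(1)] cross[OF 1(1)] by (auto simp: o_defs)
  moreover have "n1 ?l = n4 ?l" "n2 ?l = 0" "n3 ?l = 0" "n1 ?l \<noteq> 0"
    using n_zero[OF 1(2)] cross[OF 1(2)] by (auto simp: o_defs)
  ultimately have "n3 ?k * (b v1 v3 + b v2 v4) = 0" "n1 ?l * (b v3 v1 + b v2 v4) = 0"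
    using N[of ?k] N[of ?l] z[OF 1(1) o(1)] z[OF 1(2) o(2)] by (simp_all add: distrib_left)
  with \<open>n3 ?k \<noteq> 0\<close> \<open>n1 ?l \<noteq> 0\<close> show *: "b v1 v3 = - mu" "b v3 v1 = - mu" "b v2 v4 = mu"
    by (auto simp: mu_def eq_neg_iff_add_eq_0)
  have "b v3 v1 = cj (b v1 v3)" by (rule b_sym)
  then show "cj mu = mu" using * by (simp add: cj_minus)
  then show "b v4 v2 = mu" using b_sym[of v4 v2] by (simp add: mu_def)
  obtain d2 d4 where "v2 = d2 *s \<Phi> w2" "v4 = d4 *s \<Phi> w4" "d2 \<noteq> 0" "d4 \<noteq> 0" using v_scaled by metis
  then show "mu \<noteq> 0" using Phi_perp[of w2 w4] by (simp add: mu_def b_expand)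
qed

lemma b_image: "b (\<Phi> x) v1 = - mu * n1 x" "b (\<Phi> x) v2 = mu * n2 x" "b (\<Phi> x) v3 = - mu * n3 x" "b (\<Phi> x) v4 = mu * n4 x"
  using b_v_n[of x] by (auto simp: mu)

text \<open>The coordinates \<open>(1, a, 0, 1 - a)\<close> are those of a vector orthogonal to
  the unit vector.\<close>

lemma tau_complement: "tau a + tau (1 - a) = 1"
proof -
  obtain x where x: "sing x" "o1 x = 1" "o2 x = a" "o3 x = 0" "o4 x = 1 - a" using exists_sing[of 1 a 0 "1 - a"] by auto
  have "b x unit = 0" using x by (simp add: unit_def b_comb_right o_defs)
       (metis add.inverse_inverse add_0 add.right_neutral diff_add_cancel add.commute add.right_inverse)
  then have "b (\<Phi> x) (\<Phi> unit) = 0" using x Phi_perp[of x unit] unit by auto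
  then have "mu * (- n1 x + n2 x - n3 x + n4 x) = 0" by (simp add: Phi_unit b_expand b_image algebra_simps)
  moreover have "n3 x = 0" "n1 x \<noteq> 0" "n2 x = n1 x * tau a" "n4 x = n1 x * tau (1 - a)"
    using n_zero[OF x(1)] cross[OF x(1)] x by auto
  ultimately have "mu * (n1 x * (tau a + tau (1 - a))) = mu * n1 x" "n1 x \<noteq> 0" by (auto simp: algebra_simps)
  then show ?thesis using mu(6) by simp
qed

lemma tau_minus: "tau (- a) = - tau a"
proof -
  have "tau (- 1) * tau (- 1) = 1" by (simp add: tau_mult[symmetric])
  then have "tau (- 1) = 1 \<or> tau (- 1) = - 1" by (metis square_eq_1_iff)
  moreover have "tau (- 1) = 1 \<Longrightarrow> (- 1 :: 'a) = 1" using inj_tau tau_1 by (metis injD)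
  ultimately have "tau (- 1) = - 1" by auto
  then show ?thesis using tau_mult[of "- 1" a] by simp
qed

lemma tau_add: "tau (a + c) = tau a + tau c"
proof (cases "a + c = 0")
  case True
  then show ?thesis using tau_minus[of a] by (simp add: eq_neg_iff_add_eq_0 add.commute minus_unique)
next
  case False
  have "1 - a / (a + c) = c / (a + c)" using False by (simp add: field_simps)
  then have "tau (a / (a + c)) + tau (c / (a + c)) = 1" using tau_complement[of "a / (a + c)"] by simp
  moreover have "tau (a / (a + c)) * tau (a + c) = tau a" "tau (c / (a + c)) * tau (a + c) = tau c"
    using False by (simp_all add: tau_mult[symmetric])
  ultimately show ?thesis by (metis distrib_right mult_1)
qed

lemma tau_diff: "tau (a - c) = tau a - tau c"
  using tau_add[of a "- c"] by (simp add: tau_minus)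

lemma Phi_grid: "\<Phi> (grid t) = n3 (grid t) *s v1 + n4 (grid t) *s v2 + n1 (grid t) *s v3 + n2 (grid t) *s v4"
proof -
  obtain d1 d2 d3 d4 where d: "v1 = d1 *s \<Phi> w1" "v2 = d2 *s \<Phi> w2" "v3 = d3 *s \<Phi> w3" "v4 = d4 *s \<Phi> w4"
    "d1 \<noteq> 0" "d2 \<noteq> 0" "d3 \<noteq> 0" "d4 \<noteq> 0" by (rule v_scaled)
  obtain c1 c2 c3 c4 where c: "\<Phi> (grid t) = c1 *s \<Phi> w1 + c2 *s \<Phi> w2 + c3 *s \<Phi> w3 + c4 *s \<Phi> w4"
    using Phi_grid_span by blast
  have e: "\<Phi> (grid t) = (c1 / d1) *s v1 + (c2 / d2) *s v2 + (c3 / d3) *s v3 + (c4 / d4) *s v4"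
    using d by (simp add: c vector_smult_assoc)
  have z: "b v1 v1 = 0" "b v1 v2 = 0" "b v1 v4 = 0" "b v2 v2 = 0" "b v2 v1 = 0" "b v2 v3 = 0"
    "b v3 v3 = 0" "b v3 v2 = 0" "b v3 v4 = 0" "b v4 v4 = 0" "b v4 v1 = 0" "b v4 v3 = 0"
    by (simp_all add: d b_expand Phi_frame_b)
  from e obtain e1 e2 e3 e4 where e: "\<Phi> (grid t) = e1 *s v1 + e2 *s v2 + e3 *s v3 + e4 *s v4" by blast
  have "b (\<Phi> (grid t)) v1 = - mu * e3" "b (\<Phi> (grid t)) v2 = mu * e4"
    "b (\<Phi> (grid t)) v3 = - mu * e1" "b (\<Phi> (grid t)) v4 = mu * e2"
    unfolding e by (simp_all add: b_expand z mu)
  then have "e1 = n3 (grid t)" "e2 = n4 (grid t)" "e3 = n1 (grid t)" "e4 = n2 (grid t)"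
    using b_image[of "grid t"] mu(6) by simp_all
  then show ?thesis using e by simp
qed

text \<open>If one of the two other coordinates is nonzero, this follows from the rule for
  adjacent coordinates. Otherwise the parameter of a grid point can be chosen such that it is
  orthogonal to \<open>x\<close>; its image is known.\<close>

lemma cross_opposite:
  assumes x: "sing x"
  shows "n1 x * tau (o3 x) = n3 x * tau (o1 x)" "n2 x * tau (o4 x) = n4 x * tau (o2 x)"
proof -
  note nz = n_zero[OF x] and cr = cross[OF x]
  have gr: "n1 (grid t) = n3 (grid t) * tau (cj t)" "n2 (grid t) = n3 (grid t)" "n4 (grid t) = n3 (grid t) * tau t" "n3 (grid t) \<noteq> 0" for t
    using cross[of "grid t"] n_zero[of "grid t"] grid[of t] by auto
  have N: "b (\<Phi> x) (\<Phi> (grid t)) = mu * cj (n3 (grid t)) * (- (n1 x + tau t * n3 x) + (tau (cj t) * n2 x + n4 x))" for t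
    by (simp add: Phi_grid b_expand b_image gr(1-3) cj_mult tau_cj algebra_simps)
  have orth: "- (n1 x + tau t * n3 x) + (tau (cj t) * n2 x + n4 x) = 0" if "b x (grid t) = 0" for t
    using that Phi_perp[of x "grid t"] grid[of t] x N[of t] mu(6) gr(4)[of t] by auto
  have B: "b x (grid t) = - o1 x + cj t * o2 x - t * o3 x + o4 x" for t
    by (simp add: grid_def b_comb_right o_defs)
  show "n1 x * tau (o3 x) = n3 x * tau (o1 x)"
  proof (cases "o2 x = 0 \<and> o4 x = 0 \<and> o3 x \<noteq> 0")
    case True
    have "b x (grid (- o1 x / o3 x)) = 0" using True by (simp add: B)
    from orth[OF this] show ?thesis using True nz by (simp add: tau_divide tau_minus field_simps)
  next
    case False
    then consider "o2 x \<noteq> 0" | "o4 x \<noteq> 0" | "o3 x = 0" by blast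
    then show ?thesis
    proof cases
      case 1 then show ?thesis using proportional_trans[OF cr(1) cr(2)] by simp
    next
      case 2 then show ?thesis using proportional_trans[OF cr(4)[symmetric] cr(3)[symmetric]] by simp
    qed (use nz in simp)
  qed
  show "n2 x * tau (o4 x) = n4 x * tau (o2 x)"
  proof (cases "o1 x = 0 \<and> o3 x = 0 \<and> o2 x \<noteq> 0")
    case True
    have "b x (grid (cj (- o4 x / o2 x))) = 0" using True by (simp add: B)
    from orth[OF this] show ?thesis using True nz by (simp add: tau_divide tau_minus field_simps)
  next
    case False
    then consider "o3 x \<noteq> 0" | "o1 x \<noteq> 0" | "o2 x = 0" by blast
    then show ?thesis
    proof cases
      case 1 then show ?thesis using proportional_trans[OF cr(2) cr(3)] by simp
    next
      case 2 then show ?thesis using proportional_trans[OF cr(1)[symmetric] cr(4)[symmetric]] by simp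
    qed (use nz in simp)
  qed
qed

theorem Phi_coordinates:
  assumes x: "sing x"
  shows "\<exists>l. l \<noteq> 0 \<and> b (\<Phi> x) v1 = l * mu * tau (b x w1) \<and> b (\<Phi> x) v2 = l * mu * tau (b x w2) \<and>
     b (\<Phi> x) v3 = l * mu * tau (b x w3) \<and> b (\<Phi> x) v4 = l * mu * tau (b x w4)"
proof -
  note nz = n_zero[OF x] and cr = cross[OF x] cross_opposite[OF x]
  have "\<exists>l. l \<noteq> 0 \<and> n1 x = l * tau (o1 x) \<and> n2 x = l * tau (o2 x) \<and> n3 x = l * tau (o3 x) \<and> n4 x = l * tau (o4 x)"
  proof -
    consider "o1 x \<noteq> 0" | "o2 x \<noteq> 0" | "o3 x \<noteq> 0" | "o4 x \<noteq> 0" using o_nonzero[OF x] by blast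
    then show ?thesis
    proof cases
      case 1 show ?thesis by (rule exI[of _ "n1 x / tau (o1 x)"]) (use 1 nz cr in \<open>simp add: field_simps\<close>)
    next
      case 2 show ?thesis by (rule exI[of _ "n2 x / tau (o2 x)"]) (use 2 nz cr in \<open>simp add: field_simps\<close>)
    next
      case 3 show ?thesis by (rule exI[of _ "n3 x / tau (o3 x)"]) (use 3 nz cr in \<open>simp add: field_simps\<close>)
    next
      case 4 show ?thesis by (rule exI[of _ "n4 x / tau (o4 x)"]) (use 4 nz cr in \<open>simp add: field_simps\<close>)
    qed
  qed
  then obtain l where "l \<noteq> 0" "n1 x = l * tau (o1 x)" "n2 x = l * tau (o2 x)" "n3 x = l * tau (o3 x)" "n4 x = l * tau (o4 x)"
    by blast
  then show ?thesis by (intro exI[of _ l]) (simp add: b_image o_defs tau_minus)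
qed

end

section \<open>The semilinear similitude\<close>

text \<open>The vector \<open>g\<close> spans the part of the hyperplane orthogonal to the
  frame. It is zero for Hermitian varieties, where the frame spans the hyperplane. The vector
  \<open>z0\<close> completes the basis outside the hyperplane.\<close>

locale frame_map_basis = frame_map cj tr F b \<beta> w1 w2 w3 w4 \<Phi>
  for cj tr :: "'a::{field,finite} \<Rightarrow> 'a" and F :: "'a^'n \<Rightarrow> 'a" and b \<beta> w1 w2 w3 w4 \<Phi> +
  fixes \<alpha> :: "'a^'n \<Rightarrow> 'a" and g z0 :: "'a^'n"
  assumes alpha_add: "\<alpha> (x + y) = \<alpha> x + \<alpha> y" and alpha_scale: "\<alpha> (c *s x) = c * \<alpha> x"
    and perp_g: "perp g" and beta_g: "\<beta> g = 0" and perp_z0: "perp z0" and beta_z0: "\<beta> z0 = 1"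
    and basis: "v = wpart v + \<alpha> v *s g + \<beta> v *s z0"
    and linear_case: "g \<noteq> 0 \<Longrightarrow> cj = id \<and> tr = id"
begin

definition comb' where "comb' c1 c2 c3 c4 = c1 *s v1 + c2 *s v2 + c3 *s v3 + c4 *s v4"

text \<open>The \<open>tau\<close>-semilinear map that sends the frame \<open>w1, \<dots>,
  w4\<close> to \<open>v1, \<dots>, v4\<close> and its complement to 0.\<close>

definition TW where "TW v = comb' (tau (- b v w3)) (tau (b v w4)) (tau (- b v w1)) (tau (b v w2))"

definition perp' where "perp' z \<longleftrightarrow> b z v1 = 0 \<and> b z v2 = 0 \<and> b z v3 = 0 \<and> b z v4 = 0"

lemma v_props: "b v1 v1 = 0" "b v1 v2 = 0" "b v1 v4 = 0" "b v2 v2 = 0" "b v2 v1 = 0" "b v2 v3 = 0"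
    "b v3 v3 = 0" "b v3 v2 = 0" "b v3 v4 = 0" "b v4 v4 = 0" "b v4 v1 = 0" "b v4 v3 = 0"
    "F v1 = 0" "F v2 = 0" "F v3 = 0" "F v4 = 0" "\<beta> v1 = 0" "\<beta> v2 = 0" "\<beta> v3 = 0" "\<beta> v4 = 0"
  by (simp_all add: v1_def v2_def v3_def v4_def b_expand Phi_frame_b F_scale Phi_F Phi_H beta_scale)

lemma b_comb': "b (comb' c1 c2 c3 c4) v1 = - mu * c3" "b (comb' c1 c2 c3 c4) v2 = mu * c4"
   "b (comb' c1 c2 c3 c4) v3 = - mu * c1" "b (comb' c1 c2 c3 c4) v4 = mu * c2"
  by (simp_all add: comb'_def b_expand v_props mu)

lemma F_comb': "F (comb' c1 c2 c3 c4) = tr (mu * (c2 * cj c4 - c1 * cj c3))"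
proof -
  have "F (comb' c1 c2 c3 c4) = tr (- (mu * c1 * cj c3)) + tr (mu * c2 * cj c4)"
    by (simp add: comb'_def F_add F_scale b_expand v_props mu tr_add mult_ac)
  then show ?thesis by (simp add: tr_add[symmetric] algebra_simps)
qed

lemma b_TW: "b (TW v) v1 = mu * tau (b v w1)" "b (TW v) v2 = mu * tau (b v w2)"
   "b (TW v) v3 = mu * tau (b v w3)" "b (TW v) v4 = mu * tau (b v w4)"
  by (simp_all add: TW_def b_comb' tau_minus)

lemma perp'_comb': "perp' z \<Longrightarrow> b z (comb' c1 c2 c3 c4) = 0" "perp' z \<Longrightarrow> b (comb' c1 c2 c3 c4) z = 0"
proof -
  show *: "b z (comb' c1 c2 c3 c4) = 0" if "perp' z" using that by (simp add: perp'_def comb'_def b_expand)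
  then show "perp' z \<Longrightarrow> b (comb' c1 c2 c3 c4) z = 0" using b_sym0 by blast
qed

lemma perp'_TW: "perp' z \<Longrightarrow> b z (TW v) = 0" "perp' z \<Longrightarrow> b (TW v) z = 0"
  by (simp_all add: TW_def perp'_comb')

lemma b_TW_TW: "b (TW x) (TW y) = mu * tau (b x (wpart y))"
  by (simp add: TW_def[of y] wpart_def comb'_def b_expand b_TW b_comb_right tau_add tau_diff tau_mult tau_minus tau_cj
      cj_minus algebra_simps)

lemma F_TW: "F (TW v) = mu * tau (F (wpart v))"
proof -
  have "F (TW v) = tr (mu * tau (b v w4 * cj (b v w2) - b v w3 * cj (b v w1)))"
    unfolding TW_def F_comb' by (simp add: tau_minus cj_minus tau_diff tau_mult tau_cj)
  also have "\<dots> = mu * tau (tr (b v w4 * cj (b v w2) - b v w3 * cj (b v w1)))"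
    by (rule tr_commute) (auto simp: tau_mult tau_add mu)
  finally show ?thesis by (simp add: wpart_def F_comb cj_minus)
qed

lemma TW_add: "TW (x + y) = TW x + TW y"
  by (simp add: TW_def comb'_def b_expand tau_add tau_diff tau_minus vec.scale_left_distrib vec.scale_left_diff_distrib)

lemma TW_scale: "TW (c *s x) = tau c *s TW x"
  by (simp add: TW_def comb'_def b_expand tau_mult tau_minus vec.scale_right_distrib vector_smult_assoc
     vec.scale_right_diff_distrib)

text \<open>A vector of the form \<open>\<Phi> x\<close> can be rescaled so that its part along the image frame is the semilinear
  image of the part of \<open>x\<close> along the frame.\<close>

lemma Phi_normalized:
  assumes "sing x"
  shows "\<exists>l z. l \<noteq> 0 \<and> \<Phi> x = l *s (TW x + z) \<and> perp' z \<and> F z = - mu * tau (F (wpart x)) \<and> (\<beta> x = 0 \<longrightarrow> \<beta> z = 0)"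
proof -
  obtain l where l: "l \<noteq> 0" "b (\<Phi> x) v1 = l * mu * tau (b x w1)" "b (\<Phi> x) v2 = l * mu * tau (b x w2)"
     "b (\<Phi> x) v3 = l * mu * tau (b x w3)" "b (\<Phi> x) v4 = l * mu * tau (b x w4)"
    using Phi_coordinates[OF assms] by blast
  let ?p = "inverse l *s \<Phi> x"
  let ?z = "?p - TW x"
  have z: "perp' ?z" using l by (simp add: perp'_def b_expand b_TW)
  have "F ?p = F (TW x) + F ?z"
    using F_add[of "TW x" ?z] perp'_TW(2)[OF z, of x] by simp
  moreover have "F ?p = 0" using assms Phi_F by (simp add: F_scale)
  ultimately have "F ?z = - mu * tau (F (wpart x))" by (simp add: F_TW eq_neg_iff_add_eq_0 add.commute)
  moreover have "\<beta> x = 0 \<longrightarrow> \<beta> ?z = 0"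
    using assms Phi_H by (simp add: beta_diff beta_scale TW_def comb'_def beta_add v_props)
  moreover have "\<Phi> x = l *s (TW x + ?z)" using l by (simp add: vector_smult_assoc)
  ultimately show ?thesis using z l(1) by blast
qed

lemma wpart_comb_perp: "perp z \<Longrightarrow> wpart (comb c1 c2 c3 c4 + z) = comb c1 c2 c3 c4"
  by (simp add: wpart_def b_add perp_def)

lemma tau_b_cj: "cj (mu * tau a) = mu * tau (cj a)"
  by (simp add: cj_mult mu tau_cj)

text \<open>A singular vector of the hyperplane outside the span of the frame, if
  \<open>g\<close> is not zero: \<open>F\<close> takes the value \<open>- F g\<close> at its
  first summand. Its image fixes the scale and the sign of \<open>g'\<close>.\<close>

definition "R = comb 1 0 (F g) 0 + g"

lemma R: "g \<noteq> 0 \<Longrightarrow> singH R" "b R w1 = - F g" "b R w2 = 0" "b R w3 = - 1" "b R w4 = 0"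
proof -
  show b: "b R w1 = - F g" "b R w2 = 0" "b R w3 = - 1" "b R w4 = 0"
    using perp_g by (simp_all add: R_def b_add perp_def)
  have "R \<noteq> 0" using b(3) by auto
  moreover assume "g \<noteq> 0"
  ultimately show "singH R" using linear_case
    by (simp add: R_def F_comb_perp[OF perp_g] F_comb beta_add beta_g)
qed

lemma wpart_R: "wpart R = comb 1 0 (F g) 0"
  by (simp add: wpart_def R)

lemma image_g: "\<exists>g'. perp' g' \<and> \<beta> g' = 0 \<and> F g' = mu * tau (F g) \<and> (g = 0 \<longrightarrow> g' = 0) \<and>
    (g \<noteq> 0 \<longrightarrow> (\<exists>l. l \<noteq> 0 \<and> \<Phi> R = l *s (TW R + g')))"
proof (cases "g = 0")
  case True
  then show ?thesis by (intro exI[of _ 0]) (simp add: perp'_def)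
next
  case False
  obtain l z where "l \<noteq> 0" "\<Phi> R = l *s (TW R + z)" "perp' z" "F z = - mu * tau (F (wpart R))" "\<beta> z = 0"
    using Phi_normalized[of R] R(1)[OF False] by auto
  then show ?thesis using False linear_case[OF False]
    by (intro exI[of _ z]) (auto simp: wpart_R F_comb tau_minus)
qed

definition "g' = (SOME g'. perp' g' \<and> \<beta> g' = 0 \<and> F g' = mu * tau (F g) \<and> (g = 0 \<longrightarrow> g' = 0) \<and>
    (g \<noteq> 0 \<longrightarrow> (\<exists>l. l \<noteq> 0 \<and> \<Phi> R = l *s (TW R + g'))))"

lemma g': "perp' g'" "\<beta> g' = 0" "F g' = mu * tau (F g)" "g = 0 \<Longrightarrow> g' = 0"
    "g \<noteq> 0 \<Longrightarrow> \<exists>l. l \<noteq> 0 \<and> \<Phi> R = l *s (TW R + g')"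
  using someI_ex[OF image_g, folded g'_def] by blast+

text \<open>The image of \<open>z0\<close> is read off from a singular vector \<open>x0\<close> outside \<open>H\<close>; choosing \<open>x0\<close> orthogonal to
  \<open>R\<close> fixes the scalar product with \<open>g'\<close>.\<close>

lemma image_z0: "\<exists>z. perp' z \<and> F z = mu * tau (F z0) \<and> b z g' = mu * tau (b z0 g)"
proof -
  obtain c where c: "tr c = F z0" using tr_onto by auto
  let ?w = "comb 0 1 (b z0 g) (cj (- c))"
  let ?x = "?w + z0"
  have b: "b ?x w1 = - b z0 g" "b ?x w2 = cj (- c)" "b ?x w3 = 0" "b ?x w4 = 1"
    using perp_z0 by (simp_all add: b_add perp_def)
  then have w: "wpart ?x = ?w" by (simp add: wpart_def)
  have Fw: "F ?w = - F z0" using c by (simp add: F_comb tr_minus)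
  have "?x \<noteq> 0" using b(4) by auto
  moreover have "F ?x = 0" using F_comb_perp[OF perp_z0] Fw by simp
  ultimately have x: "sing ?x" by simp
  obtain l z where z: "l \<noteq> 0" "\<Phi> ?x = l *s (TW ?x + z)" "perp' z" "F z = - mu * tau (F (wpart ?x))"
    using Phi_normalized[OF x] by blast
  have "b z g' = mu * tau (b z0 g)"
  proof (cases "g = 0")
    case True
    then show ?thesis using g' by simp
  next
    case False
    obtain k where k: "k \<noteq> 0" "\<Phi> R = k *s (TW R + g')" using g'(5)[OF False] by blast
    have xR: "b ?x (wpart R) = - b z0 g" by (simp only: wpart_R b_comb_right b) simp
    have "b ?w g = 0" using perp_b_comb[OF perp_g] b_sym0 by blast
    then have "b ?x R = 0" using xR wpart_R by (simp add: R_def b_expand)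
    then have "b (\<Phi> ?x) (\<Phi> R) = 0" using Phi_perp[of ?x R] x R(1)[OF False] by auto
    moreover have "b (\<Phi> ?x) (\<Phi> R) = l * (cj k * b (TW ?x + z) (TW R + g'))"
      unfolding z(2) k(2) by (simp only: b_scale b_scale_right) (rule mult.left_commute)
    ultimately have "b (TW ?x + z) (TW R + g') = 0" using z(1) k(1) by simp
    moreover have "b (TW ?x) (TW R) = mu * tau (- b z0 g)" by (simp only: b_TW_TW xR)
    moreover have "b (TW ?x + z) (TW R + g') = b (TW ?x) (TW R) + b z g'"
      by (simp only: b_add b_add_right perp'_TW[OF z(3)] perp'_TW[OF g'(1)]) simp
    ultimately show ?thesis by (simp only: tau_minus) simp
  qed
  then show ?thesis using z w Fw by (intro exI[of _ z]) (auto simp: tau_minus)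
qed

definition "z0' = (SOME z. perp' z \<and> F z = mu * tau (F z0) \<and> b z g' = mu * tau (b z0 g))"

lemma z0': "perp' z0'" "F z0' = mu * tau (F z0)" "b z0' g' = mu * tau (b z0 g)"
  using someI_ex[OF image_z0, folded z0'_def] by blast+

text \<open>The semilinear map that agrees with \<open>TW\<close> on the frame and sends
  \<open>g, z0\<close> to \<open>g', z0'\<close>.\<close>

definition T where "T v = TW v + tau (\<alpha> v) *s g' + tau (\<beta> v) *s z0'"

lemma T_add: "T (x + y) = T x + T y"
  by (simp add: T_def TW_add alpha_add beta_add tau_add vec.scale_left_distrib)

lemma T_scale: "T (c *s x) = tau c *s T x"
  by (simp add: T_def TW_scale alpha_scale beta_scale tau_mult vec.scale_right_distrib vector_smult_assoc)

lemma T_diff: "T (x - y) = T x - T y" using T_add[of "x - y" y] by simp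

lemma b_T: "b (T v) v1 = mu * tau (b v w1)" "b (T v) v2 = mu * tau (b v w2)"
   "b (T v) v3 = mu * tau (b v w3)" "b (T v) v4 = mu * tau (b v w4)"
  using g'(1) z0'(1) by (simp_all add: T_def b_expand b_TW perp'_def)

lemma F_T: "F (T v) = mu * tau (F v)"
proof -
  let ?z = "\<alpha> v *s g + \<beta> v *s z0" and ?z' = "tau (\<alpha> v) *s g' + tau (\<beta> v) *s z0'"
  have p: "perp ?z" using perp_g perp_z0 by (simp add: perp_def b_expand)
  have p': "perp' ?z'" using g' z0' by (simp add: perp'_def b_expand)
  have "F v = F (wpart v + ?z)" using basis[of v] by (simp add: add.assoc)
  also have "\<dots> = F (wpart v) + F ?z" using F_comb_perp[OF p] by (simp add: wpart_def)
  finally have v: "F v = F (wpart v) + F ?z" .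
  have "F (T v) = F (TW v + ?z')" by (simp add: T_def add.assoc)
  also have "\<dots> = F (TW v) + F ?z'" using perp'_TW(2)[OF p'] by (simp add: F_add)
  finally have Tv: "F (T v) = F (TW v) + F ?z'" .
  have bg: "b g' z0' = mu * tau (b g z0)"
    using z0'(3) b_sym[of g' z0'] b_sym[of g z0] by (simp add: tau_b_cj)
  have "tr (tau (\<alpha> v) * (cj (tau (\<beta> v)) * (mu * tau (b g z0)))) = tr (mu * tau (\<alpha> v * (cj (\<beta> v) * b g z0)))"
    by (simp add: tau_mult tau_cj mult_ac)
  also have "\<dots> = mu * tau (tr (\<alpha> v * (cj (\<beta> v) * b g z0)))"
    by (rule tr_commute) (auto simp: tau_mult tau_add mu)
  finally have "F ?z' = mu * tau (F ?z)"
    by (simp add: F_add F_scale b_expand bg g'(3) z0'(2) tau_add tau_mult tau_cj algebra_simps)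
  then show ?thesis unfolding v Tv by (simp add: F_TW tau_add algebra_simps)
qed

text \<open>By polarization of \<open>F_T\<close>, a vector in the kernel is singular and
  orthogonal to everything.\<close>

lemma inj_T: "inj T"
proof (rule injI)
  have ker: "x = 0" if x: "T x = 0" for x
  proof (rule nonsingular)
    show "F x = 0" using F_T[of x] mu(6) by (simp add: x)
    fix y
    have "tr (c * b x y) = 0" for c
    proof -
      let ?y = "cj c *s y"
      have "mu * tau (F (x + ?y)) = mu * tau (F ?y)" by (metis F_T T_add x add_0)
      then have "F (x + ?y) = F ?y" using mu(6) inj_tau by (auto dest: injD)
      then show ?thesis using \<open>F x = 0\<close> by (simp add: F_add b_expand)
    qed
    then show "b x y = 0" by (rule tr_nondeg)
  qed
  fix x y assume "T x = T y"
  then have "T (x - y) = 0" by (simp add: T_diff)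
  then show "x = y" using ker[of "x - y"] by simp
qed

lemma T_H: "\<beta> v = 0 \<Longrightarrow> \<beta> (T v) = 0"
  by (simp add: T_def TW_def comb'_def beta_add beta_scale v_props g')

lemma T_onto_H: "\<beta> p = 0 \<Longrightarrow> \<exists>h. \<beta> h = 0 \<and> T h = p"
proof -
  have "T ` H = H" by (rule endo_inj_surj) (use T_H inj_on_subset[OF inj_T] in auto)
  then show "\<beta> p = 0 \<Longrightarrow> \<exists>h. \<beta> h = 0 \<and> T h = p" by (metis (mono_tags, lifting) imageE mem_Collect_eq)
qed

text \<open>As \<open>T\<close> permutes the hyperplane, \<open>\<Phi> u\<close> is a multiple
  of some \<open>T h\<close>; the scalar products with the frame show that \<open>h\<close> and
  \<open>u\<close> have the same part along the frame.\<close>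

lemma Phi_T_preimage:
  assumes "singH u"
  obtains k h where "k \<noteq> 0" "\<Phi> u = k *s T h" "\<beta> h = 0" "F h = 0" "wpart h = wpart u"
proof -
  obtain l z where l: "l \<noteq> 0" "\<Phi> u = l *s (TW u + z)" "perp' z" using Phi_normalized assms by blast
  let ?p = "inverse l *s \<Phi> u"
  have p: "?p = TW u + z" using l by (simp add: vector_smult_assoc)
  have "\<beta> ?p = 0" using Phi_H assms by (simp add: beta_scale)
  then obtain h where h: "\<beta> h = 0" "T h = ?p" using T_onto_H by blast
  have "F (T h) = 0" using h Phi_F assms by (simp add: F_scale)
  then have "F h = 0" using F_T mu(6) by simp
  moreover have "b h w1 = b u w1 \<and> b h w2 = b u w2 \<and> b h w3 = b u w3 \<and> b h w4 = b u w4"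
    using b_T[of h] mu(6) l(3) unfolding h(2) p by (simp add: b_add b_TW perp'_def inj_eq[OF inj_tau])
  ultimately show ?thesis using that[of l h] l h p by (simp add: wpart_def)
qed

text \<open>In the orthogonal case \<open>\<Phi> u\<close> is thus known up to the reflection that fixes the frame and negates \<open>g\<close>.
  The remaining sign is the same at any two collinear points off the hyperplane of the frame, and
  these points form a connected graph.\<close>

context
  assumes g0: "g \<noteq> 0"
begin

lemma lin [simp]: "cj x = x" "tr x = x" using linear_case[OF g0] by auto

lemma Fg: "F g \<noteq> 0" using perp_eq_0[OF perp_g] g0 by blast

lemma b_double: "b x x = 2 * F x"
proof -
  have "F (x + x) = F ((1 + 1) *s x)" by (simp only: vec.scale_left_distrib vec.scale_one)
  then show ?thesis unfolding F_scale F_add by (simp add: algebra_simps)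
qed

lemma b_T_T: "b (T x) (T y) = mu * tau (b x y)"
  using F_T[of "x + y"] F_T[of x] F_T[of y] by (simp add: T_add F_add tau_add algebra_simps)

lemma alpha_values: "\<alpha> g = 1" "\<alpha> (comb c1 c2 c3 c4) = 0"
proof -
  have "wpart g = 0" using perp_g by (simp add: wpart_def perp_def comb_def)
  then have "1 *s g = \<alpha> g *s g" using basis[of g] beta_g by simp
  then show "\<alpha> g = 1" using g0 by (metis vec.scale_right_imp_eq)
  have "\<alpha> (comb c1 c2 c3 c4) *s g = 0" using basis[of "comb c1 c2 c3 c4"] by simp
  then show "\<alpha> (comb c1 c2 c3 c4) = 0" using g0 by simp
qed

lemma Phi_sign:
  assumes "singH u"
  shows "\<exists>k. k \<noteq> 0 \<and> (\<Phi> u = k *s T u \<or> \<Phi> u = k *s T (wpart u - \<alpha> u *s g))"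
proof -
  obtain k h where k: "k \<noteq> 0" "\<Phi> u = k *s T h" "\<beta> h = 0" "F h = 0" "wpart h = wpart u"
    using Phi_T_preimage[OF assms] .
  have p: "perp (c *s g)" for c using perp_g by (simp add: perp_def b_expand)
  have h: "h = wpart u + \<alpha> h *s g" and u: "u = wpart u + \<alpha> u *s g"
    using basis[of h] basis[of u] k assms by auto
  have "F (wpart u + c *s g) = F (wpart u) + c * c * F g" for c
    using F_comb_perp[OF p] by (simp add: wpart_def F_scale)
  then have "\<alpha> h * \<alpha> h * F g = \<alpha> u * \<alpha> u * F g" using h u k assms by (metis add_left_cancel)
  then have "\<alpha> h = \<alpha> u \<or> \<alpha> h = - \<alpha> u" using Fg by (simp add: square_eq_iff)
  then show ?thesis
  proof
    assume "\<alpha> h = \<alpha> u" then show ?thesis using h u k by metis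
  next
    assume "\<alpha> h = - \<alpha> u"
    then have "h = wpart u - \<alpha> u *s g" using h by simp
    then show ?thesis using k by blast
  qed
qed

definition good where "good c1 c2 c3 c4 \<longleftrightarrow> (\<exists>k. k \<noteq> 0 \<and> \<Phi> (comb c1 c2 c3 c4 + g) = k *s T (comb c1 c2 c3 c4 + g))"

lemma sing_comb_g: "c1 * c3 - c2 * c4 = F g \<Longrightarrow> singH (comb c1 c2 c3 c4 + g)"
proof -
  assume d: "c1 * c3 - c2 * c4 = F g"
  have "b (comb c1 c2 c3 c4 + g) w1 = - c3" "b (comb c1 c2 c3 c4 + g) w2 = c4"
    using perp_g by (simp_all add: b_add perp_def)
  moreover have "c3 \<noteq> 0 \<or> c4 \<noteq> 0" using d Fg by auto
  ultimately have "comb c1 c2 c3 c4 + g \<noteq> 0" by auto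
  moreover have "F (comb c1 c2 c3 c4 + g) = F g - (c1 * c3 - c2 * c4)"
    by (simp add: F_comb_perp[OF perp_g] F_comb)
  ultimately show ?thesis using d by (simp add: beta_add beta_g)
qed

text \<open>The points \<open>\<langle>v + g\<rangle>\<close> and \<open>\<langle>v + m +
  g\<rangle>\<close> are collinear when \<open>m\<close> is singular and orthogonal to
  \<open>v\<close>. With the wrong sign at the second point, collinearity of the images would
  give \<open>4 F g = 0\<close>, so the characteristic is 2, where both signs are the
  same.\<close>

lemma good_step:
  assumes d: "c1 * c3 - c2 * c4 = F g" and gd: "good c1 c2 c3 c4"
    and n: "m1 * m3 = m2 * m4" "m1 * c3 + m3 * c1 = m2 * c4 + m4 * c2"
  shows "good (c1 + m1) (c2 + m2) (c3 + m3) (c4 + m4)"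
proof -
  let ?v = "comb c1 c2 c3 c4" and ?u = "comb (c1 + m1) (c2 + m2) (c3 + m3) (c4 + m4)"
  have "(c1 + m1) * (c3 + m3) - (c2 + m2) * (c4 + m4)
      = (c1 * c3 - c2 * c4) + (m1 * m3 - m2 * m4) + ((m1 * c3 + m3 * c1) - (m2 * c4 + m4 * c2))"
    by (simp add: algebra_simps)
  then have u: "singH (?u + g)" using d n by (intro sing_comb_g) simp
  have v: "singH (?v + g)" using d by (rule sing_comb_g)
  have "b ?v ?u = - (2 * (c1 * c3 - c2 * c4)) - ((m1 * c3 + m3 * c1) - (m2 * c4 + m4 * c2))"
    by (simp add: b_comb_right algebra_simps)
  then have bvu: "b ?v ?u = - (2 * F g)" using d n by simp
  have vg: "b ?v g = 0" "b g ?u = 0" using perp_b_comb[OF perp_g] b_sym0 by blast+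
  have "b (?v + g) (?u + g) = 0" by (simp add: b_expand bvu vg b_double)
  then have o: "b (\<Phi> (?v + g)) (\<Phi> (?u + g)) = 0" using Phi_perp[of "?v + g" "?u + g"] u v by auto
  have "wpart (?u + g) = ?u" "\<alpha> (?u + g) = 1"
    by (simp_all add: wpart_comb_perp[OF perp_g] alpha_add alpha_values)
  then obtain k where k: "k \<noteq> 0" "\<Phi> (?u + g) = k *s T (?u + g) \<or> \<Phi> (?u + g) = k *s T (?u - g)"
    using Phi_sign[OF u] by auto
  obtain l where l: "l \<noteq> 0" "\<Phi> (?v + g) = l *s T (?v + g)" using gd by (auto simp: good_def)
  from k(2) show ?thesis
  proof
    assume "\<Phi> (?u + g) = k *s T (?u + g)" then show ?thesis using k by (auto simp: good_def)
  next
    assume m: "\<Phi> (?u + g) = k *s T (?u - g)"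
    then have "b (T (?v + g)) (T (?u - g)) = 0" using o k l by (simp add: b_scale b_scale_right)
    then have "b (?v + g) (?u - g) = 0" using mu(6) by (simp add: b_T_T)
    then have "2 * (2 * F g) = 0" by (simp add: b_expand bvu vg b_double algebra_simps)
    then have "(2::'a) = 0" using Fg by (metis mult_eq_0_iff)
    then have "g + g = 0" by (metis one_add_one vec.scale_left_distrib vec.scale_one vector_smult_lzero)
    then have e: "?u - g = ?u + g" by (simp add: diff_eq_eq add.assoc)
    show ?thesis using m k(1) unfolding e good_def by blast
  qed
qed

text \<open>The condition says that the matrix with rows \<open>(c1, c2)\<close> and \<open>(c4,
  c3)\<close> has determinant \<open>F g\<close>. Elementary row and column operations are
  instances of \<open>good_step\<close>, and they connect all these matrices to the diagonal
  matrix \<open>diag(1, F g)\<close>, which belongs to \<open>R\<close>.\<close>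

lemma good_all:
  assumes d: "c1 * c3 - c2 * c4 = F g"
  shows "good c1 c2 c3 c4"
proof -
  have col: "good c1 (c2 + r * c1) (c3 + r * c4) c4" if "c1 * c3 - c2 * c4 = F g" "good c1 c2 c3 c4" for c1 c2 c3 c4 r
    using good_step[OF that, of 0 "r * c4" "r * c1" 0] by (simp add: mult_ac)
  have col': "good (c1 + r * c2) c2 c3 (c4 + r * c3)" if "c1 * c3 - c2 * c4 = F g" "good c1 c2 c3 c4" for c1 c2 c3 c4 r
    using good_step[OF that, of "r * c2" 0 0 "r * c3"] by (simp add: mult_ac)
  obtain l where l: "l \<noteq> 0" "\<Phi> R = l *s (TW R + g')" using g'(5)[OF g0] by blast
  have "T R = TW R + g'" using R(1)[OF g0] by (simp add: T_def R_def alpha_add alpha_values)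
  then have s0: "good 1 0 (F g) 0" using l by (auto simp: good_def R_def)
  have s1: "good 1 0 (F g) c4" for c4
    using good_step[OF _ s0, of 0 0 0 c4] by simp
  have s2: "good 1 c2 c3 c4" if "c3 - c2 * c4 = F g" for c2 c3 c4
    using col[OF _ s1, of c4 c2] that by (simp add: diff_eq_eq)
  have s3: "good c1 c2 c3 c4" if "c1 * c3 - c2 * c4 = F g" "c2 \<noteq> 0" for c1 c2 c3 c4
  proof -
    let ?r = "(c1 - 1) / c2"
    have r: "c2 * ?r = c1 - 1" using that(2) by simp
    have e: "c3 - c2 * (c4 - r * c3) = c3 - c2 * c4 + (c2 * r) * c3" for r by (simp add: algebra_simps)
    have 1: "c3 - c2 * (c4 - ?r * c3) = F g" unfolding e r using that(1) by (simp add: algebra_simps)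
    show ?thesis using col'[OF _ s2[OF 1], of ?r] 1 that(2) by simp
  qed
  show ?thesis
  proof (cases "c2 = 0")
    case True
    then have "c1 \<noteq> 0" using d Fg by auto
    moreover have 1: "c1 * (c3 + c4) - c1 * c4 = F g" using d True by (simp add: algebra_simps)
    ultimately have "good c1 c1 (c3 + c4) c4" by (intro s3)
    then show ?thesis using col[OF 1, of "- 1"] True by simp
  qed (use d s3 in blast)
qed

lemma Phi_eq_T_linear:
  assumes u: "singH u"
  shows "\<exists>k. k \<noteq> 0 \<and> \<Phi> u = k *s T u"
proof (cases "\<alpha> u = 0")
  case True
  then have "wpart u - \<alpha> u *s g = u" using basis[of u] u by simp
  then show ?thesis using Phi_sign[OF u] by auto
next
  case False
  let ?s = "\<alpha> u"
  let ?c1 = "- b u w3 / ?s" and ?c2 = "b u w4 / ?s" and ?c3 = "- b u w1 / ?s" and ?c4 = "b u w2 / ?s"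
  let ?v = "comb ?c1 ?c2 ?c3 ?c4"
  have "?s *s ?v = wpart u" using False by (simp add: comb_def wpart_def vec.scale_right_distrib vector_smult_assoc)
  then have us: "u = ?s *s (?v + g)" using basis[of u] u by (simp add: vec.scale_right_distrib)
  have "F (?s *s (?v + g)) = ?s * ?s * F (?v + g)" by (simp only: F_scale lin)
  then have "F (?v + g) = 0" using u False us by simp
  moreover have "F (comb a1 a2 a3 a4 + g) = F g - (a1 * a3 - a2 * a4)" for a1 a2 a3 a4
    by (simp add: F_comb_perp[OF perp_g] F_comb)
  ultimately have "?c1 * ?c3 - ?c2 * ?c4 = F g" by (metis eq_iff_diff_eq_0)
  then have "good ?c1 ?c2 ?c3 ?c4" and vg: "singH (?v + g)" using good_all sing_comb_g by blast+
  then obtain k where k: "k \<noteq> 0" "\<Phi> (?v + g) = k *s T (?v + g)" by (auto simp: good_def)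
  obtain l where l: "l \<noteq> 0" "\<Phi> (?s *s (?v + g)) = l *s \<Phi> (?v + g)"
    using Phi_scale[of "?v + g" ?s] vg False by blast
  have "T (?s *s (?v + g)) = tau ?s *s T (?v + g)" by (rule T_scale)
  then have "T u = tau ?s *s T (?v + g)" using us by simp
  then have "\<Phi> u = (l * k / tau ?s) *s T u"
    using l k us[symmetric] False by (simp add: vector_smult_assoc)
  then show ?thesis using k l False by (metis divide_eq_0_iff mult_eq_0_iff tau_eq_0)
qed

end

lemma Phi_eq_T: "singH u \<Longrightarrow> \<exists>k. k \<noteq> 0 \<and> \<Phi> u = k *s T u"
proof (cases "g = 0")
  case True
  assume u: "singH u"
  obtain k h where k: "k \<noteq> 0" "\<Phi> u = k *s T h" "\<beta> h = 0" "F h = 0" "wpart h = wpart u"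
    using Phi_T_preimage[OF u] .
  have "h = u" using basis[of h] basis[of u] u k True by simp
  then show ?thesis using k by blast
qed (rule Phi_eq_T_linear)

end

section \<open>From semilinear maps to automorphisms\<close>

lemma bij_betw_finite_selfmap: "finite A \<Longrightarrow> f ` A \<subseteq> A \<Longrightarrow> inj_on f A \<Longrightarrow> bij_betw f A A"
  by (simp add: bij_betw_def endo_inj_surj)

context polar_frame
begin

lemma semilinear_similitude_automorphism:
  fixes T :: "'a^'n \<Rightarrow> 'a^'n" and t :: "'a \<Rightarrow> 'a"
  assumes T_add: "\<And>x y. T (x + y) = T x + T y" and T_scale: "\<And>c x. T (c *s x) = t c *s T x"
    and inj_T: "inj T" and t_onto: "surj t" and t_0: "\<And>c. t c = 0 \<longleftrightarrow> c = 0"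
    and F_T: "\<And>x. F x = 0 \<Longrightarrow> F (T x) = 0" and T_H: "\<And>x. \<beta> x = 0 \<Longrightarrow> \<beta> (T x) = 0"
  shows "automorphism S (image T) (image T)" "automorphism S' (image T) (image T)"
    and "\<And>u. T ` vec.span {u} = vec.span {T u}"
proof -
  show span1: "T ` vec.span {u} = vec.span {T u}" for u
  proof (intro equalityI subsetI)
    fix x assume "x \<in> vec.span {T u}"
    then obtain r where "x = r *s T u" by (auto simp: mem_span1)
    moreover obtain s where "r = t s" using t_onto by (metis surjD)
    ultimately have "x = T (s *s u)" by (simp add: T_scale)
    then show "x \<in> T ` vec.span {u}" by (auto simp: mem_span1)
  qed (auto simp: mem_span1 T_scale)
  have span2: "T ` vec.span {x, y} = vec.span {T x, T y}" for x y
  proof (intro equalityI subsetI)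
    fix v assume "v \<in> vec.span {T x, T y}"
    then obtain r s where "v = r *s T x + s *s T y" by (auto simp: mem_span2)
    moreover obtain r' s' where "r = t r'" "s = t s'" using t_onto by (metis surjD)
    ultimately have "v = T (r' *s x + s' *s y)" by (simp add: T_scale T_add)
    moreover have "r' *s x + s' *s y \<in> vec.span {x, y}" using mem_span2 by blast
    ultimately show "v \<in> T ` vec.span {x, y}" by blast
  next
    fix v assume "v \<in> T ` vec.span {x, y}"
    then obtain r s where "v = T (r *s x + s *s y)" by (auto simp: mem_span2)
    then have "v = t r *s T x + t s *s T y" by (simp add: T_scale T_add)
    then show "v \<in> vec.span {T x, T y}" by (auto simp: mem_span2)
  qed
  have T0: "T 0 = 0" using T_add[of 0 0] by simp
  have T_nz: "T x \<noteq> 0" if "x \<noteq> 0" for x using that inj_T T0 by (metis injD)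
  have pts: "T ` p \<in> pts S" if "p \<in> pts S" for p
    using that span1 T_nz F_T by (auto simp: pts_iff) metis
  have lns: "T ` L \<in> lns S" if L: "L \<in> lns S" for L
  proof -
    obtain x y where xy: "indep2 x y" "F x = 0" "F y = 0" "b x y = 0" "L = vec.span {x, y}"
      using L by (auto simp: lns_iff)
    have "indep2 (T x) (T y)"
      unfolding indep2_def
    proof (intro allI impI)
      fix r s assume rs: "r *s T x + s *s T y = 0"
      obtain r' s' where e: "r = t r'" "s = t s'" using t_onto by (metis surjD)
      then have "T (r' *s x + s' *s y) = T 0" using rs by (simp add: T_add T_scale T0)
      then have "r' *s x + s' *s y = 0" using inj_T by (metis injD)
      then have "r' = 0 \<and> s' = 0" using xy(1) unfolding indep2_def by blast
      then show "r = 0 \<and> s = 0" using e t_0 by simp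
    qed
    moreover have "b (T x) (T y) = 0"
    proof (rule b_zero_of_F)
      fix r s
      obtain r' s' where e: "r = t r'" "s = t s'" using t_onto by (metis surjD)
      have "F (T (r' *s x + s' *s y)) = 0" using xy by (intro F_T F_combo)
      then show "F (r *s T x + s *s T y) = 0" using e by (simp add: T_add T_scale)
    qed
    ultimately show ?thesis using xy F_T span2 by (auto simp: lns_iff)
  qed
  have TH: "T ` X \<subseteq> H" if "X \<subseteq> H" for X using that T_H by auto
  have inj: "inj_on (image T) A" for A using inj_T by (auto simp: inj_on_def inj_image_eq_iff)
  have inc: "X \<subseteq> Y \<longleftrightarrow> T ` X \<subseteq> T ` Y" for X Y using inj_image_subset_iff[OF inj_T] by blast
  show "automorphism S (image T) (image T)"
    unfolding automorphism_def inc_S using pts lns inj inc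
    by (intro conjI bij_betw_finite_selfmap ballI) auto
  have sub: "image T ` {p \<in> pts S. p \<subseteq> H} \<subseteq> {p \<in> pts S. p \<subseteq> H}"
    "image T ` {L \<in> lns S. L \<subseteq> H} \<subseteq> {L \<in> lns S. L \<subseteq> H}"
    using pts lns TH by blast+
  have "inc S' = (\<subseteq>)" by (simp add: section_geometry_def)
  then show "automorphism S' (image T) (image T)"
    unfolding automorphism_def S'_simps using inj inc sub
    by (intro conjI bij_betw_finite_selfmap ballI) auto
qed

text \<open>Choose spanning vectors for the images of the points of \<open>S'\<close>, and for
  points subtending the images of the subtended ovoids; perpendicularity is then preserved and
  \<open>frame_map_basis\<close> applies.\<close>

theorem cover_extends:
  fixes \<alpha> :: "'a^'n \<Rightarrow> 'a"
  assumes alpha_add: "\<And>x y. \<alpha> (x + y) = \<alpha> x + \<alpha> y" and alpha_scale: "\<And>c x. \<alpha> (c *s x) = c * \<alpha> x"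
    and perp_g: "perp g" and beta_g: "\<beta> g = 0" and perp_z0: "perp z0" and beta_z0: "\<beta> z0 = 1"
    and basis: "\<And>v. v = wpart v + \<alpha> v *s g + \<beta> v *s z0"
    and linear_case: "g \<noteq> 0 \<Longrightarrow> cj = id \<and> tr = id"
    and cover: "theta_cover \<theta> (geometry_diff S S') (ovoid_geometry S S') f gl" and theta: "\<theta> > 0"
  shows "extends_to_automorphism S S' (assoc_map S S' gl)"
proof -
  interpret Q: gq_cover S S' f gl \<theta>
    by (intro gq_cover.intro gq gq_cover_axioms.intro cover theta)
  let ?\<sigma> = "assoc_map S S' gl"
  let ?sing = "\<lambda>x. x \<noteq> 0 \<and> F x = 0" and ?singH = "\<lambda>x. x \<noteq> 0 \<and> F x = 0 \<and> \<beta> x = 0"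
  have maps: "?\<sigma> p \<in> pts S'" if "p \<in> pts S'" for p using Q.assoc_bij that by (auto simp: bij_betw_def)
  \<comment> \<open>every point of the big quadrangle has a partner whose trace is the image of its trace\<close>
  have ex: "\<exists>y. ?sing y \<and> (\<beta> x = 0 \<longrightarrow> \<beta> y = 0 \<and> ?\<sigma> (vec.span {x}) = vec.span {y}) \<and>
      (\<forall>u u'. ?singH u \<longrightarrow> ?singH u' \<longrightarrow> ?\<sigma> (vec.span {u}) = vec.span {u'} \<longrightarrow> (b y u' = 0 \<longleftrightarrow> b x u = 0))"
    if x: "?sing x" for x
  proof (cases "\<beta> x = 0")
    case True
    then have p: "vec.span {x} \<in> pts S'" using x pts'_iff by blast
    obtain y where y: "?singH y" "?\<sigma> (vec.span {x}) = vec.span {y}" using maps[OF p] pts'_iff by blast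
    have "b y u' = 0 \<longleftrightarrow> b x u = 0" if "?singH u" "?singH u'" "?\<sigma> (vec.span {u}) = vec.span {u'}" for u u'
    proof -
      have "vec.span {u} \<in> pts S'" using that pts'_iff by blast
      from Q.assoc_coll[OF p this] show ?thesis using that x y coll_iff by simp
    qed
    then show ?thesis using y by blast
  next
    case False
    then have p: "vec.span {x} \<in> pts S - pts S'" using x span_pt span1_H by (auto simp: S'_simps)
    obtain w where w: "w \<in> pts S - pts S'" "?\<sigma> ` subtended S S' (vec.span {x}) = subtended S S' w"
      using Q.assoc_subtended[OF p] by blast
    obtain y where y: "?sing y" "w = vec.span {y}" using w by (auto simp: pts_iff)
    have "b y u' = 0 \<longleftrightarrow> b x u = 0" if u: "?singH u" "?singH u'" "?\<sigma> (vec.span {u}) = vec.span {u'}" for u u'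
    proof -
      have in': "vec.span {u} \<in> pts S'" "vec.span {u'} \<in> pts S'" using u pts'_iff by blast+
      have "b y u' = 0 \<longleftrightarrow> vec.span {u'} \<in> subtended S S' w"
        using u y in' coll_iff by (simp add: Q.mem_Ov)
      also have "\<dots> \<longleftrightarrow> ?\<sigma> (vec.span {u}) \<in> ?\<sigma> ` subtended S S' (vec.span {x})" using w u by simp
      also have "\<dots> \<longleftrightarrow> vec.span {u} \<in> subtended S S' (vec.span {x})"
        using Q.assoc_bij in' by (intro inj_on_image_mem_iff[of _ "pts S'"]) (auto simp: bij_betw_def Q.mem_Ov)
      also have "\<dots> \<longleftrightarrow> b x u = 0" using u x in' coll_iff by (simp add: Q.mem_Ov)
      finally show ?thesis .
    qed
    then show ?thesis using y False by blast
  qed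
  then obtain \<Phi> where \<Phi>: "\<And>x. ?sing x \<Longrightarrow> ?sing (\<Phi> x) \<and> (\<beta> x = 0 \<longrightarrow> \<beta> (\<Phi> x) = 0 \<and> ?\<sigma> (vec.span {x}) = vec.span {\<Phi> x}) \<and>
      (\<forall>u u'. ?singH u \<longrightarrow> ?singH u' \<longrightarrow> ?\<sigma> (vec.span {u}) = vec.span {u'} \<longrightarrow> (b (\<Phi> x) u' = 0 \<longleftrightarrow> b x u = 0))"
    by (metis (no_types, lifting))
  interpret M: frame_map_basis cj tr F b \<beta> w1 w2 w3 w4 \<Phi> \<alpha> g z0
  proof unfold_locales
    fix x assume x: "x \<noteq> 0" "F x = 0"
    show "\<Phi> x \<noteq> 0" "F (\<Phi> x) = 0" using \<Phi>[of x] x by auto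
    { assume "\<beta> x = 0" then show "\<beta> (\<Phi> x) = 0" using \<Phi>[of x] x by auto }
    { fix u assume u: "u \<noteq> 0" "F u = 0" "\<beta> u = 0"
      then have "?singH (\<Phi> u)" "?\<sigma> (vec.span {u}) = vec.span {\<Phi> u}" using \<Phi>[of u] by auto
      then show "b (\<Phi> x) (\<Phi> u) = 0 \<longleftrightarrow> b x u = 0" using \<Phi>[of x] x u by blast }
  next
    fix u :: "'a^'n" and c :: 'a assume u: "u \<noteq> 0" "F u = 0" "\<beta> u = 0" "c \<noteq> 0"
    then have cu: "c *s u \<noteq> 0" "F (c *s u) = 0" "\<beta> (c *s u) = 0" by (auto simp: F_scale beta_scale)
    have "vec.span {c *s u} = vec.span {u}" using span_singleton_eq[OF cu(1) u(1)] u by blast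
    then have "vec.span {\<Phi> (c *s u)} = vec.span {\<Phi> u}" using \<Phi>[of u] \<Phi>[of "c *s u"] u cu by simp
    then show "\<exists>k. k \<noteq> 0 \<and> \<Phi> (c *s u) = k *s \<Phi> u"
      using span_singleton_eq[of "\<Phi> (c *s u)" "\<Phi> u"] \<Phi>[of u] \<Phi>[of "c *s u"] u cu by simp
  qed (use assms in auto)
  have "surj M.tau" by (rule finite_UNIV_inj_surj[OF _ M.inj_tau]) simp
  note aut = semilinear_similitude_automorphism[of M.T M.tau, OF M.T_add M.T_scale M.inj_T this M.tau_eq_0 _ M.T_H]
  have "?\<sigma> p = M.T ` p" if p: "p \<in> pts S'" for p
  proof -
    obtain u where u: "?singH u" "p = vec.span {u}" using p pts'_iff by blast
    then obtain k where k: "k \<noteq> 0" "\<Phi> u = k *s M.T u" using M.Phi_eq_T by blast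
    then have "M.T u \<noteq> 0" using \<Phi>[of u] u by auto
    then have "vec.span {\<Phi> u} = vec.span {M.T u}" using k \<Phi>[of u] u span_singleton_eq[of "\<Phi> u" "M.T u"] by blast
    then show ?thesis using \<Phi>[of u] u aut(3)[of u] by (simp add: M.F_T)
  qed
  then show ?thesis unfolding extends_to_automorphism_def
    using aut(1,2) by (intro exI[of _ "image M.T"]) (simp add: M.F_T)
qed

end

section \<open>Existence of a frame in a nontangent hyperplane\<close>

lemma dim_functional_kernel:
  fixes \<phi> :: "'a::field^'n \<Rightarrow> 'a"
  assumes U: "vec.subspace U" and add: "\<And>x y. \<phi> (x + y) = \<phi> x + \<phi> y" and scale: "\<And>c x. \<phi> (c *s x) = c * \<phi> x"
  shows "vec.subspace {x \<in> U. \<phi> x = 0}" "vec.dim U \<le> vec.dim {x \<in> U. \<phi> x = 0} + 1"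
proof -
  have 0: "\<phi> 0 = 0" using scale[of 0 0] by simp
  show sub: "vec.subspace {x \<in> U. \<phi> x = 0}"
    using U by (auto simp: vec.subspace_def add scale 0)
  show "vec.dim U \<le> vec.dim {x \<in> U. \<phi> x = 0} + 1"
  proof (cases "\<forall>x\<in>U. \<phi> x = 0")
    case True
    then have "{x \<in> U. \<phi> x = 0} = U" by auto
    then show ?thesis by simp
  next
    case False
    then obtain u where u: "u \<in> U" "\<phi> u \<noteq> 0" by auto
    have "U \<subseteq> vec.span (insert u {x \<in> U. \<phi> x = 0})"
    proof
      fix x assume x: "x \<in> U"
      have "\<phi> (x - (\<phi> x / \<phi> u) *s u) = 0"
        using add[of "x - (\<phi> x / \<phi> u) *s u" "(\<phi> x / \<phi> u) *s u"] u by (simp add: scale)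
      moreover have "x - (\<phi> x / \<phi> u) *s u \<in> U" using U x u by (simp add: vec.subspace_diff vec.subspace_scale)
      ultimately show "x \<in> vec.span (insert u {x \<in> U. \<phi> x = 0})"
        unfolding vec.span_breakdown_eq by (auto intro: vec.span_base)
    qed
    then have "vec.dim U \<le> vec.dim (insert u {x \<in> U. \<phi> x = 0})" by (rule vec.dim_mono)
    also have "\<dots> \<le> vec.dim {x \<in> U. \<phi> x = 0} + 1" by (simp add: vec.dim_insert)
    finally show ?thesis .
  qed
qed

lemma dim_strict:
  assumes "vec.subspace A" "vec.subspace B" "A \<subseteq> B" "x \<in> B" "x \<notin> (A :: ('a::field^'n) set)"
  shows "vec.dim A + 1 \<le> vec.dim B"
proof -
  have "vec.dim A \<le> vec.dim B" using assms by (intro vec.dim_subset)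
  moreover have "vec.dim A \<noteq> vec.dim B"
    using vec.subspace_dim_equal[OF assms(1,2,3)] assms(4,5) by auto
  ultimately show ?thesis by simp
qed

lemma nonzero_of_dim: "vec.dim U \<ge> 1 \<Longrightarrow> \<exists>u\<in>U. u \<noteq> (0 :: 'a::field^'n)"
  by (metis vec.dim_eq_0 not_one_le_zero singletonI subsetI)

lemma subspace_dim_le_1: "vec.subspace D \<Longrightarrow> vec.dim D \<le> 1 \<Longrightarrow> \<exists>g :: 'a::field^'n. D = vec.span {g}"
proof -
  assume D: "vec.subspace D" "vec.dim D \<le> 1"
  show ?thesis
  proof (cases "vec.dim D = 1")
    case True
    then show ?thesis using D subspace_dim1[of D] by blast
  next
    case False
    then have "vec.dim D = 0" using D(2) by linarith
    then have "D \<subseteq> {0}" by (simp only: vec.dim_eq_0)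
    then have "D = vec.span {0}" using vec.subspace_0[OF D(1)] by (auto simp: mem_span1)
    then show ?thesis by blast
  qed
qed

lemma hyperplane_functional:
  fixes H :: "('a::field^'n) set"
  assumes H: "vec.subspace H" "vec.dim H + 1 = vec.dim (UNIV :: ('a^'n) set)" and z: "z \<notin> H"
  shows "\<exists>\<beta>. (\<forall>x y. \<beta> (x + y) = \<beta> x + \<beta> y) \<and> (\<forall>c x. \<beta> (c *s x) = c * \<beta> x) \<and> H = {v. \<beta> v = 0} \<and> \<beta> z = 1"
proof -
  have spH: "vec.span H = H" using H by (simp add: vec.span_eq_iff)
  have "vec.dim (vec.span (insert z H)) = vec.dim (UNIV :: ('a^'n) set)"
    using H z by (simp add: vec.dim_insert spH del: vec.dim_UNIV)
  then have full: "vec.span (insert z H) = UNIV"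
    using vec.subspace_dim_equal[of "vec.span (insert z H)" UNIV] by (simp add: vec.subspace_span vec.subspace_UNIV)
  have ex: "\<exists>c. v - c *s z \<in> H" for v
    using vec.span_breakdown_eq[of v z H] full spH by auto
  have un: "c = d" if "v - c *s z \<in> H" "v - d *s z \<in> H" for v c d
  proof (rule ccontr)
    assume "c \<noteq> d"
    have "(v - d *s z) - (v - c *s z) \<in> H" by (rule vec.subspace_diff[OF H(1) that(2,1)])
    then have "(c - d) *s z \<in> H" by (simp add: vec.scale_left_diff_distrib)
    then have "inverse (c - d) *s ((c - d) *s z) \<in> H" by (rule vec.subspace_scale[OF H(1)])
    moreover have "inverse (c - d) *s ((c - d) *s z) = z"
      using \<open>c \<noteq> d\<close> by (simp only: vector_smult_assoc) simp
    ultimately show False using z by simp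
  qed
  define \<beta> where "\<beta> v = (THE c. v - c *s z \<in> H)" for v
  have b: "v - \<beta> v *s z \<in> H" for v unfolding \<beta>_def by (rule theI') (use ex un in blast)
  have be: "\<beta> v = c" if "v - c *s z \<in> H" for v c using un[OF b that] .
  have "\<beta> (x + y) = \<beta> x + \<beta> y" for x y
  proof (rule be)
    have "(x - \<beta> x *s z) + (y - \<beta> y *s z) \<in> H" by (rule vec.subspace_add[OF H(1) b b])
    then show "x + y - (\<beta> x + \<beta> y) *s z \<in> H" by (simp add: vec.scale_left_distrib algebra_simps)
  qed
  moreover have "\<beta> (c *s x) = c * \<beta> x" for c x
  proof (rule be)
    have "c *s (x - \<beta> x *s z) \<in> H" by (rule vec.subspace_scale[OF H(1) b])
    then show "c *s x - (c * \<beta> x) *s z \<in> H" by (simp add: vec.scale_right_diff_distrib vector_smult_assoc)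
  qed
  moreover have "v \<in> H \<longleftrightarrow> \<beta> v = 0" for v
    using b[of v] be[of v 0] by auto
  then have "H = {v. \<beta> v = 0}" by blast
  moreover have "\<beta> z = 1" by (rule be) (use H in \<open>simp add: vec.subspace_0\<close>)
  ultimately show ?thesis by blast
qed

context polar_space
begin

text \<open>After scaling \<open>f\<close> to \<open>b x f = c\<close>, add a multiple of
  \<open>x\<close> to make it singular; this is possible because \<open>tr\<close> takes all
  values of \<open>F\<close>.\<close>

lemma hyperbolic_partner:
  assumes U: "vec.subspace U" and x: "x \<in> U" "F x = 0" and f: "f \<in> U" "b x f \<noteq> 0" and c: "c \<noteq> 0"
  shows "\<exists>y\<in>U. F y = 0 \<and> b x y = c"
proof -
  let ?f = "cj (c / b x f) *s f"
  have bf: "b x ?f = c" using f by (simp add: b_scale_right)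
  obtain d where d: "tr d = F ?f" using tr_onto by blast
  have nz: "b ?f x \<noteq> 0" using bf c b_sym0 by metis
  let ?y = "?f + cj (- d / b ?f x) *s x"
  have "F ?y = F ?f + tr (- d)" using nz x by (simp add: F_add F_scale b_scale_right)
  then have "F ?y = 0" using d by (simp add: tr_minus)
  moreover have "b x ?y = c" using bf x by (simp only: b_add_right b_scale_right b_self) simp
  moreover have "?y \<in> U" using U x f by (intro vec.subspace_add vec.subspace_scale)
  ultimately show ?thesis by blast
qed

lemma subspace_perp_vector:
  assumes "vec.subspace U"
  shows "vec.subspace {v \<in> U. b v w = 0}" "vec.dim U \<le> vec.dim {v \<in> U. b v w = 0} + 1"
  using dim_functional_kernel[OF assms, of "\<lambda>v. b v w"] by (auto simp: b_add b_scale)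

definition frame :: "'a^'n \<Rightarrow> 'a^'n \<Rightarrow> 'a^'n \<Rightarrow> 'a^'n \<Rightarrow> bool" where
  "frame w1 w2 w3 w4 \<longleftrightarrow> F w1 = 0 \<and> F w2 = 0 \<and> F w3 = 0 \<and> F w4 = 0 \<and>
     b w1 w2 = 0 \<and> b w2 w3 = 0 \<and> b w3 w4 = 0 \<and> b w4 w1 = 0 \<and> b w1 w3 = - 1 \<and> b w2 w4 = 1"

text \<open>Because the hyperplane is not tangent, every singular vector in it has a partner in
  it that is not orthogonal to it. Split off one hyperbolic pair, then a second one from its
  orthogonal space, which has dimension \<open>k\<close>.\<close>

lemma frame_exists:
  assumes H: "vec.subspace H" "vec.dim H = k + 2" and full: "vec.dim (UNIV :: ('a^'n) set) = k + 3"
    and nontangent: "\<not> (\<exists>x. x \<noteq> 0 \<and> F x = 0 \<and> H = {y. b x y = 0})"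
    and isotropic: "\<And>U. vec.subspace U \<Longrightarrow> vec.dim U \<ge> k \<Longrightarrow> \<exists>u\<in>U. u \<noteq> 0 \<and> F u = 0"
  shows "\<exists>w1\<in>H. \<exists>w2\<in>H. \<exists>w3\<in>H. \<exists>w4\<in>H. frame w1 w2 w3 w4"
proof -
  have partner: "\<exists>f\<in>H. b x f \<noteq> 0" if x: "x \<noteq> 0" "F x = 0" for x
  proof (rule ccontr)
    assume "\<not> ?thesis"
    then have sub: "H \<subseteq> {y. b x y = 0}" by auto
    have "vec.subspace {y \<in> UNIV. b y x = 0}" by (rule subspace_perp_vector) (rule vec.subspace_UNIV)
    moreover have eq: "{y \<in> UNIV. b y x = 0} = {y. b x y = 0}" using b_sym0 by auto
    ultimately have s: "vec.subspace {y. b x y = 0}" by simp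
    obtain y where y: "b x y \<noteq> 0" using nonsingular x by blast
    have "vec.dim {y. b x y = 0} + 1 \<le> vec.dim (UNIV :: ('a^'n) set)"
      by (rule dim_strict[OF s vec.subspace_UNIV, of y]) (use y in auto)
    then have "H = {y. b x y = 0}"
      using vec.subspace_dim_equal[OF H(1) s sub] H full by simp
    then show False using nontangent x by blast
  qed
  obtain w1 where w1: "w1 \<in> H" "w1 \<noteq> 0" "F w1 = 0" using isotropic[of H] H by auto
  obtain f1 where "f1 \<in> H" "b w1 f1 \<noteq> 0" using partner w1 by blast
  then obtain w3 where w3: "w3 \<in> H" "F w3 = 0" "b w1 w3 = - 1"
    using hyperbolic_partner[OF H(1) w1(1,3), of f1 "- 1"] by auto
  have b31: "b w3 w1 = - 1" using w3(3) b_sym[of w3 w1] by (simp add: cj_minus)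
  have b11: "b w1 w1 = 0" "b w3 w3 = 0" using w1 w3 b_self by auto
  let ?U1 = "{v \<in> H. b v w1 = 0}" and ?U = "{v \<in> {v \<in> H. b v w1 = 0}. b v w3 = 0}"
  have U1: "vec.subspace ?U1" "vec.dim H \<le> vec.dim ?U1 + 1" using subspace_perp_vector[OF H(1)] .
  have U: "vec.subspace ?U" "vec.dim ?U1 \<le> vec.dim ?U + 1" using subspace_perp_vector[OF U1(1)] .
  have "vec.dim ?U \<ge> k" using H U1 U by simp
  then obtain w2 where w2: "w2 \<in> ?U" "w2 \<noteq> 0" "F w2 = 0" using isotropic[OF U(1)] by blast
  obtain f where f: "f \<in> H" "b w2 f \<noteq> 0" using partner w2 by blast
  let ?f = "f + b f w3 *s w1 + b f w1 *s w3"
  have w2': "b w2 w1 = 0" "b w2 w3 = 0" using w2 by auto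
  have "?f \<in> H" using f w1 w3 H by (intro vec.subspace_add vec.subspace_scale)
  moreover have "b ?f w1 = 0" "b ?f w3 = 0" by (simp_all add: b_add b_scale b11 b31 w3)
  ultimately have fU: "?f \<in> ?U" by simp
  have "b w2 ?f \<noteq> 0" using f w2' by (simp add: b_add_right b_scale_right)
  then obtain w4 where w4: "w4 \<in> ?U" "F w4 = 0" "b w2 w4 = 1"
    using hyperbolic_partner[OF U(1) w2(1,3) fU, of 1] by auto
  have "frame w1 w2 w3 w4" using w1 w2 w3 w4 w2' b_sym0 by (auto simp: frame_def)
  then show ?thesis using w1 w2 w3 w4 by blast
qed

text \<open>Imposing the four conditions one at a time lowers the dimension each time, because
  the frame vector opposite to the current one still satisfies the previous conditions and
  violates the new one.\<close>

lemma perp_frame_dim: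
  assumes U: "vec.subspace U" and w: "w1 \<in> U" "w2 \<in> U" "w3 \<in> U" "w4 \<in> U" and fr: "frame w1 w2 w3 w4"
  defines "D \<equiv> {v \<in> U. b v w1 = 0 \<and> b v w2 = 0 \<and> b v w3 = 0 \<and> b v w4 = 0}"
  shows "vec.subspace D" "vec.dim D + 4 = vec.dim U"
proof -
  have f: "b w1 w2 = 0" "b w2 w3 = 0" "b w3 w4 = 0" "b w4 w1 = 0" "b w1 w3 = - 1" "b w2 w4 = 1"
    "b w1 w1 = 0" "b w2 w2 = 0" "b w3 w3 = 0" "b w4 w4 = 0"
    using fr b_self by (auto simp: frame_def)
  have f': "b w2 w1 = 0" "b w3 w2 = 0" "b w4 w3 = 0" "b w1 w4 = 0" "b w3 w1 \<noteq> 0" "b w4 w2 \<noteq> 0"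
    using f b_sym0 by (metis zero_neq_one neg_equal_0_iff_equal)+
  let ?A = "{v \<in> U. b v w1 = 0}"
  let ?B = "{v \<in> ?A. b v w2 = 0}"
  let ?C = "{v \<in> ?B. b v w3 = 0}"
  let ?D = "{v \<in> ?C. b v w4 = 0}"
  have A: "vec.subspace ?A" "vec.dim U \<le> vec.dim ?A + 1" by (rule subspace_perp_vector[OF U])+
  have B: "vec.subspace ?B" "vec.dim ?A \<le> vec.dim ?B + 1" by (rule subspace_perp_vector[OF A(1)])+
  have C: "vec.subspace ?C" "vec.dim ?B \<le> vec.dim ?C + 1" by (rule subspace_perp_vector[OF B(1)])+
  have D: "vec.subspace ?D" "vec.dim ?C \<le> vec.dim ?D + 1" by (rule subspace_perp_vector[OF C(1)])+
  have "vec.dim ?A + 1 \<le> vec.dim U" by (rule dim_strict[OF A(1) U, of w3]) (use w f f' in auto)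
  moreover have "vec.dim ?B + 1 \<le> vec.dim ?A" by (rule dim_strict[OF B(1) A(1), of w4]) (use w f f' in auto)
  moreover have "vec.dim ?C + 1 \<le> vec.dim ?B" by (rule dim_strict[OF C(1) B(1), of w1]) (use w f f' in auto)
  moreover have "vec.dim ?D + 1 \<le> vec.dim ?C" by (rule dim_strict[OF D(1) C(1), of w2]) (use w f f' in auto)
  moreover have "D = ?D" by (auto simp: D_def)
  ultimately show "vec.subspace D" "vec.dim D + 4 = vec.dim U" using A B C D by simp_all
qed

end

section \<open>Covers of the complement of a nontangent hyperplane section\<close>

context polar_space
begin

text \<open>Here \<open>k = 3\<close> is the case of quadrics in dimension 6 and \<open>k =
  2\<close> that of Hermitian varieties in dimension 5. The part of \<open>H\<close> orthogonal
  to a frame has dimension \<open>k - 2\<close>.\<close>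

theorem nontangent_cover_extends:
  assumes H: "vec.subspace H" "vec.dim H = k + 2" and full: "vec.dim (UNIV :: ('a^'n) set) = k + 3"
    and nontangent: "\<not> (\<exists>x. x \<noteq> 0 \<and> F x = 0 \<and> H = {y. b x y = 0})"
    and isotropic: "\<And>U. vec.subspace U \<Longrightarrow> vec.dim U \<ge> k \<Longrightarrow> \<exists>u\<in>U. u \<noteq> 0 \<and> F u = 0"
    and anisotropic: "\<And>w1 w2 w3 w4 z. \<lbrakk>frame w1 w2 w3 w4; b z w1 = 0; b z w2 = 0; b z w3 = 0; b z w4 = 0; F z = 0\<rbrakk>
       \<Longrightarrow> z = 0"
    and universal: "\<And>w1 w2 w3 w4 v. frame w1 w2 w3 w4 \<Longrightarrow>
       \<exists>z. b z w1 = 0 \<and> b z w2 = 0 \<and> b z w3 = 0 \<and> b z w4 = 0 \<and> F z = - F v"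
    and k: "k = 2 \<or> k = 3 \<and> cj = id \<and> tr = id"
    and cover: "theta_cover \<theta> (geometry_diff S (section_geometry F H)) (ovoid_geometry S (section_geometry F H)) f gl"
    and theta: "\<theta> > 0"
  shows "extends_to_automorphism S (section_geometry F H) (assoc_map S (section_geometry F H) gl)"
proof -
  obtain w1 w2 w3 w4 where w: "w1 \<in> H" "w2 \<in> H" "w3 \<in> H" "w4 \<in> H" and fr: "frame w1 w2 w3 w4"
    using frame_exists[OF H full nontangent isotropic] by blast
  have "H \<noteq> UNIV" using H full by auto
  then obtain v0 where v0: "v0 \<notin> H" by auto
  have "vec.dim H + 1 = vec.dim (UNIV :: ('a^'n) set)" using H full by simp
  from hyperplane_functional[OF H(1) this v0] obtain \<beta> where
    beta: "\<And>x y. \<beta> (x + y) = \<beta> x + \<beta> y" "\<And>c x. \<beta> (c *s x) = c * \<beta> x" "H = {v. \<beta> v = 0}" "\<beta> v0 = 1"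
    by blast
  interpret polar_frame cj tr F b \<beta> w1 w2 w3 w4
  proof unfold_locales
    show "\<exists>v. \<beta> v \<noteq> 0" using beta(4) by (intro exI[of _ v0]) simp
  qed (use beta w fr anisotropic[OF fr] universal[OF fr] in \<open>auto simp: frame_def\<close>)
  define z0 where "z0 = v0 - wpart v0"
  have z0: "perp z0" "\<beta> z0 = 1" using perp_diff beta(4) by (auto simp: z0_def beta_diff wpart_def)
  let ?D = "{v \<in> H. b v w1 = 0 \<and> b v w2 = 0 \<and> b v w3 = 0 \<and> b v w4 = 0}"
  have D: "vec.subspace ?D" "vec.dim ?D + 4 = vec.dim H" using perp_frame_dim[OF H(1) w fr] .
  have "vec.dim ?D \<le> 1" using D(2) H(2) k by linarith
  then obtain g where g: "?D = vec.span {g}" using subspace_dim_le_1[OF D(1)] by blast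
  then have gD: "g \<in> ?D" by (simp add: vec.span_base)
  have "k = 2 \<Longrightarrow> vec.dim ?D = 0" using D(2) H(2) by simp
  then have "k = 2 \<Longrightarrow> ?D \<subseteq> {0}" by (simp only: vec.dim_eq_0)
  then have lin: "g \<noteq> 0 \<Longrightarrow> cj = id \<and> tr = id" using gD k by blast
  define pr where "pr v = v - wpart v - \<beta> v *s z0" for v
  have "pr v \<in> ?D" for v
    using perp_diff[of v] z0 beta(3) by (auto simp: pr_def perp_def b_diff b_scale beta_diff beta_scale wpart_def)
  then have "\<exists>a. pr v = a *s g" for v unfolding g by (simp add: mem_span1)
  then obtain a where a: "\<And>v. pr v = a v *s g" by metis
  define \<alpha> where "\<alpha> v = (if g = 0 then 0 else a v)" for v
  have al: "pr v = \<alpha> v *s g" for v using a[of v] by (simp add: \<alpha>_def)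
  have wp: "wpart (x + y) = wpart x + wpart y" "wpart (c *s x) = c *s wpart x" for x y c
    by (simp_all add: wpart_def comb_def b_add b_scale vec.scale_left_distrib vec.scale_right_distrib
        vec.scale_left_diff_distrib vec.scale_right_diff_distrib vector_smult_assoc)
  have pr: "pr (x + y) = pr x + pr y" "pr (c *s x) = c *s pr x" for x y c
    by (simp_all add: pr_def wp beta_add beta_scale vec.scale_left_distrib vec.scale_right_diff_distrib vector_smult_assoc)
  have "\<alpha> (x + y) = \<alpha> x + \<alpha> y" for x y
  proof (cases "g = 0")
    case False
    have "\<alpha> (x + y) *s g = (\<alpha> x + \<alpha> y) *s g"
      using pr(1)[of x y] by (simp only: al vec.scale_left_distrib)
    then show ?thesis using False by (metis vec.scale_right_imp_eq)
  qed (simp add: \<alpha>_def)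
  moreover have "\<alpha> (c *s x) = c * \<alpha> x" for c x
  proof (cases "g = 0")
    case False
    have "\<alpha> (c *s x) *s g = (c * \<alpha> x) *s g"
      using pr(2)[of c x] by (simp only: al vector_smult_assoc)
    then show ?thesis using False by (metis vec.scale_right_imp_eq)
  qed (simp add: \<alpha>_def)
  moreover have "v = wpart v + \<alpha> v *s g + \<beta> v *s z0" for v
    using al[of v, symmetric] by (simp add: pr_def)
  moreover have "perp g" "\<beta> g = 0" using gD beta(3) by (auto simp: perp_def)
  ultimately show ?thesis
    using cover_extends[of \<alpha> g z0 \<theta> f gl] z0 lin cover theta unfolding beta(3) by blast
qed

end

section \<open>Elliptic quadrics\<close>

text \<open>With a choice \<open>r\<close> of square roots every element is \<open>r s\<close>
  or \<open>- r s\<close> for a square \<open>s\<close>, and 0 occurs only once.\<close>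

lemma card_squares: "CARD('a::{field,finite}) < 2 * card (range (\<lambda>x::'a. x\<^sup>2))"
proof -
  let ?R = "range (\<lambda>x::'a. x\<^sup>2)"
  obtain r where r: "\<And>s. s \<in> ?R \<Longrightarrow> (r s)\<^sup>2 = (s :: 'a)" by (metis imageE)
  have "x \<in> r ` ?R \<union> (\<lambda>s. - r s) ` (?R - {0})" for x :: 'a
  proof -
    have "(r (x\<^sup>2))\<^sup>2 = x\<^sup>2" using r by blast
    then have "x = r (x\<^sup>2) \<or> x = - r (x\<^sup>2)" by (metis power2_eq_iff)
    moreover have "x\<^sup>2 = 0 \<Longrightarrow> x = r (x\<^sup>2)" using \<open>(r (x\<^sup>2))\<^sup>2 = x\<^sup>2\<close> by simp
    ultimately show ?thesis by (cases "x\<^sup>2 = 0") auto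
  qed
  then have "UNIV \<subseteq> r ` ?R \<union> (\<lambda>s. - r s) ` (?R - {0})" by blast
  then have "CARD('a) \<le> card (r ` ?R \<union> (\<lambda>s. - r s) ` (?R - {0}))" by (intro card_mono) auto
  also have "\<dots> \<le> card (r ` ?R) + card ((\<lambda>s. - r s) ` (?R - {0}))" by (rule card_Un_le)
  also have "\<dots> \<le> card ?R + card (?R - {0})" by (intro add_mono card_image_le) auto
  also have "\<dots> < 2 * card ?R"
  proof -
    have "0 \<in> ?R" by (rule range_eqI[of _ _ 0]) simp
    then have "card (?R - {0}) < card ?R" by (intro psubset_card_mono) auto
    then show ?thesis by simp
  qed
  finally show ?thesis .
qed

text \<open>The sets of values \<open>a * x\<^sup>2\<close> and \<open>c - d * y\<^sup>2\<close>
  each contain more than half of the field, so they meet.\<close>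

lemma diagonal_form_universal:
  fixes a d c :: "'a::{field,finite}"
  assumes "a \<noteq> 0" "d \<noteq> 0"
  shows "\<exists>x y. a * x\<^sup>2 + d * y\<^sup>2 = c"
proof -
  let ?R = "range (\<lambda>x::'a. x\<^sup>2)"
  let ?A = "(\<lambda>s. a * s) ` ?R" and ?B = "(\<lambda>s. c - d * s) ` ?R"
  have c: "card ?A = card ?R" "card ?B = card ?R"
    using assms by (intro card_image inj_onI; simp)+
  have "?A \<inter> ?B \<noteq> {}"
  proof
    assume "?A \<inter> ?B = {}"
    then have "card (?A \<union> ?B) = card ?A + card ?B" by (intro card_Un_disjoint) auto
    moreover have "card (?A \<union> ?B) \<le> CARD('a)" by (intro card_mono) auto
    ultimately show False using c card_squares[where 'a = 'a] by simp
  qed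
  then obtain x y where "a * x\<^sup>2 = c - d * y\<^sup>2" by auto
  then have "a * x\<^sup>2 + d * y\<^sup>2 = c" by simp
  then show ?thesis by blast
qed

lemma square_root_exists:
  assumes "(2::'a::{field,finite}) = 0"
  shows "\<exists>x::'a. x\<^sup>2 = c"
proof -
  have neg: "- y = y" for y :: 'a
  proof -
    have "y + y = 2 * y" by simp
    then have "y + y = 0" using assms by simp
    then show ?thesis by (rule minus_unique)
  qed
  have "inj (\<lambda>x::'a. x\<^sup>2)" by (rule injI) (auto simp: power2_eq_iff neg)
  then have "surj (\<lambda>x::'a. x\<^sup>2)" by (rule finite_UNIV_inj_surj[rotated]) simp
  then show ?thesis by (metis surjD)
qed

lemma quadric_polar_space:
  assumes "nonsingular_quadric (Q :: 'a::{field,finite}^'n \<Rightarrow> 'a)"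
  shows "polar_space id id Q (polar_form Q)"
proof
  have Q: "\<And>c x. Q (c *s x) = c\<^sup>2 * Q x" "\<And>x y z. polar_form Q (x + y) z = polar_form Q x z + polar_form Q y z"
    "\<And>c x z. polar_form Q (c *s x) z = c * polar_form Q x z"
    using assms by (auto simp: nonsingular_quadric_def quadratic_form_def)
  show "polar_form Q (x + y) z = polar_form Q x z + polar_form Q y z" "polar_form Q (c *s x) z = c * polar_form Q x z"
    "Q (c *s x) = c * id c * Q x" for x y z c
    by (simp_all add: Q power2_eq_square)
  show "polar_form Q y x = id (polar_form Q x y)" "Q (x + y) = Q x + Q y + id (polar_form Q x y)" for x y
    by (simp_all add: polar_form_def add.commute)
  show "Q x = 0 \<Longrightarrow> (\<And>y. polar_form Q x y = 0) \<Longrightarrow> x = 0" for x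
    using assms by (auto simp: nonsingular_quadric_def)
  show "\<exists>q>0. \<forall>x::'a. id x = x ^ q" by (intro exI[of _ 1]) simp
  show "(\<And>c. id (c * a) = 0) \<Longrightarrow> a = 0" for a :: 'a by (metis id_apply mult_1)
qed simp_all

text \<open>Two nonzero orthogonal vectors of \<open>P\<close> suffice. In characteristic 2 they
  may be proportional.\<close>

lemma quadric_universal:
  fixes Q :: "'a::{field,finite}^'n \<Rightarrow> 'a"
  assumes "nonsingular_quadric Q" and P: "vec.subspace P" "vec.dim P \<ge> 2" and an: "\<And>z. z \<in> P \<Longrightarrow> Q z = 0 \<Longrightarrow> z = 0"
  shows "\<exists>z\<in>P. Q z = c"
proof -
  interpret polar_space id id Q "polar_form Q" by (rule quadric_polar_space) fact
  obtain u where u: "u \<in> P" "u \<noteq> 0" using nonzero_of_dim[of P] P by auto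
  let ?K = "{v \<in> P. polar_form Q v u = 0}"
  have K: "vec.subspace ?K" "vec.dim P \<le> vec.dim ?K + 1" by (rule subspace_perp_vector[OF P(1)])+
  have "vec.dim ?K \<ge> 1" using K(2) P(2) by linarith
  then obtain v where v: "v \<in> P" "polar_form Q v u = 0" "v \<noteq> 0" using nonzero_of_dim[of ?K] by auto
  have "Q u \<noteq> 0" "Q v \<noteq> 0" using an u v by auto
  then obtain x y where xy: "Q v * x\<^sup>2 + Q u * y\<^sup>2 = c" using diagonal_form_universal by blast
  have "Q (x *s v + y *s u) = c"
    using xy v by (simp add: F_add F_scale b_expand power2_eq_square mult_ac)
  moreover have "x *s v + y *s u \<in> P" using u v by (intro vec.subspace_add[OF P(1)] vec.subspace_scale[OF P(1)])
  ultimately show ?thesis by blast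
qed

text \<open>Let \<open>U\<close> be anisotropic and \<open>u\<close> a nonzero vector in it. The
  vectors of \<open>U\<close> orthogonal to \<open>u\<close> form a space of dimension at least
  2, on which \<open>Q\<close> takes the value \<open>- Q u\<close> in odd characteristic. In
  characteristic 2 this space contains a vector \<open>v\<close> independent of
  \<open>u\<close>, and \<open>Q (v + x *s u)\<close> vanishes for some \<open>x\<close> because
  every element is a square.\<close>

lemma quadric_isotropic:
  fixes Q :: "'a::{field,finite}^'n \<Rightarrow> 'a"
  assumes ns: "nonsingular_quadric Q" and U: "vec.subspace U" "vec.dim U \<ge> 3"
  shows "\<exists>u\<in>U. u \<noteq> 0 \<and> Q u = 0"
proof (rule ccontr)
  assume no: "\<not> ?thesis"
  interpret polar_space id id Q "polar_form Q" by (rule quadric_polar_space) fact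
  obtain u where u: "u \<in> U" "u \<noteq> 0" using nonzero_of_dim[of U] U by auto
  let ?K = "{v \<in> U. polar_form Q v u = 0}"
  have K: "vec.subspace ?K" "vec.dim U \<le> vec.dim ?K + 1" by (rule subspace_perp_vector[OF U(1)])+
  have dK: "vec.dim ?K \<ge> 2" using K(2) U(2) by linarith
  have an: "\<And>z. z \<in> ?K \<Longrightarrow> Q z = 0 \<Longrightarrow> z = 0" using no by auto
  show False
  proof (cases "(2::'a) = 0")
    case False
    obtain z where z: "z \<in> ?K" "Q z = - Q u" using quadric_universal[OF ns K(1) dK an] by blast
    have "Q (z + u) = 0" using z by (simp add: F_add)
    moreover have "z + u \<in> U" using z u by (intro vec.subspace_add[OF U(1)]) auto
    ultimately have "z + u = 0" using no by blast
    then have "z = - u" by (simp add: eq_neg_iff_add_eq_0)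
    then have "polar_form Q u u = 0" using z(1) by (auto simp: b_minus)
    moreover have "Q (u + u) = Q ((1 + 1) *s u)" by (simp only: vec.scale_left_distrib vec.scale_one)
    then have "polar_form Q u u = 2 * Q u" unfolding F_scale F_add by (simp add: algebra_simps)
    ultimately have "Q u = 0" using False by simp
    then show False using no u by blast
  next
    case True
    have "\<not> ?K \<subseteq> vec.span {u}"
    proof
      assume "?K \<subseteq> vec.span {u}"
      then have "vec.dim ?K \<le> vec.dim {u}" by (rule vec.dim_mono)
      also have "\<dots> \<le> 1" using vec.dim_insert[of u "{}"] by simp
      finally show False using dK by simp
    qed
    then obtain v where v: "v \<in> U" "polar_form Q v u = 0" "v \<notin> vec.span {u}" by blast
    then have "Q u \<noteq> 0" using no u by auto
    obtain x :: 'a where x: "x\<^sup>2 = - Q v / Q u" using square_root_exists[OF True] by blast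
    have "Q (v + x *s u) = Q v + x\<^sup>2 * Q u"
      using v by (simp add: F_add F_scale b_expand power2_eq_square)
    then have "Q (v + x *s u) = 0" using x \<open>Q u \<noteq> 0\<close> by simp
    moreover have "v + x *s u \<in> U" using u v by (intro vec.subspace_add[OF U(1)] vec.subspace_scale[OF U(1)])
    ultimately have "v + x *s u = 0" using no by blast
    then have "v = (- x) *s u" by (simp add: eq_neg_iff_add_eq_0)
    then show False using v(3) by (metis mem_span1)
  qed
qed

lemma totally_singular_dim:
  fixes Q :: "'a::{field,finite}^'n \<Rightarrow> 'a"
  assumes "vec.subspace W" "\<And>x. x \<in> W \<Longrightarrow> Q x = 0"
  shows "vec.dim W \<le> witt_index Q"
  unfolding witt_index_def using assms by (intro Max_ge) auto

text \<open>Since the quadric is elliptic it contains no planes, so the complement of a frame is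
  anisotropic. It has dimension 2, hence \<open>Q\<close> takes all values on it.\<close>

theorem quadric_cover_extends:
  fixes Q :: "'a::{field,finite}^6 \<Rightarrow> 'a"
  assumes Q: "elliptic_quadric Q" and H: "nontangent_hyperplane Q (polar_form Q) H"
    and cover: "theta_cover 2 (geometry_diff (variety_geometry Q) (section_geometry Q H))
      (ovoid_geometry (variety_geometry Q) (section_geometry Q H)) f gl"
  shows "extends_to_automorphism (variety_geometry Q) (section_geometry Q H)
      (assoc_map (variety_geometry Q) (section_geometry Q H) gl)"
proof -
  have ns: "nonsingular_quadric Q" and witt: "witt_index Q = 2" using Q by (auto simp: elliptic_quadric_def)
  interpret polar_space id id Q "polar_form Q" by (rule quadric_polar_space) fact
  have full: "vec.dim (UNIV :: ('a^6) set) = 3 + 3" by (simp add: card_cart_basis)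
  have H': "vec.subspace H" "vec.dim H = 3 + 2"
    "\<not> (\<exists>x. x \<noteq> 0 \<and> Q x = 0 \<and> H = {y. polar_form Q x y = 0})"
    using H by (auto simp: nontangent_hyperplane_def)
  have aniso: "z = 0" if fr: "frame w1 w2 w3 w4" and z: "polar_form Q z w1 = 0" "polar_form Q z w2 = 0"
    "polar_form Q z w3 = 0" "polar_form Q z w4 = 0" "Q z = 0" for w1 w2 w3 w4 z
  proof (rule ccontr)
    assume "z \<noteq> 0"
    have fr': "Q w1 = 0" "Q w2 = 0" "polar_form Q w1 w2 = 0" "polar_form Q w2 w3 = 0" "polar_form Q w1 w4 = 0"
      "polar_form Q w1 w3 = - 1" "polar_form Q w2 w4 = 1" using fr b_sym0 by (auto simp: frame_def)
    have zw: "polar_form Q w1 z = 0" "polar_form Q w2 z = 0" using z b_sym0 by blast+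
    have co: "r = 0 \<and> s = 0" if "polar_form Q (r *s w1 + s *s w2) w3 = 0" "polar_form Q (r *s w1 + s *s w2) w4 = 0" for r s
      using that fr' by (simp add: b_expand)
    have "indep2 w1 w2" unfolding indep2_def
    proof (intro allI impI)
      fix r s assume "r *s w1 + s *s w2 = 0"
      then show "r = 0 \<and> s = 0" by (intro co) simp_all
    qed
    then have d2: "vec.dim {w1, w2} = 2" using subspace_dim2[of "vec.span {w1, w2}"] by auto
    have "z \<notin> vec.span {w1, w2}"
    proof
      assume "z \<in> vec.span {w1, w2}"
      then obtain r s where rs: "z = r *s w1 + s *s w2" by (auto simp: mem_span2)
      then have "r = 0 \<and> s = 0" using z(3,4) by (intro co) simp_all
      then show False using rs \<open>z \<noteq> 0\<close> by simp
    qed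
    then have d3: "vec.dim (vec.span {z, w1, w2}) = 3" using d2 by (simp add: vec.dim_insert)
    have "Q x = 0" if x: "x \<in> vec.span {z, w1, w2}" for x
    proof -
      obtain c where "x - c *s z \<in> vec.span {w1, w2}"
        using vec.span_breakdown_eq[THEN iffD1, OF x] by blast
      then obtain r s where "x - c *s z = r *s w1 + s *s w2" by (auto simp: mem_span2)
      then have "x = (r *s w1 + s *s w2) + c *s z" by (simp add: diff_eq_eq)
      then show ?thesis using z(5) fr'(1-3) zw by (simp add: F_add F_scale b_add b_scale b_scale_right)
    qed
    then show False using totally_singular_dim[OF vec.subspace_span, of "{z, w1, w2}" Q] d3 witt by simp
  qed
  have univ: "\<exists>z. polar_form Q z w1 = 0 \<and> polar_form Q z w2 = 0 \<and> polar_form Q z w3 = 0 \<and> polar_form Q z w4 = 0 \<and> Q z = - Q v"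
    if fr: "frame w1 w2 w3 w4" for w1 w2 w3 w4 v
  proof -
    let ?P = "{v \<in> UNIV. polar_form Q v w1 = 0 \<and> polar_form Q v w2 = 0 \<and> polar_form Q v w3 = 0 \<and> polar_form Q v w4 = 0}"
    have P: "vec.subspace ?P" "vec.dim ?P + 4 = vec.dim (UNIV :: ('a^6) set)"
      by (rule perp_frame_dim[OF vec.subspace_UNIV _ _ _ _ fr]; simp)+
    have "vec.dim ?P \<ge> 2" using P(2) full by linarith
    then show ?thesis using quadric_universal[OF ns P(1), of "- Q v"] aniso[OF fr] by auto
  qed
  show ?thesis
  proof (rule nontangent_cover_extends[OF H'(1,2) full H'(3) _ _ _ _ cover])
    show "\<exists>u\<in>U. u \<noteq> 0 \<and> Q u = 0" if "vec.subspace U" "vec.dim U \<ge> 3" for U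
      by (rule quadric_isotropic[OF ns that])
    show "z = 0" if "frame w1 w2 w3 w4" "polar_form Q z w1 = 0" "polar_form Q z w2 = 0" "polar_form Q z w3 = 0" "polar_form Q z w4 = 0"
      "Q z = 0" for w1 w2 w3 w4 z
      by (rule aniso[OF that])
    show "\<exists>z. polar_form Q z w1 = 0 \<and> polar_form Q z w2 = 0 \<and> polar_form Q z w3 = 0 \<and> polar_form Q z w4 = 0 \<and> Q z = - Q v"
      if "frame w1 w2 w3 w4" for w1 w2 w3 w4 v
      by (rule univ[OF that])
  qed simp_all
qed

section \<open>Hermitian varieties\<close>

text \<open>Both identities are forced by the values of the form. The first comes from applying
  the symmetry twice to a value \<open>a\<close>. For the second choose \<open>x, x', u,
  v\<close> with \<open>h u x = a\<close>, \<open>h v x' = c\<close> and \<open>h u x' = h v x =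
  0\<close>. Expanding in the first argument gives \<open>a\<^sup>q + c\<^sup>q\<close> for
  \<open>h (x + x') (u + v)\<close> and \<open>a + c\<close> for \<open>h (u + v) (x +
  x')\<close>.\<close>

lemma hermitian_frobenius:
  fixes h :: "'b::{field,finite}^'n \<Rightarrow> 'b^'n \<Rightarrow> 'b" and a c :: 'b
  assumes h: "nonsingular_hermitian q h" and q: "q > 0" and n: "CARD('n) \<ge> 2"
  shows "(a ^ q) ^ q = a" "(a + c) ^ q = a ^ q + c ^ q"
proof -
  have add: "\<And>x y z. h (x + y) z = h x z + h y z" and scale: "\<And>c x z. h (c *s x) z = c * h x z"
    and sym: "\<And>x y. h y x = h x y ^ q" and ns: "\<And>x. (\<And>y. h x y = 0) \<Longrightarrow> x = 0"
    using h unfolding nonsingular_hermitian_def hermitian_form_def by blast+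
  have full: "vec.dim (UNIV :: ('b^'n) set) \<ge> 2" using n by (simp add: card_cart_basis)
  then have "vec.dim (UNIV :: ('b^'n) set) \<ge> 1" by linarith
  from nonzero_of_dim[OF this] obtain x :: "'b^'n" where x: "x \<noteq> 0" by blast
  obtain y where y: "h x y \<noteq> 0" using ns x by blast
  have inv: "(a ^ q) ^ q = a" for a :: 'b
  proof -
    have "h ((a / h x y) *s x) y = a" using y by (simp add: scale)
    then show ?thesis using sym by metis
  qed
  show "(a ^ q) ^ q = a" by (rule inv)
  let ?K = "{v \<in> UNIV. h v x = 0}"
  have "vec.dim (UNIV :: ('b^'n) set) \<le> vec.dim ?K + 1"
    by (rule dim_functional_kernel[OF vec.subspace_UNIV]) (simp_all add: add scale)
  then have "vec.dim ?K \<ge> 1" using full by linarith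
  then obtain y' where y': "h y' x = 0" "y' \<noteq> 0" using nonzero_of_dim[of ?K] by auto
  obtain x0 where x0: "h y' x0 \<noteq> 0" using ns y' by blast
  let ?x' = "x0 + (- h x0 y / h x y) *s x"
  have xy': "h x y' = 0" "h x0 y' \<noteq> 0" using sym[of x y'] sym[of x0 y'] y' x0 q by auto
  have x'y: "h ?x' y = 0" using y by (simp only: add scale) simp
  have x'y': "h ?x' y' \<noteq> 0" using xy' by (simp only: add scale) simp
  have nz: "h y x \<noteq> 0" "h y' ?x' \<noteq> 0" using sym[of y x] sym[of y' ?x'] y x'y' by auto
  have yx': "h y ?x' = 0" using sym[of y ?x'] x'y q by simp
  let ?u = "(a / h y x) *s y" and ?v = "(c / h y' ?x') *s y'"
  have 1: "h ?u x = a" "h ?v x = 0" "h ?u ?x' = 0" "h ?v ?x' = c"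
    using nz y' yx' by (simp_all only: scale) simp_all
  then have 2: "h x ?u = a ^ q" "h x ?v = 0" "h ?x' ?u = 0" "h ?x' ?v = c ^ q"
    using sym[of x ?u] sym[of x ?v] sym[of ?x' ?u] sym[of ?x' ?v] q by simp_all
  have "h (x + ?x') (?u + ?v) = a ^ q + c ^ q"
    using sym[of x "?u + ?v"] sym[of ?x' "?u + ?v"] 1 by (simp only: add) simp
  moreover have "h (?u + ?v) (x + ?x') = a + c"
    using sym[of ?u "x + ?x'"] sym[of ?v "x + ?x'"] 2 inv by (simp only: add) simp
  ultimately show "(a + c) ^ q = a ^ q + c ^ q" using sym[of "x + ?x'" "?u + ?v"] by simp
qed

lemma card_binomial_roots:
  fixes c d :: "'b::field"
  assumes "n > m"
  shows "card {x. x ^ n = c * x ^ m + d} \<le> n"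
proof -
  let ?p = "monom 1 n - monom c m - [:d:]"
  have "n \<noteq> m" "n \<noteq> 0" using assms by auto
  then have "coeff ?p n = 1" by (simp add: coeff_pCons split: nat.split)
  then have p: "?p \<noteq> 0" by (metis coeff_0 zero_neq_one)
  have "degree ?p \<le> n"
    using assms by (intro degree_diff_le) (auto intro: order_trans[OF degree_monom_le])
  moreover have "{x. poly ?p x = 0} = {x. x ^ n = c * x ^ m + d}"
    by (auto simp: poly_monom algebra_simps)
  ultimately show ?thesis using card_poly_roots_bound[OF p] by auto
qed

text \<open>The norm \<open>a \<mapsto> a * a ^ q\<close> takes values in the set of fixed
  elements of \<open>a \<mapsto> a ^ q\<close>, which has at most \<open>q\<close> elements. Its
  fibres over nonzero elements have at most \<open>q + 1\<close> elements and the fibre over 0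
  has one, so a field of \<open>q\<^sup>2 = 1 + (q - 1) * (q + 1)\<close> elements has at least
  \<open>q\<close> norms.\<close>

lemma norm_surjective:
  fixes c :: "'b::{field,finite}"
  assumes q2: "CARD('b) = q\<^sup>2" and inv: "\<And>a::'b. (a ^ q) ^ q = a" and c: "c ^ q = c"
  shows "\<exists>a. a * a ^ q = c"
proof -
  have q: "q \<ge> 2"
  proof -
    have "card {0, 1 :: 'b} \<le> CARD('b)" by (intro card_mono) auto
    then have "2 \<le> q\<^sup>2" using q2 by simp
    then show ?thesis by (cases "q \<le> 1") (auto simp: le_Suc_eq)
  qed
  let ?N = "\<lambda>a::'b. a * a ^ q" and ?Fix = "{a::'b. a ^ q = a}"
  let ?I = "range ?N"
  have norms: "?I \<subseteq> ?Fix" by (auto simp: power_mult_distrib inv mult.commute)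
  have "?Fix = {a. a ^ q = 1 * a ^ 1 + 0}" by simp
  then have cF: "card ?Fix \<le> q" using card_binomial_roots[of 1 q "1::'b" 0] q by simp
  have fib: "card {a. ?N a = s} \<le> q + 1" for s
    using card_binomial_roots[of 0 "q + 1" "0::'b" s] by simp
  have fib0: "card {a. ?N a = 0} = 1"
  proof -
    have "{a. ?N a = 0} = {0}" using q by auto
    then show ?thesis by simp
  qed
  have 0: "0 \<in> ?I" by (rule range_eqI[of _ _ 0]) simp
  have "(UNIV :: 'b set) = (\<Union>s\<in>?I. {a. ?N a = s})" by auto
  then have "CARD('b) \<le> (\<Sum>s\<in>?I. card {a. ?N a = s})" by (metis card_UN_le finite)
  also have "\<dots> = 1 + (\<Sum>s\<in>?I - {0}. card {a. ?N a = s})" using 0 fib0 by (subst sum.remove[of _ 0]) auto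
  also have "\<dots> \<le> 1 + (\<Sum>s\<in>?I - {0}. q + 1)" by (intro add_left_mono sum_mono fib)
  also have "\<dots> = 1 + (card ?I - 1) * (q + 1)" using 0 by simp
  finally have "q * q \<le> 1 + (card ?I - 1) * (q + 1)" using q2 by (simp add: power2_eq_square)
  moreover have "q * q = 1 + (q - 1) * (q + 1)" using q by (cases q) (auto simp: algebra_simps)
  ultimately have "(q - 1) * (q + 1) \<le> (card ?I - 1) * (q + 1)" by linarith
  then have "q - 1 \<le> card ?I - 1" by (simp only: mult_le_cancel2)
  moreover have "card ?I > 0" using 0 by (auto simp: card_gt_0_iff)
  ultimately have "card ?Fix \<le> card ?I" using cF by linarith
  then have "?I = ?Fix" using card_seteq[OF _ norms] by simp
  then show ?thesis using c by (metis (mono_tags, lifting) imageE mem_Collect_eq)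
qed

lemma trace_nonzero:
  assumes "CARD('b::{field,finite}) = q\<^sup>2" "q \<ge> 2"
  shows "\<exists>d::'b. d + d ^ q \<noteq> 0"
proof (rule ccontr)
  assume *: "\<not> ?thesis"
  have "d ^ q = - 1 * d ^ 1 + 0" for d :: 'b
  proof -
    have "d + d ^ q = 0" using * by blast
    then show ?thesis by (simp add: eq_neg_iff_add_eq_0 add.commute)
  qed
  then have "UNIV = {d::'b. d ^ q = - 1 * d ^ 1 + 0}" by blast
  then have "CARD('b) \<le> q" using card_binomial_roots[of 1 q "- 1 :: 'b" 0] assms by simp
  then show False using assms by (simp add: power2_eq_square)
qed

lemma hermitian_polar_space:
  fixes h :: "'b::{field,finite}^'n \<Rightarrow> 'b^'n \<Rightarrow> 'b"
  assumes q2: "CARD('b) = q\<^sup>2" "q \<ge> 2" and h: "nonsingular_hermitian q h" and n: "CARD('n) \<ge> 2"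
  shows "polar_space (\<lambda>a. a ^ q) (\<lambda>a. a + a ^ q) (\<lambda>x. h x x) h"
proof -
  have q: "q > 0" using q2 by simp
  note frob = hermitian_frobenius[OF h q n]
  have add: "\<And>x y z. h (x + y) z = h x z + h y z" and scale: "\<And>c x z. h (c *s x) z = c * h x z"
    and sym: "\<And>x y. h y x = h x y ^ q" and ns: "\<And>x. (\<And>y. h x y = 0) \<Longrightarrow> x = 0"
    using h unfolding nonsingular_hermitian_def hermitian_form_def by blast+
  have add': "h z (x + y) = h z x + h z y" for x y z by (metis add sym frob(2))
  have scale': "h z (c *s x) = c ^ q * h z x" for c x z by (metis scale sym power_mult_distrib)
  obtain d :: 'b where d: "d + d ^ q \<noteq> 0" using trace_nonzero[OF q2] by blast
  show ?thesis
  proof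
    show "(a + c) ^ q = a ^ q + c ^ q" "(a ^ q) ^ q = a" for a c :: 'b using frob by auto
    show "\<exists>r>0. \<forall>x::'b. x ^ q = x ^ r" using q by blast
    show "(((\<lambda>a. a + a ^ q) = id \<and> (\<lambda>a. a ^ q) = (id :: 'b \<Rightarrow> 'b))) \<or> (\<lambda>a::'b. a + a ^ q) = (\<lambda>a. a + a ^ q)" by simp
    show "a = 0" if "\<And>c. c * a + (c * a) ^ q = 0" for a :: 'b
    proof (rule ccontr)
      assume "a \<noteq> 0"
      then show False using that[of "d / a"] d by simp
    qed
    show "\<exists>c. c + c ^ q = h x x" for x
    proof -
      let ?t = "d + d ^ q" and ?s = "h x x"
      have t: "?t ^ q = ?t" by (simp add: frob add.commute)
      have s: "?s ^ q = ?s" using sym[of x x] by simp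
      let ?c = "d * (?s / ?t)"
      have "?c ^ q = d ^ q * (?s / ?t)" by (simp only: power_mult_distrib power_divide s t)
      then have "?c + ?c ^ q = (d + d ^ q) * (?s / ?t)" by (simp only: distrib_right)
      then have "?c + ?c ^ q = ?s" using d by simp
      then show ?thesis by blast
    qed
    show "h (x + y) (x + y) = h x x + h y y + (h x y + h x y ^ q)" for x y
      using sym[of y x] by (simp add: add add')
    show "h (c *s x) (c *s x) = c * c ^ q * h x x" for c x by (simp add: scale scale')
    show "h y x = h x y ^ q" for x y by (rule sym)
    show "x = 0" if "\<And>y. h x y = 0" for x using ns that by blast
  qed (simp_all add: add scale)
qed

lemma hermitian_diagonal:
  fixes h :: "'b::{field,finite}^'n \<Rightarrow> 'b^'n \<Rightarrow> 'b"
  assumes q2: "CARD('b) = q\<^sup>2" "q \<ge> 2" and h: "nonsingular_hermitian q h" and n: "CARD('n) \<ge> 2" and u: "h u u \<noteq> 0"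
  shows "\<exists>a. a * a ^ q * h u u = - h v v"
proof -
  interpret polar_space "\<lambda>a. a ^ q" "\<lambda>a. a + a ^ q" "\<lambda>x. h x x" h
    by (rule hermitian_polar_space) fact+
  have f: "h x x ^ q = h x x" for x using b_sym[of x x] by simp
  have "(- h v v / h u u) ^ q = - h v v / h u u" by (simp add: power_divide cj_minus f)
  then obtain a where "a * a ^ q = - h v v / h u u" using norm_surjective[OF q2(1)] cj_cj by blast
  then have "a * a ^ q * h u u = - h v v" using u by (simp add: field_simps)
  then show ?thesis by blast
qed

text \<open>The complement of a frame has dimension 1. It is anisotropic because a singular
  vector in it would be orthogonal to the whole space, and it takes all the required values
  because the norm is surjective onto the fixed field.\<close>

theorem hermitian_cover_extends:
  fixes h :: "'b::{field,finite}^5 \<Rightarrow> 'b^5 \<Rightarrow> 'b"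
  assumes q2: "CARD('b) = q\<^sup>2" and h: "nonsingular_hermitian q h" and H: "nontangent_hyperplane (\<lambda>x. h x x) h H"
    and cover: "theta_cover (q + 1) (geometry_diff (variety_geometry (\<lambda>x. h x x)) (section_geometry (\<lambda>x. h x x) H))
      (ovoid_geometry (variety_geometry (\<lambda>x. h x x)) (section_geometry (\<lambda>x. h x x) H)) f gl"
  shows "extends_to_automorphism (variety_geometry (\<lambda>x. h x x)) (section_geometry (\<lambda>x. h x x) H)
      (assoc_map (variety_geometry (\<lambda>x. h x x)) (section_geometry (\<lambda>x. h x x) H) gl)"
proof -
  have q: "q \<ge> 2"
  proof -
    have "card {0, 1 :: 'b} \<le> CARD('b)" by (intro card_mono) auto
    then have "2 \<le> q\<^sup>2" using q2 by simp
    then show ?thesis by (cases "q \<le> 1") (auto simp: le_Suc_eq)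
  qed
  have n: "CARD(5) \<ge> 2" by simp
  interpret polar_space "\<lambda>a. a ^ q" "\<lambda>a. a + a ^ q" "\<lambda>x. h x x" h
    by (rule hermitian_polar_space) fact+
  have full: "vec.dim (UNIV :: ('b^5) set) = 2 + 3" by (simp add: card_cart_basis)
  have H': "vec.subspace H" "vec.dim H = 2 + 2"
    "\<not> (\<exists>x. x \<noteq> 0 \<and> h x x = 0 \<and> H = {y. h x y = 0})"
    using H by (auto simp: nontangent_hyperplane_def)
  have iso: "\<exists>u\<in>U. u \<noteq> 0 \<and> h u u = 0" if U: "vec.subspace U" "vec.dim U \<ge> 2" for U
  proof -
    obtain u where u: "u \<in> U" "u \<noteq> 0" using nonzero_of_dim[of U] U by auto
    let ?K = "{v \<in> U. h v u = 0}"
    have K: "vec.dim U \<le> vec.dim ?K + 1" by (rule subspace_perp_vector[OF U(1)])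
    have "vec.dim ?K \<ge> 1" using K U(2) by linarith
    then obtain v where v: "v \<in> U" "h v u = 0" "v \<noteq> 0" using nonzero_of_dim[of ?K] by auto
    show ?thesis
    proof (cases "h u u = 0 \<or> h v v = 0")
      case False
      then obtain a where a: "a * a ^ q * h u u = - h v v" using hermitian_diagonal[OF q2 q h n] by blast
      let ?x = "v + a *s u"
      have uv: "h u v = 0" using v b_sym0 by blast
      have "h ?x ?x = 0" using a v uv by (simp add: b_expand mult_ac)
      moreover have "h ?x v \<noteq> 0" using False uv by (simp add: b_expand)
      then have "?x \<noteq> 0" by auto
      moreover have "?x \<in> U" using u v by (intro vec.subspace_add[OF U(1)] vec.subspace_scale[OF U(1)])
      ultimately show ?thesis by blast
    qed (use u v in blast)
  qed
  have P: "vec.dim {v \<in> UNIV. h v w1 = 0 \<and> h v w2 = 0 \<and> h v w3 = 0 \<and> h v w4 = 0} = 1"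
      "vec.subspace {v \<in> UNIV. h v w1 = 0 \<and> h v w2 = 0 \<and> h v w3 = 0 \<and> h v w4 = 0}"
    if fr: "frame w1 w2 w3 w4" for w1 w2 w3 w4
    using perp_frame_dim[OF vec.subspace_UNIV _ _ _ _ fr] full by simp_all
  have aniso: "z = 0" if fr: "frame w1 w2 w3 w4" and z: "h z w1 = 0" "h z w2 = 0" "h z w3 = 0" "h z w4 = 0" "h z z = 0"
    for w1 w2 w3 w4 z
  proof (rule nonsingular)
    show "h z z = 0" by fact
    fix v
    let ?D = "{v \<in> UNIV. h v w1 = 0 \<and> h v w2 = 0 \<and> h v w3 = 0 \<and> h v w4 = 0}"
    obtain p where p: "?D = vec.span {p}" using P[OF fr] subspace_dim_le_1[of ?D] by auto
    have fr': "h w1 w1 = 0" "h w1 w2 = 0" "h w1 w3 = - 1" "h w1 w4 = 0" "h w2 w1 = 0" "h w2 w2 = 0" "h w2 w3 = 0" "h w2 w4 = 1"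
      "h w3 w1 = - 1" "h w3 w2 = 0" "h w3 w3 = 0" "h w3 w4 = 0" "h w4 w1 = 0" "h w4 w2 = 1" "h w4 w3 = 0" "h w4 w4 = 0"
      using fr b_sym0 b_sym[of w3 w1] b_sym[of w4 w2] unfolding frame_def by (auto simp: cj_minus)
    let ?w = "(- h v w3) *s w1 + h v w4 *s w2 + (- h v w1) *s w3 + h v w2 *s w4"
    have "v - ?w \<in> ?D" by (simp add: b_expand fr')
    then obtain c where c: "v - ?w = c *s p" unfolding p by (auto simp: mem_span1)
    have "z \<in> ?D" using z by simp
    then obtain d where d: "z = d *s p" unfolding p mem_span1 by blast
    have "h z ?w = 0" using z by (simp only: b_add_right b_scale_right) simp
    moreover have "h z (c *s p) = 0"
    proof (cases "d = 0")
      case False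
      have "d * d ^ q * h p p = 0" using z(5) by (auto simp: d b_expand)
      then have "h p p = 0" using False by simp
      then show ?thesis by (auto simp: d b_expand)
    qed (simp add: d)
    moreover have "v = ?w + c *s p" using c by (simp add: diff_eq_eq add.commute)
    ultimately show "h z v = 0" using b_add_right[of z ?w "c *s p"] by simp
  qed
  have univ: "\<exists>z. h z w1 = 0 \<and> h z w2 = 0 \<and> h z w3 = 0 \<and> h z w4 = 0 \<and> h z z = - h v v"
    if fr: "frame w1 w2 w3 w4" for w1 w2 w3 w4 v
  proof -
    let ?D = "{v \<in> UNIV. h v w1 = 0 \<and> h v w2 = 0 \<and> h v w3 = 0 \<and> h v w4 = 0}"
    have "vec.dim ?D \<ge> 1" using P(1)[OF fr] by simp
    then obtain p where p: "p \<in> ?D" "p \<noteq> 0" using nonzero_of_dim[of ?D] by blast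
    then have "h p p \<noteq> 0" using aniso[OF fr, of p] by auto
    then obtain a where a: "a * a ^ q * h p p = - h v v" using hermitian_diagonal[OF q2 q h n] by blast
    then have "h (a *s p) (a *s p) = - h v v" by (simp add: b_expand mult_ac)
    then show ?thesis using p by (intro exI[of _ "a *s p"]) (simp add: b_scale)
  qed
  show ?thesis
  proof (rule nontangent_cover_extends[OF H'(1,2) full H'(3) _ _ _ _ cover])
    show "\<exists>u\<in>U. u \<noteq> 0 \<and> h u u = 0" if "vec.subspace U" "vec.dim U \<ge> 2" for U
      by (rule iso[OF that])
    show "z = 0" if "frame w1 w2 w3 w4" "h z w1 = 0" "h z w2 = 0" "h z w3 = 0" "h z w4 = 0"
      "h z z = 0" for w1 w2 w3 w4 z
      by (rule aniso[OF that])
    show "\<exists>z. h z w1 = 0 \<and> h z w2 = 0 \<and> h z w3 = 0 \<and> h z w4 = 0 \<and> h z z = - h v v"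
      if "frame w1 w2 w3 w4" for w1 w2 w3 w4 v
      by (rule univ[OF that])
  qed simp_all
qed

theorem theorem10p5:
  shows
   "(\<forall>(Q :: 'a::{field,finite}^6 \<Rightarrow> 'a) H \<gamma>\<^sub>P \<gamma>\<^sub>L.
       let S = variety_geometry Q; S' = section_geometry Q H in
         elliptic_quadric Q \<and> nontangent_hyperplane Q (polar_form Q) H \<and>
         theta_cover 2 (geometry_diff S S') (ovoid_geometry S S') \<gamma>\<^sub>P \<gamma>\<^sub>L
         \<longrightarrow> extends_to_automorphism S S' (assoc_map S S' \<gamma>\<^sub>L))
    \<and>
    (\<forall>q (h :: 'b::{field,finite}^5 \<Rightarrow> 'b^5 \<Rightarrow> 'b) H \<gamma>\<^sub>P \<gamma>\<^sub>L.
       let S = variety_geometry (\<lambda>x. h x x); S' = section_geometry (\<lambda>x. h x x) H in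
         CARD('b) = q\<^sup>2 \<and> nonsingular_hermitian q h \<and> nontangent_hyperplane (\<lambda>x. h x x) h H \<and>
         theta_cover (q + 1) (geometry_diff S S') (ovoid_geometry S S') \<gamma>\<^sub>P \<gamma>\<^sub>L
         \<longrightarrow> extends_to_automorphism S S' (assoc_map S S' \<gamma>\<^sub>L))"
  unfolding Let_def
  by (intro conjI allI impI; elim conjE)
    (rule quadric_cover_extends hermitian_cover_extends; assumption)+

end
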